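(* Let $\beta>0$. If $h_c(\beta)=-\beta$, then $$\mathtt F(\beta,-\beta+u)=o(\mathtt F(0,u))\qquad\text{as }u\searrow0.$$ In particular, in presence of infinite disorder, i.e. if $\liminf_{n\to\infty}-\frac1n\log\mathbb P(\omega_1=+1,\ldots,\omega_n=+1)=0$, this holds for all $\beta>0$.
   Context: Renewal process: $\tau=(\tau_i)_{i\ge 0}$ has law $\mathbf P$ (expectation $\mathbf E$), $\tau_0=0$, and the increments $(\tau_i-\tau_{i-1})_{i\ge1}$ are i.i.d. with values in $\mathbb N=\{1,2,\ldots\}$ and law $K(n):=\mathbf P(\tau_1=n)$. The renewal is recurrent, $\mathbf P(\tau_1=+\infty)=0$, and $K(n)=(1+o(1))\,c_K n^{-(1+\alpha)}$ as $n\to\infty$ for some $\alpha>0$, $\alpha\neq1$, and $c_K>0$. Set $\delta_n:=\mathbf 1_{\{n\in\{\tau_0,\tau_1,\ldots\}\}}$. Environment: $\omega=(\omega_i)_{i\ge0}$ is a stationary ergodic random sequence with values in $\{-1,+1\}$, with law $\mathbb P$ (independent of $\tau$), non-trivial in the sense that $\mathbb P(\omega_1=+1)>0$ and $\mathbb P(\omega_1=-1)>0$. Pinning model: for $h\in\mathbb R$, $\beta\ge0$, $Z_{N,h}^{\omega,\beta}:=\mathbf E\big[\exp\big(\sum_{n=1}^N(h+\beta\omega_n)\delta_n\big)\big]$. The quenched free energy $\mathtt F(\beta,h):=\lim_{N\to\infty}\frac1N\log Z_{N,h}^{\omega,\beta}$ exists and is $\mathbb P$-a.s. constant; $h\mapsto\mathtt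 F(\beta,h)$ is convex, non-negative and non-decreasing. The quenched critical point $h_c(\beta)$ is such that $\mathtt F(\beta,h)>0$ if and only if $h>h_c(\beta)$. The homogeneous model corresponds to $\beta=0$, with free energy $\mathtt F(0,u)$ and critical point $h_c(0)=0$. *)

theory Defs
  imports "HOL-Probability.Probability" "HOL-Library.Landau_Symbols"
begin

(* The renewal times are natural numbers, so they are finite and the renewal is recurrent. *)
locale renewal_process = prob_space P
  for P :: "'a measure" and \<tau> :: "nat \<Rightarrow> 'a \<Rightarrow> nat" +
  assumes start: "\<And>x. x \<in> space P \<Longrightarrow> \<tau> 0 x = 0"
    and increasing: "\<And>i x. x \<in> space P \<Longrightarrow> \<tau> i x < \<tau> (Suc i) x"
    and indep_increments:
      "indep_vars (\<lambda>_. count_space UNIV) (\<lambda>i x. \<tau> (Suc i) x - \<tau> i x) UNIV"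
    and identically_distributed:
      "\<And>i. distr P (count_space UNIV) (\<lambda>x. \<tau> (Suc i) x - \<tau> i x) =
            distr P (count_space UNIV) (\<lambda>x. \<tau> 1 x - \<tau> 0 x)"

definition inter_arrival_law :: "'a measure \<Rightarrow> (nat \<Rightarrow> 'a \<Rightarrow> nat) \<Rightarrow> nat \<Rightarrow> real" where
  "inter_arrival_law P \<tau> n = measure P {x \<in> space P. \<tau> 1 x = n}"

definition sequence_law :: "'b measure \<Rightarrow> (nat \<Rightarrow> 'b \<Rightarrow> real) \<Rightarrow> (nat \<Rightarrow> real) measure" where
  "sequence_law M \<omega> = distr M (PiM UNIV (\<lambda>_. borel)) (\<lambda>x i. \<omega> i x)"

locale environment = prob_space M
  for M :: "'b measure" and \<omega> :: "nat \<Rightarrow> 'b \<Rightarrow> real" +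
  assumes random_variables: "\<And>i. random_variable borel (\<omega> i)"
    and plus_minus: "\<And>i x. x \<in> space M \<Longrightarrow> \<omega> i x \<in> {-1, 1}"
    and stationary: "sequence_law M (\<lambda>i. \<omega> (Suc i)) = sequence_law M \<omega>"
    and ergodic: "\<And>A. A \<in> sets (PiM UNIV (\<lambda>_. borel)) \<Longrightarrow>
        {s. (\<lambda>i. s (Suc i)) \<in> A} = A \<Longrightarrow> measure (sequence_law M \<omega>) A \<in> {0, 1}"
    and nontrivial_plus: "prob {x \<in> space M. \<omega> 1 x = 1} > 0"
    and nontrivial_minus: "prob {x \<in> space M. \<omega> 1 x = -1} > 0"

(* The environment is a fixed sequence w here: the integral is over the renewal only,
   which is how the independence of renewal and environment enters. *)
definition partition_function ::
    "'a measure \<Rightarrow> (nat \<Rightarrow> 'a \<Rightarrow> nat) \<Rightarrow> real \<Rightarrow> real \<Rightarrow> (nat \<Rightarrow> real) \<Rightarrow> nat \<Rightarrow> real" where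
  "partition_function P \<tau> \<beta> h w N =
     (\<integral>x. exp (\<Sum>n=1..N. (h + \<beta> * w n) * indicator (range (\<lambda>i. \<tau> i x)) n) \<partial>P)"

definition free_energy ::
    "'a measure \<Rightarrow> (nat \<Rightarrow> 'a \<Rightarrow> nat) \<Rightarrow> 'b measure \<Rightarrow> (nat \<Rightarrow> 'b \<Rightarrow> real) \<Rightarrow>
      real \<Rightarrow> real \<Rightarrow> real" where
  "free_energy P \<tau> M \<omega> \<beta> h =
     (THE c. AE x in M.
        (\<lambda>N. 1 / real N * ln (partition_function P \<tau> \<beta> h (\<lambda>i. \<omega> i x) N)) \<longlonglongrightarrow> c)"

definition critical_point ::
    "'a measure \<Rightarrow> (nat \<Rightarrow> 'a \<Rightarrow> nat) \<Rightarrow> 'b measure \<Rightarrow> (nat \<Rightarrow> 'b \<Rightarrow> real) \<Rightarrow> real \<Rightarrow> real"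
  where
  "critical_point P \<tau> M \<omega> \<beta> =
     (THE hc. \<forall>h. free_energy P \<tau> M \<omega> \<beta> h > 0 \<longleftrightarrow> h > hc)"

(* The convention - log 0 = \<infinity> is made explicit, since ln 0 = 0 on the reals. *)
definition all_plus_rate :: "'b measure \<Rightarrow> (nat \<Rightarrow> 'b \<Rightarrow> real) \<Rightarrow> nat \<Rightarrow> ereal" where
  "all_plus_rate M \<omega> n =
     (let p = measure M {x \<in> space M. \<forall>i\<in>{1..n}. \<omega> i x = 1}
      in if p = 0 then \<infinity> else ereal (- (1 / real n) * ln p))"

definition infinite_disorder :: "'b measure \<Rightarrow> (nat \<Rightarrow> 'b \<Rightarrow> real) \<Rightarrow> bool" where
  "infinite_disorder M \<omega> \<longleftrightarrow> liminf (all_plus_rate M \<omega>) = 0"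

end

theory Submission
  imports Defs "HOL-Real_Asymp.Real_Asymp"
begin

text \<open>
  Write K for the law of the inter-arrival times and v(n) for the weight of a contact at n, so that
  with h = -\<beta> + u a contact has weight e^u at a positive spin and e^(u-2\<beta>) at a negative one.
  Conditioning on the first renewal turns the partition function into the solution \<open>Z\<close> of a renewal
  equation in which the environment is a fixed sequence of weights (\<open>partition_function_eq_Z\<close>).
  Almost every argument below is then an induction along this equation; probability enters only through
  the environment.

  \<^bold>\<open>The free energy.\<close> Let \<open>B\<close> be the largest partition function of a block over all
  positions of its first contact. Restarting the renewal at the first contact of each block shows that
  \<open>B\<close> is exactly submultiplicative (\<open>B_submult\<close>), while the power law of K makes \<open>Z\<close>
  supermultiplicative up to a factor polynomial in the block length (\<open>Z_concat\<close>), and \<open>B\<close> and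
  \<open>Z\<close> agree up to such a factor (\<open>B_le_Z\<close>). Averaging the two block bounds over the offset of
  the blocks and applying Birkhoff's theorem to the bounded functions log \<open>B\<close> and log \<open>Z\<close>
  of a block of length m encloses the limit points of (1/N) log Z_N in an interval whose length is of order
  (log m)/m. Hence the limit exists almost surely, is constant, and is also the limit of
  the expectations (\<open>free_energy_exists\<close>), so that bounds for E log Z_N suffice from there on.

  \<^bold>\<open>Negligibility.\<close> In the homogeneous model the gain per contact is u. The point is that, from most
  sites, the probability that the next jump ends at a negative spin outweighs this gain. If \<alpha> > 1, call a
  site good when some negative spin lies at a distance between \<open>n0\<close> and L ahead. From a good site the next jump reaches that spin
  with probability bounded below, so for small u one step multiplies the mean weight by at most 1, while a bad
  site costs at most e^u. Therefore F(\<beta>,-\<beta>+u) \<le> u p_L, where p_L is the density of bad sites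
  (\<open>F_le_site\<close>); it tends to 0 as L\<rightarrow>\<infinity> by ergodicity, whereas F(0,u) \<ge> c u because the mean
  inter-arrival time is finite (\<open>homogeneous_linear\<close>).

  If \<alpha> < 1, then F(0,u) is only of order u^(1/\<alpha>), so the gain has to be controlled on blocks of the
  correlation length. Choose m of order u^(-1/\<alpha>) with a small constant: a jump of length
  in [m,2m) then has probability at least a multiple of u that is as large as desired. In a block whose windows ahead contain their share of
  negative spins, a contact is therefore followed by a penalised one often enough to offset the gain
  u. In a sparse block the probability of leaving it at the next jump still bounds the total factor
  by 2 (\<open>Z_le_blocks\<close>). Hence F(\<beta>,-\<beta>+u) \<le> (u + \<rho>_m log 2)/m, where the
  probability \<rho>_m of a sparse block tends to 0 (\<open>F_le_block\<close>), whereas F(0,u) \<ge> c/m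
  (\<open>homogeneous_power\<close>).

  \<^bold>\<open>Infinite disorder.\<close> For every \<epsilon> > 0 there are arbitrarily large n for which positive runs of length n have probability p_n \<ge> e^(-\<epsilon> n).
  Let the
  renewal visit only the fully positive blocks of length n. Each visit earns l n with l > 0 depending on u only,
  and a jump of length d costs (1+\<alpha>)log d up to a constant. The tangent bound log d \<le> log r + d/r with r = n/p_n
  makes the total cost additive, and the gain dominates when \<epsilon> is small against l
  (\<open>F_pos_of_long_plus_blocks\<close>). So the free energy is positive exactly for h > -\<beta>, which
  identifies the critical point (\<open>critical_point_eq\<close>).
\<close>

section \<open>The renewal equation\<close>

locale renewal_kernel =
  fixes K :: "nat \<Rightarrow> real"
  assumes K_nonneg: "\<And>n. 0 \<le> K n"
    and K_zero: "K 0 = 0"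
    and K_sums: "K sums 1"
begin

text \<open>
  The probability that an inter-arrival time exceeds n, written through a finite sum so that the
  renewal equation stays algebraic.
\<close>
definition tail :: "nat \<Rightarrow> real" where
  "tail n = 1 - sum K {1..n}"

text \<open>
  Partition function with free end, started from a contact at x and run over the next n sites; the
  weight of the starting contact is not included. Absolute positions in v make translations of the
  environment visible in the argument x.
\<close>
function Z :: "(nat \<Rightarrow> real) \<Rightarrow> nat \<Rightarrow> nat \<Rightarrow> real" where
  "Z v x n = tail n + (\<Sum>a=1..n. K a * v (x + a) * Z v (x + a) (n - a))"
  by auto
termination by (relation "Wellfounded.measure (\<lambda>(v, x, n). n)") auto

declare Z.simps [simp del]

lemma tail_split: "e \<le> n \<Longrightarrow> tail e = tail n + sum K {e<..n}"
proof -
  assume "e \<le> n"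
  then have "{1..n} = {1..e} \<union> {e<..n}" "{1..e} \<inter> {e<..n} = {}" by auto
  then show ?thesis by (simp add: tail_def sum.union_disjoint)
qed

lemma tail_suminf: "(\<lambda>N. sum K {n<..N}) \<longlonglongrightarrow> tail n"
proof -
  have "(\<lambda>N. sum K {..N}) \<longlonglongrightarrow> 1"
    using K_sums by (simp add: sums_def_le)
  then have "(\<lambda>N. sum K {..N} - sum K {1..n}) \<longlonglongrightarrow> tail n"
    unfolding tail_def by (intro tendsto_diff) auto
  moreover have "eventually (\<lambda>N. sum K {..N} - sum K {1..n} = sum K {n<..N}) sequentially"
    using eventually_ge_at_top[of n]
  proof eventually_elim
    case (elim N)
    have "{..N} = insert 0 ({1..n} \<union> {n<..N})" "{1..n} \<inter> {n<..N} = {}" using elim by auto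
    then show ?case by (simp add: sum.union_disjoint K_zero)
  qed
  ultimately show ?thesis by (rule Lim_transform_eventually)
qed

lemma tail_ge_sum: "sum K {n<..N} \<le> tail n"
proof -
  have "incseq (\<lambda>N. sum K {n<..N})"
    by (intro incseq_SucI sum_mono2) (auto simp: K_nonneg)
  from incseq_le[OF this tail_suminf] show ?thesis .
qed

lemma tail_le: "(\<And>N. sum K {n<..N} \<le> c) \<Longrightarrow> tail n \<le> c"
  by (rule LIMSEQ_le_const2[OF tail_suminf]) auto

lemma tail_nonneg: "0 \<le> tail n"
  using tail_ge_sum[of n n] by simp

lemma tail_le_1: "tail n \<le> 1"
  unfolding tail_def by (simp add: sum_nonneg K_nonneg)

lemma tail_0: "tail 0 = 1" by (simp add: tail_def)

lemma tail_plus_sum: "tail n + sum K {1..n} = 1"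
  by (simp add: tail_def)

lemma tail_tendsto_0: "tail \<longlonglongrightarrow> 0"
proof -
  have "(\<lambda>N. 1 - sum K {0<..N}) \<longlonglongrightarrow> 1 - 1"
    using tail_suminf[of 0] by (intro tendsto_diff) (auto simp: tail_0)
  moreover have "{0<..N} = {1..N}" for N :: nat by auto
  ultimately show ?thesis unfolding tail_def by (simp add: fun_eq_iff)
qed

lemma tail_mono: "m \<le> n \<Longrightarrow> tail n \<le> tail m"
  using tail_split[of m n] by (simp add: sum_nonneg K_nonneg)

lemma Z_shift: "Z (\<lambda>i. v (i + j)) x n = Z v (x + j) n"
proof (induction n arbitrary: x rule: less_induct)
  case (less n)
  have "(\<Sum>a=1..n. K a * v (x + a + j) * Z (\<lambda>i. v (i + j)) (x + a) (n - a))
      = (\<Sum>a=1..n. K a * v (x + j + a) * Z v (x + j + a) (n - a))"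
    using less by (intro sum.cong refl) (auto simp: ac_simps)
  then show ?case by (subst (1 2) Z.simps) simp
qed

lemma Z_nonneg:
  assumes "\<And>i. 0 \<le> v i" shows "0 \<le> Z v x n"
proof (induction n arbitrary: x rule: less_induct)
  case (less n)
  have "0 \<le> (\<Sum>a=1..n. K a * v (x + a) * Z v (x + a) (n - a))"
    using less assms K_nonneg by (intro sum_nonneg mult_nonneg_nonneg) auto
  then show ?case using tail_nonneg[of n] by (subst Z.simps) simp
qed

lemma Z_ge_tail: "(\<And>i. 0 \<le> v i) \<Longrightarrow> tail n \<le> Z v x n"
  by (subst Z.simps) (auto intro!: sum_nonneg mult_nonneg_nonneg Z_nonneg K_nonneg)

lemma Z_ge_step:
  assumes "\<And>i. 0 \<le> v i" "1 \<le> a" "a \<le> n"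
  shows "K a * v (x + a) * Z v (x + a) (n - a) \<le> Z v x n"
proof -
  have "K a * v (x + a) * Z v (x + a) (n - a) \<le> (\<Sum>a=1..n. K a * v (x + a) * Z v (x + a) (n - a))"
    by (rule member_le_sum) (use assms in \<open>auto intro!: mult_nonneg_nonneg Z_nonneg K_nonneg\<close>)
  then show ?thesis using tail_nonneg[of n] by (subst Z.simps) simp
qed

text \<open>
  Comparison principle: a supersolution of the renewal equation dominates its solution. The two upper
  bounds behind the theorem consist in finding the right supersolution.
\<close>
lemma Z_le_potential:
  assumes v: "\<And>i. 0 \<le> v i"
    and super: "\<And>x n. x + n = N \<Longrightarrow> tail n + (\<Sum>a=1..n. K a * v (x + a) * \<Phi> (x + a)) \<le> \<Phi> x"
    and "x + n = N"
  shows "Z v x n \<le> \<Phi> x"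
  using \<open>x + n = N\<close>
proof (induction n arbitrary: x rule: less_induct)
  case (less n)
  have "(\<Sum>a=1..n. K a * v (x + a) * Z v (x + a) (n - a)) \<le> (\<Sum>a=1..n. K a * v (x + a) * \<Phi> (x + a))"
    using less v by (intro sum_mono mult_left_mono less.IH) (auto intro!: mult_nonneg_nonneg K_nonneg)
  then show ?case using super[OF less.prems] by (subst Z.simps) simp
qed

text \<open>
  The part of the renewal equation, started at x, in which the first jump passes over the site e: all
  the information about the environment to the right of e that the part to its left can feel.
\<close>
definition crossing :: "(nat \<Rightarrow> real) \<Rightarrow> nat \<Rightarrow> nat \<Rightarrow> nat \<Rightarrow> real" where
  "crossing v N e x = tail (N - x) + (\<Sum>y\<in>{e<..N}. K (y - x) * v y * Z v y (N - y))"

lemma Z_abs: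
  assumes "x \<le> N"
  shows "Z v x (N - x) = tail (N - x) + (\<Sum>y\<in>{x<..N}. K (y - x) * v y * Z v y (N - y))"
proof -
  have "(\<Sum>a=1..N-x. K a * v (x + a) * Z v (x + a) (N - x - a))
      = (\<Sum>y\<in>{x<..N}. K (y - x) * v y * Z v y (N - y))"
    by (rule sum.reindex_bij_witness[of _ "\<lambda>y. y - x" "\<lambda>a. x + a"]) (use assms in auto)
  then show ?thesis by (subst Z.simps) simp
qed

lemma Z_abs_crossing:
  assumes "x \<le> e" "e \<le> N"
  shows "Z v x (N - x) = crossing v N e x + (\<Sum>y\<in>{x<..e}. K (y - x) * v y * Z v y (N - y))"
proof -
  have "{x<..N} = {x<..e} \<union> {e<..N}" "{x<..e} \<inter> {e<..N} = {}" using assms by auto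
  then show ?thesis using assms by (subst Z_abs) (auto simp: crossing_def sum.union_disjoint)
qed

lemma crossing_ge_step:
  assumes "\<And>i. 0 \<le> v i" "e < y" "y \<le> N"
  shows "K (y - x) * v y * Z v y (N - y) \<le> crossing v N e x"
proof -
  have "K (y - x) * v y * Z v y (N - y) \<le> (\<Sum>y\<in>{e<..N}. K (y - x) * v y * Z v y (N - y))"
    by (rule member_le_sum) (use assms in \<open>auto intro!: mult_nonneg_nonneg Z_nonneg K_nonneg\<close>)
  then show ?thesis using tail_nonneg[of "N - x"] by (simp add: crossing_def)
qed

text \<open>
  In the system cut at e, the term \<open>tail (e - a)\<close> accounts for the last jump from a over
  e; in the full system the same jump contributes \<open>crossing\<close>. A uniform ratio between the
  two passes to the partition functions.
\<close>
lemma Z_ge_crossing: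
  assumes v: "\<And>i. 0 \<le> v i" and "0 \<le> \<rho>" and "x \<le> e" "e \<le> N"
    and cr: "\<And>a. x \<le> a \<Longrightarrow> a \<le> e \<Longrightarrow> \<rho> * tail (e - a) \<le> crossing v N e a"
  shows "\<rho> * Z v x (e - x) \<le> Z v x (N - x)"
  using \<open>x \<le> e\<close> cr
proof (induction "e - x" arbitrary: x rule: less_induct)
  case less
  have "(\<Sum>y\<in>{x<..e}. K (y - x) * v y * (\<rho> * Z v y (e - y)))
     \<le> (\<Sum>y\<in>{x<..e}. K (y - x) * v y * Z v y (N - y))"
    using less v by (intro sum_mono mult_left_mono less.hyps) (auto intro!: mult_nonneg_nonneg K_nonneg)
  moreover have "\<rho> * tail (e - x) \<le> crossing v N e x" using less by auto
  ultimately show ?case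
    using less.prems(1) \<open>e \<le> N\<close>
    by (subst Z_abs, simp, subst Z_abs_crossing[of x e N]) 
       (auto simp: algebra_simps sum_distrib_left)
qed

lemma Z_le_crossing:
  assumes v: "\<And>i. 0 \<le> v i" and "x \<le> e" "e \<le> N"
    and cr: "\<And>a. x \<le> a \<Longrightarrow> a \<le> e \<Longrightarrow> crossing v N e a \<le> \<rho> * tail (e - a)"
  shows "Z v x (N - x) \<le> \<rho> * Z v x (e - x)"
  using \<open>x \<le> e\<close> cr
proof (induction "e - x" arbitrary: x rule: less_induct)
  case less
  have "(\<Sum>y\<in>{x<..e}. K (y - x) * v y * Z v y (N - y))
     \<le> (\<Sum>y\<in>{x<..e}. K (y - x) * v y * (\<rho> * Z v y (e - y)))"
    using less v by (intro sum_mono mult_left_mono less.hyps) (auto intro!: mult_nonneg_nonneg K_nonneg)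
  moreover have "crossing v N e x \<le> \<rho> * tail (e - x)" using less by auto
  ultimately show ?case
    using less.prems(1) \<open>e \<le> N\<close>
    by (subst (2) Z_abs, simp, subst Z_abs_crossing[of x e N]) 
       (auto simp: algebra_simps sum_distrib_left)
qed

text \<open>
  The first contact inside a block may fall anywhere, so the weight of a block is maximised over that
  position; the value 1 accounts for a block without contact.
\<close>
definition B :: "(nat \<Rightarrow> real) \<Rightarrow> nat \<Rightarrow> nat \<Rightarrow> real" where
  "B v x n = Max (insert 1 ((\<lambda>a. v (x + a) * Z v (x + a) (n - a)) ` {1..n}))"

lemma B_ge_1: "1 \<le> B v x n"
  unfolding B_def by (rule Max_ge) auto

lemma B_ge: "1 \<le> a \<Longrightarrow> a \<le> n \<Longrightarrow> v (x + a) * Z v (x + a) (n - a) \<le> B v x n"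
  unfolding B_def by (rule Max_ge) auto

lemma B_le: 
  assumes "1 \<le> c" "\<And>a. 1 \<le> a \<Longrightarrow> a \<le> n \<Longrightarrow> v (x + a) * Z v (x + a) (n - a) \<le> c"
  shows "B v x n \<le> c"
  unfolding B_def using assms by (subst Max_le_iff) auto

lemma B_shift: "B (\<lambda>i. v (i + j)) x n = B v (x + j) n"
  unfolding B_def by (simp add: Z_shift ac_simps)

text \<open>
  The first contact after e has total weight at most \<open>B\<close>, whichever contact it was
  reached from. No polynomial factor is lost, because this weight is bounded uniformly in the position
  of that contact.
\<close>
lemma Z_split_le:
  assumes v: "\<And>i. 0 \<le> v i" and "x \<le> e" "e \<le> N"
  shows "Z v x (N - x) \<le> B v e (N - e) * Z v x (e - x)"
proof (rule Z_le_crossing[OF v assms(2,3)])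
  fix a assume a: "x \<le> a" "a \<le> e"
  have "(\<Sum>y\<in>{e<..N}. K (y - a) * v y * Z v y (N - y)) \<le> (\<Sum>y\<in>{e<..N}. K (y - a) * B v e (N - e))"
  proof (intro sum_mono)
    fix y assume y: "y \<in> {e<..N}"
    have "v y * Z v y (N - y) \<le> B v e (N - e)"
      using B_ge[of "y - e" "N - e" v e] y by auto
    then show "K (y - a) * v y * Z v y (N - y) \<le> K (y - a) * B v e (N - e)"
      using K_nonneg by (simp add: mult.assoc mult_left_mono)
  qed
  also have "\<dots> = B v e (N - e) * (\<Sum>y\<in>{e<..N}. K (y - a))"
    by (simp add: sum_distrib_left mult.commute)
  also have "(\<Sum>y\<in>{e<..N}. K (y - a)) = sum K {e - a<..N - a}"
    by (rule sum.reindex_bij_witness[of _ "\<lambda>y. y + a" "\<lambda>y. y - a"]) (use a in auto)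
  finally have 1: "(\<Sum>y\<in>{e<..N}. K (y - a) * v y * Z v y (N - y)) \<le> B v e (N - e) * sum K {e - a<..N - a}" .
  have "tail (N - a) \<le> B v e (N - e) * tail (N - a)"
    using B_ge_1[of v e "N - e"] tail_nonneg[of "N - a"] using mult_right_mono[of 1 "B v e (N - e)" "tail (N - a)"] by simp
  then have "crossing v N e a \<le> B v e (N - e) * (tail (N - a) + sum K {e - a<..N - a})"
    using 1 by (simp add: crossing_def algebra_simps)
  also have "tail (N - a) + sum K {e - a<..N - a} = tail (e - a)"
    using tail_split[of "e - a" "N - a"] a assms by simp
  finally show "crossing v N e a \<le> B v e (N - e) * tail (e - a)" .
qed

lemma Z_le_B:
  assumes v: "\<And>i. 0 \<le> v i" shows "Z v x n \<le> B v x n"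
proof -
  have "Z v x 0 = 1" by (subst Z.simps) (simp add: tail_0)
  then show ?thesis using Z_split_le[where v=v and x=x and e=x and N="x + n"] v by simp
qed

lemma B_submult:
  assumes v: "\<And>i. 0 \<le> v i" 
  shows "B v x (n + m) \<le> B v x n * B v (x + n) m"
proof (rule B_le)
  show 1: "1 \<le> B v x n * B v (x + n) m"
    using mult_mono[OF B_ge_1 B_ge_1] B_ge_1 by (metis mult_1 order.trans zero_le_one)
  fix a assume a: "1 \<le> a" "a \<le> n + m"
  show "v (x + a) * Z v (x + a) (n + m - a) \<le> B v x n * B v (x + n) m"
  proof (cases "a \<le> n")
    case True
    have "Z v (x + a) (n + m - a) \<le> B v (x + n) m * Z v (x + a) (n - a)"
      using Z_split_le[where v=v and x="x + a" and e="x + n" and N="x + n + m"] v True by (simp add: algebra_simps)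
    then have "v (x + a) * Z v (x + a) (n + m - a) \<le> v (x + a) * (B v (x + n) m * Z v (x + a) (n - a))"
      using v by (intro mult_left_mono) auto
    also have "\<dots> = B v (x + n) m * (v (x + a) * Z v (x + a) (n - a))" by simp
    also have "\<dots> \<le> B v (x + n) m * B v x n"
      using B_ge[OF a(1) True] B_ge_1[of v "x+n" m] by (intro mult_left_mono) auto
    finally show ?thesis by (simp add: mult.commute)
  next
    case False
    then have "v (x + a) * Z v (x + a) (n + m - a) \<le> B v (x + n) m"
      using B_ge[of "a - n" m v "x + n"] a by (simp add: add.commute)
    also have "\<dots> \<le> B v x n * B v (x + n) m"
      using B_ge_1[of v x n] B_ge_1[of v "x+n" m] mult_right_mono[of 1 "B v x n" "B v (x + n) m"] by simp
    finally show ?thesis .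
  qed
qed

lemma B_le_exp_of_bound:
  assumes "\<And>i. 0 \<le> v i" "\<And>i. v i \<le> exp c" "0 \<le> c" 
  shows "B v x n \<le> exp (c * real n)"
proof (induction n)
  case 0
  show ?case by (auto intro!: B_le)
next
  case (Suc n)
  have Z0: "Z v y 0 = 1" for y by (subst Z.simps) (simp add: tail_0)
  have b1: "B v (x + n) 1 \<le> exp c"
    using assms by (intro B_le) (auto simp: Z0)
  have "B v x (Suc n) \<le> B v x n * B v (x + n) 1"
    using B_submult[where v=v and x=x and n=n and m=1] assms(1) by simp
  also have "\<dots> \<le> exp (c * real n) * exp c"
    using Suc b1 B_ge_1[of v "x + n" 1] by (intro mult_mono) auto
  finally show ?case by (simp add: exp_add[symmetric] algebra_simps)
qed

lemma B_blocks:
  assumes v: "\<And>i. 0 \<le> v i"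
  shows "B v x (k * m) \<le> (\<Prod>i<k. B v (x + i * m) m)"
proof (induction k)
  case 0
  show ?case by (auto intro!: B_le)
next
  case (Suc k)
  have "B v x (Suc k * m) \<le> B v x (k * m) * B v (x + k * m) m"
    using B_submult[where v=v and x=x and n="k * m" and m=m] v by (simp add: add.commute)
  also have "\<dots> \<le> (\<Prod>i<k. B v (x + i * m) m) * B v (x + k * m) m"
    using Suc B_ge_1[of v "x + k * m" m] by (intro mult_right_mono) auto
  finally show ?case by simp
qed

end

section \<open>First-step analysis of the renewal process\<close>

text \<open>
  Weight of the trajectory whose successive increments are \<xi>, over the n sites following x.
\<close>
definition path_weight :: "(nat \<Rightarrow> real) \<Rightarrow> nat \<Rightarrow> nat \<Rightarrow> (nat \<Rightarrow> nat) \<Rightarrow> real" where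
  "path_weight v x n \<xi> = (\<Prod>a=1..n. if a \<in> range (\<lambda>i. \<Sum>j<i. \<xi> j) then v (x + a) else 1)"

lemma range_partial_sums_case_nat:
  "range (\<lambda>i. \<Sum>j<i. case_nat b \<xi> j) = insert (0::nat) ((+) b ` range (\<lambda>i. \<Sum>j<i. \<xi> j))"
proof (intro set_eqI iffI)
  fix y assume "y \<in> range (\<lambda>i. \<Sum>j<i. case_nat b \<xi> j)"
  then obtain i where "y = (\<Sum>j<i. case_nat b \<xi> j)" by auto
  then show "y \<in> insert 0 ((+) b ` range (\<lambda>i. \<Sum>j<i. \<xi> j))"
    by (cases i) (auto simp: sum.lessThan_Suc_shift simp del: sum.lessThan_Suc)
next
  fix y assume "y \<in> insert 0 ((+) b ` range (\<lambda>i. \<Sum>j<i. \<xi> j))"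
  then consider "y = 0" | i where "y = b + (\<Sum>j<i. \<xi> j)" by auto
  then show "y \<in> range (\<lambda>i. \<Sum>j<i. case_nat b \<xi> j)"
  proof cases
    case 1
    then show ?thesis by (intro range_eqI[of _ _ 0]) auto
  next
    case (2 i)
    then show ?thesis by (intro range_eqI[of _ _ "Suc i"]) 
      (auto simp: sum.lessThan_Suc_shift simp del: sum.lessThan_Suc)
  qed
qed

text \<open>
  If the first increment is b, the trajectory is empty before b and, from b on, is a translate of the
  one built from the remaining increments. This is the pathwise form of the renewal equation.
\<close>
lemma path_weight_case_nat:
  assumes "1 \<le> b"
  shows "path_weight v x n (case_nat b \<xi>) = (if b \<le> n then v (x + b) * path_weight v (x + b) (n - b) \<xi> else 1)"
proof -
  let ?R = "range (\<lambda>i. \<Sum>j<i. \<xi> j)"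
  have zero: "0 \<in> ?R" by (intro range_eqI[of _ _ 0]) auto
  have eq: "path_weight v x n (case_nat b \<xi>) = (\<Prod>a=1..n. if a \<in> (+) b ` ?R then v (x + a) else 1)"
    unfolding path_weight_def range_partial_sums_case_nat by (intro prod.cong refl) auto
  show ?thesis
  proof (cases "b \<le> n")
    case False
    then have "a \<notin> (+) b ` ?R" if "a \<in> {1..n}" for a using that by auto
    then show ?thesis using False unfolding eq by (auto intro!: prod.neutral)
  next
    case True
    have split: "{1..n} = {1..<b} \<union> insert b {b+1..n}" using True assms by auto
    have 1: "(\<Prod>a\<in>{1..<b}. if a \<in> (+) b ` ?R then v (x + a) else 1) = 1"
      by (intro prod.neutral) auto
    have 2: "(\<Prod>a=b+1..n. if a \<in> (+) b ` ?R then v (x + a) else 1) = path_weight v (x + b) (n - b) \<xi>"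
      unfolding path_weight_def
    proof (rule prod.reindex_bij_witness[of _ "\<lambda>a. a + b" "\<lambda>a. a - b"])
      fix a assume "a \<in> {b+1..n}"
      then obtain c where c: "a = b + c" by (auto dest: le_Suc_ex)
      have "a \<in> (+) b ` ?R \<longleftrightarrow> a - b \<in> ?R" unfolding c by (simp only: add_diff_cancel_left' image_iff) auto
      moreover have "x + b + (a - b) = x + a" using c by simp
      ultimately show "(if a - b \<in> ?R then v (x + b + (a - b)) else 1) = (if a \<in> (+) b ` ?R then v (x + a) else 1)"
        by simp
    qed auto
    have 3: "b \<in> (+) b ` ?R" using zero by (metis add.right_neutral imageI)
    show ?thesis using True unfolding eq split
      by (subst prod.union_disjoint) (auto simp: 1[simplified] 2[simplified] 3)
  qed
qed

context renewal_process
begin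

abbreviation "K \<equiv> inter_arrival_law P \<tau>"

definition increment_law :: "nat measure" where
  "increment_law = distr P (count_space UNIV) (\<lambda>x. \<tau> 1 x - \<tau> 0 x)"

lemma measurable_increment [measurable]: "(\<lambda>x. \<tau> (Suc i) x - \<tau> i x) \<in> P \<rightarrow>\<^sub>M count_space UNIV"
  using indep_increments unfolding indep_vars_def by auto

lemma prob_space_increment_law: "prob_space increment_law"
  unfolding increment_law_def using measurable_increment[of 0] by (intro prob_space_distr) simp

lemma measure_increment_law: "measure increment_law {n} = K n"
proof -
  have "measure increment_law {n} = measure P ((\<lambda>x. \<tau> 1 x - \<tau> 0 x) -` {n} \<inter> space P)"
    unfolding increment_law_def using measurable_increment[of 0] by (intro measure_distr) auto
  also have "(\<lambda>x. \<tau> 1 x - \<tau> 0 x) -` {n} \<inter> space P = {x \<in> space P. \<tau> 1 x = n}"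
    using start by auto
  finally show ?thesis by (simp add: inter_arrival_law_def)
qed

lemma sets_increment_law [simp, measurable_cong]: "sets increment_law = sets (count_space UNIV)"
  and space_increment_law [simp]: "space increment_law = UNIV"
  by (auto simp: increment_law_def)

sublocale renewal_kernel K
proof
  interpret D: prob_space increment_law by (rule prob_space_increment_law)
  show "0 \<le> K n" for n by (simp add: inter_arrival_law_def)
  have "\<tau> 1 x \<noteq> 0" if "x \<in> space P" for x
    using increasing[OF that, of 0] by simp
  then have "{x \<in> space P. \<tau> 1 x = 0} = {}" by auto
  then show "K 0 = 0" unfolding inter_arrival_law_def by (simp only: measure_empty)
  have "(\<lambda>n. measure increment_law {n}) sums measure increment_law (\<Union>n. {n})"
    by (rule D.finite_measure_UNION) (auto simp: disjoint_family_on_def)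
  moreover have "(\<Union>n::nat. {n}) = UNIV" by auto
  ultimately show "K sums 1" using D.prob_space by (simp add: measure_increment_law)
qed

lemma tau_eq: "x \<in> space P \<Longrightarrow> \<tau> i x = (\<Sum>j<i. \<tau> (Suc j) x - \<tau> j x)"
proof (induction i)
  case 0
  then show ?case using start by simp
next
  case (Suc i)
  then show ?case using increasing[of x i] by simp
qed

lemma increments_law:
  "distr P (PiM UNIV (\<lambda>_. count_space UNIV)) (\<lambda>x i. \<tau> (Suc i) x - \<tau> i x) = PiM UNIV (\<lambda>_. increment_law)"
proof -
  have "distr P (PiM UNIV (\<lambda>_. count_space UNIV)) (\<lambda>x. \<lambda>i\<in>UNIV. \<tau> (Suc i) x - \<tau> i x)
     = PiM UNIV (\<lambda>i. distr P (count_space UNIV) (\<lambda>x. \<tau> (Suc i) x - \<tau> i x))"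
    by (rule indep_vars_iff_distr_eq_PiM[THEN iffD1, OF _ _ indep_increments]) simp_all
  also have "\<dots> = PiM UNIV (\<lambda>_. increment_law)"
    unfolding increment_law_def by (intro PiM_cong refl) (rule identically_distributed)
  finally show ?thesis by (simp only: restrict_UNIV)
qed

lemma path_weight_measurable [measurable]:
  "path_weight v x n \<in> borel_measurable (PiM UNIV (\<lambda>_. increment_law))"
proof -
  have sums: "(\<lambda>\<xi>. \<Sum>j<i. \<xi> j) \<in> PiM UNIV (\<lambda>_. increment_law) \<rightarrow>\<^sub>M count_space (UNIV :: nat set)" for i :: nat
  proof (induction i)
    case (Suc i)
    have comp: "(\<lambda>\<xi>. \<xi> i) \<in> PiM UNIV (\<lambda>_. increment_law) \<rightarrow>\<^sub>M count_space (UNIV :: nat set)"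
    proof -
      have "(\<lambda>\<xi>. \<xi> i) \<in> PiM UNIV (\<lambda>_. increment_law) \<rightarrow>\<^sub>M increment_law"
        by (rule measurable_component_singleton) simp
      then show ?thesis by (subst (asm) measurable_cong_sets[OF refl sets_increment_law])
    qed
    have add: "(\<lambda>\<xi>. a + \<xi> i) \<in> PiM UNIV (\<lambda>_. increment_law) \<rightarrow>\<^sub>M count_space (UNIV :: nat set)" for a
      by (rule measurable_compose[OF comp]) simp
    have "(\<lambda>\<xi>. (\<lambda>a \<xi>. a + \<xi> i) (\<Sum>j<i. \<xi> j) \<xi>)
        \<in> PiM UNIV (\<lambda>_. increment_law) \<rightarrow>\<^sub>M count_space (UNIV :: nat set)"
      by (rule measurable_compose_countable[where f="\<lambda>a \<xi>. a + \<xi> i" and g="\<lambda>\<xi>. \<Sum>j<i. \<xi> j", OF add Suc])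
    then show ?case by simp
  qed simp
  let ?M = "PiM UNIV (\<lambda>_. increment_law) :: (nat \<Rightarrow> nat) measure"
  have "{\<xi> \<in> space ?M. \<exists>i. (\<Sum>j<i. \<xi> j) = a} = (\<Union>i. (\<lambda>\<xi>. \<Sum>j<i. \<xi> j) -` {a} \<inter> space ?M)" for a
    by auto
  moreover have "(\<Union>i. (\<lambda>\<xi>. \<Sum>j<i. \<xi> j) -` {a} \<inter> space ?M) \<in> sets ?M" for a
    by (intro sets.countable_UN) (auto intro!: measurable_sets[OF sums])
  ultimately have "{\<xi> \<in> space ?M. \<exists>i. (\<Sum>j<i. \<xi> j) = a} \<in> sets ?M" for a
    by simp
  then have "(\<lambda>\<xi>. \<Prod>a=1..n. if \<exists>i. (\<Sum>j<i. \<xi> j) = a then v (x + a) else 1) \<in> borel_measurable ?M"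
    by (intro borel_measurable_prod measurable_If) auto
  moreover have "path_weight v x n = (\<lambda>\<xi>. \<Prod>a=1..n. if \<exists>i. (\<Sum>j<i. \<xi> j) = a then v (x + a) else 1)"
    unfolding path_weight_def image_iff by (intro ext prod.cong refl) auto
  ultimately show ?thesis by simp
qed

lemma path_weight_bound: "\<exists>C. \<forall>\<xi>. norm (path_weight v x n \<xi>) \<le> C"
proof -
  have "norm (path_weight v x n \<xi>) \<le> (\<Prod>a=1..n. \<bar>v (x + a)\<bar> + 1)" for \<xi>
    unfolding path_weight_def prod_norm[symmetric] by (intro prod_mono) auto
  then show ?thesis by blast
qed

text \<open>
  The increments are an i.i.d. sequence, and splitting off its first term leaves the law of the rest
  unchanged; integrating over that term gives the renewal equation. An increment 0 has probability 0
  and is discarded almost everywhere.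
\<close>
lemma expectation_path_weight:
  "(\<integral>\<xi>. path_weight v x n \<xi> \<partial>PiM UNIV (\<lambda>_. increment_law)) = Z v x n"
proof (induction n arbitrary: x rule: less_induct)
  case (less n)
  interpret D: prob_space increment_law by (rule prob_space_increment_law)
  interpret S: sequence_space increment_law ..
  let ?S = "PiM UNIV (\<lambda>_. increment_law) :: (nat \<Rightarrow> nat) measure"
  interpret pair_prob_space increment_law ?S ..
  have S1: "(\<integral>\<xi>. (1::real) \<partial>?S) = 1"
    by (simp only: lebesgue_integral_const S.P.prob_space scaleR_one real_scaleR_def mult_1)
  have meas [measurable]: "(\<lambda>(b, \<xi>). case_nat b \<xi>) \<in> increment_law \<Otimes>\<^sub>M ?S \<rightarrow>\<^sub>M ?S"
    unfolding case_prod_beta by (rule measurable_case_nat'[OF measurable_fst measurable_snd])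
  have meas' : "(\<lambda>(b, \<xi>). path_weight v x n (case_nat b \<xi>)) \<in> borel_measurable (increment_law \<Otimes>\<^sub>M ?S)"
    using measurable_compose[OF meas path_weight_measurable, of v x n] by (simp add: case_prod_beta)
  have int: "integrable (increment_law \<Otimes>\<^sub>M ?S) (\<lambda>(b, \<xi>). path_weight v x n (case_nat b \<xi>))"
  proof -
    obtain C where "\<forall>\<xi>. norm (path_weight v x n \<xi>) \<le> C" using path_weight_bound by blast
    then show ?thesis by (intro P.integrable_const_bound[of _ C] meas') auto
  qed
  define g where "g b = (\<Sum>a=1..n. v (x + a) * Z v (x + a) (n - a) * indicator {a} b) + indicator {n<..} b"
    for b :: nat
  have "(\<integral>\<xi>. path_weight v x n \<xi> \<partial>?S)
      = (\<integral>\<xi>. path_weight v x n \<xi> \<partial>distr (increment_law \<Otimes>\<^sub>M ?S) ?S (\<lambda>(b, \<xi>). case_nat b \<xi>))"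
    by (subst S.PiM_iter) simp
  also have "\<dots> = (\<integral>z. path_weight v x n (case z of (b, \<xi>) \<Rightarrow> case_nat b \<xi>) \<partial>(increment_law \<Otimes>\<^sub>M ?S))"
    by (rule integral_distr) simp_all
  also have "\<dots> = (\<integral>z. (case z of (b, \<xi>) \<Rightarrow> path_weight v x n (case_nat b \<xi>)) \<partial>(increment_law \<Otimes>\<^sub>M ?S))"
    by (simp add: case_prod_beta)
  also have "\<dots> = (\<integral>b. (\<integral>\<xi>. path_weight v x n (case_nat b \<xi>) \<partial>?S) \<partial>increment_law)"
    using integral_fst[OF int] by simp
  also have "\<dots> = (\<integral>b. g b \<partial>increment_law)"
  proof (rule integral_cong_AE)
    have "emeasure increment_law {0} = 0"
      using measure_increment_law[of 0] K_zero by (simp add: D.emeasure_eq_measure)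
    then have "AE b in increment_law. b \<noteq> 0"
      by (intro AE_I[of _ _ "{0}"]) auto
    then show "AE b in increment_law. (\<integral>\<xi>. path_weight v x n (case_nat b \<xi>) \<partial>?S) = g b"
    proof eventually_elim
      case (elim b)
      show ?case
      proof (cases "b \<le> n")
        case True
        have "g b = (\<Sum>a=1..n. if a = b then v (x + a) * Z v (x + a) (n - a) else 0)"
          unfolding g_def using True by (auto simp: indicator_def intro!: sum.cong)
        also have "\<dots> = v (x + b) * Z v (x + b) (n - b)"
          using True elim by simp
        finally show ?thesis using True elim less.IH[of "n - b" "x + b"]
          by (simp add: path_weight_case_nat)
      next
        case False
        then have "g b = 1" unfolding g_def by (auto simp: indicator_def intro!: sum.neutral)
        then show ?thesis using False elim S1 by (simp add: path_weight_case_nat del: lebesgue_integral_const)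
      qed
    qed
  qed simp_all
  also have "\<dots> = (\<Sum>a=1..n. v (x + a) * Z v (x + a) (n - a) * measure increment_law {a}) + measure increment_law {n<..}"
  proof -
    have i1: "integrable increment_law (\<lambda>b. v (x + a) * Z v (x + a) (n - a) * indicator {a} b)" for a
      by (intro integrable_mult_right integrable_real_indicator) (auto simp: D.emeasure_eq_measure)
    have i2: "integrable increment_law (indicator {n<..} :: nat \<Rightarrow> real)"
      by (intro integrable_real_indicator) (auto simp: D.emeasure_eq_measure)
    show ?thesis unfolding g_def
      by (subst Bochner_Integration.integral_add[OF Bochner_Integration.integrable_sum[OF i1] i2],
          subst Bochner_Integration.integral_sum[OF i1]) simp
  qed
  also have "measure increment_law {n<..} = tail n"
  proof -
    have "measure increment_law {..n} = (\<Sum>a\<in>{..n}. measure increment_law {a})"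
      by (rule D.finite_measure_eq_sum_singleton) auto
    also have "\<dots> = sum K {1..n}"
      unfolding measure_increment_law
      by (rule sum.mono_neutral_right) (auto simp: K_zero Suc_le_eq)
    finally have "measure increment_law {..n} = sum K {1..n}" .
    moreover have "UNIV - {..n} = {n<..}" by auto
    ultimately show ?thesis
      using D.prob_compl[of "{..n}"] by (simp add: tail_def)
  qed
  finally show ?case
    unfolding Z.simps[of v x n] measure_increment_law by (simp add: mult.commute mult.left_commute mult.assoc)
qed

lemma partition_function_eq_Z:
  "partition_function P \<tau> \<beta> h w N = Z (\<lambda>i. exp (h + \<beta> * w i)) 0 N"
proof -
  let ?v = "\<lambda>i. exp (h + \<beta> * w i)" and ?X = "\<lambda>x i. \<tau> (Suc i) x - \<tau> i x"
  have "partition_function P \<tau> \<beta> h w N = (\<integral>x. path_weight ?v 0 N (?X x) \<partial>P)"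
    unfolding partition_function_def
  proof (intro Bochner_Integration.integral_cong refl)
    fix x assume x: "x \<in> space P"
    have range: "range (\<lambda>i. \<tau> i x) = range (\<lambda>i. \<Sum>j<i. ?X x j)"
      by (intro image_cong refl tau_eq x)
    show "exp (\<Sum>n=1..N. (h + \<beta> * w n) * indicator (range (\<lambda>i. \<tau> i x)) n) = path_weight ?v 0 N (?X x)"
      unfolding path_weight_def range exp_sum[OF finite_atLeastAtMost]
      by (intro prod.cong refl) (simp add: indicator_def)
  qed
  also have "\<dots> = (\<integral>\<xi>. path_weight ?v 0 N \<xi> \<partial>distr P (PiM UNIV (\<lambda>_. count_space UNIV)) ?X)"
  proof (rule integral_distr[symmetric])
    show "?X \<in> P \<rightarrow>\<^sub>M PiM UNIV (\<lambda>_. count_space UNIV)"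
      by (rule measurable_PiM_single') auto
    have "sets (PiM UNIV (\<lambda>_::nat. increment_law)) = sets (PiM UNIV (\<lambda>_. count_space (UNIV::nat set)))"
      by (intro sets_PiM_cong) auto
    then show "path_weight ?v 0 N \<in> borel_measurable (PiM UNIV (\<lambda>_. count_space UNIV))"
      using path_weight_measurable[of ?v 0 N] by (simp cong: measurable_cong_sets)
  qed
  also have "\<dots> = Z ?v 0 N"
    by (simp add: increments_law expectation_path_weight)
  finally show ?thesis .
qed

end

section \<open>The pointwise ergodic theorem for bounded functions\<close>

locale ergodic_map = prob_space S for S :: "'s measure" +
  fixes T :: "'s \<Rightarrow> 's"
  assumes T_measurable [measurable]: "T \<in> S \<rightarrow>\<^sub>M S"
    and T_preserving: "distr S S T = S"
    and T_ergodic: "\<And>A. A \<in> sets S \<Longrightarrow> T -` A \<inter> space S = A \<Longrightarrow> prob A \<in> {0, 1}"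
begin

lemma T_pow_measurable [measurable]: "(T ^^ n) \<in> S \<rightarrow>\<^sub>M S"
  by (induction n) (auto intro: measurable_comp)

lemma integral_T: "f \<in> borel_measurable S \<Longrightarrow> (\<integral>s. f (T s) \<partial>S) = (\<integral>s. (f s :: real) \<partial>S)"
  using integral_distr[OF T_measurable, of f] T_preserving by simp

lemma integral_T_pow:
  assumes [measurable]: "f \<in> borel_measurable S"
  shows "(\<integral>s. f ((T ^^ n) s) \<partial>S) = (\<integral>s. (f s :: real) \<partial>S)"
proof (induction n)
  case (Suc n)
  have "(\<integral>s. f ((T ^^ Suc n) s) \<partial>S) = (\<integral>s. f ((T ^^ n) (T s)) \<partial>S)" by (simp add: funpow_swap1)
  also have "\<dots> = (\<integral>s. f ((T ^^ n) s) \<partial>S)"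
    by (intro integral_T[where f="\<lambda>s. f ((T ^^ n) s)"]) measurable
  finally show ?case using Suc by simp
qed simp

definition birkhoff_sum :: "('s \<Rightarrow> real) \<Rightarrow> nat \<Rightarrow> 's \<Rightarrow> real" where
  "birkhoff_sum f n s = (\<Sum>i<n. f ((T ^^ i) s))"

lemma birkhoff_sum_measurable [measurable]:
  assumes [measurable]: "f \<in> borel_measurable S"
  shows "birkhoff_sum f n \<in> borel_measurable S"
  unfolding birkhoff_sum_def by measurable

lemma birkhoff_sum_Suc: "birkhoff_sum f (Suc n) s = f s + birkhoff_sum f n (T s)"
  unfolding birkhoff_sum_def by (simp add: sum.lessThan_Suc_shift funpow_swap1 del: sum.lessThan_Suc)

text \<open>
  The maximum of 0 and the first n Birkhoff sums, in the recursive form on which Garsia's argument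
  rests.
\<close>
primrec max_sum :: "('s \<Rightarrow> real) \<Rightarrow> nat \<Rightarrow> 's \<Rightarrow> real" where
  "max_sum f 0 s = 0"
| "max_sum f (Suc n) s = max 0 (f s + max_sum f n (T s))"

lemma max_sum_measurable [measurable]:
  assumes [measurable]: "f \<in> borel_measurable S"
  shows "max_sum f n \<in> borel_measurable S"
proof (induction n)
  case 0
  have "max_sum f 0 = (\<lambda>_. 0)" by (simp add: fun_eq_iff)
  then show ?case by simp
next
  case (Suc n)
  then have [measurable]: "max_sum f n \<in> borel_measurable S" .
  have "(\<lambda>s. max 0 (f s + max_sum f n (T s))) \<in> borel_measurable S" by measurable
  moreover have "max_sum f (Suc n) = (\<lambda>s. max 0 (f s + max_sum f n (T s)))" by (simp add: fun_eq_iff)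
  ultimately show ?case by simp
qed

lemma max_sum_nonneg: "0 \<le> max_sum f n s" by (cases n) auto

lemma max_sum_le: "(\<And>s. \<bar>f s\<bar> \<le> C) \<Longrightarrow> max_sum f n s \<le> real n * C"
proof (induction n arbitrary: s)
  case (Suc n)
  have "0 \<le> C" using Suc.prems[of s] by linarith
  moreover have "max_sum f n (T s) \<le> real n * C" by (rule Suc.IH) (rule Suc.prems)
  moreover have "f s \<le> C" using Suc.prems[of s] by linarith
  moreover have "0 \<le> real n * C" using \<open>0 \<le> C\<close> by simp
  ultimately show ?case by (simp add: algebra_simps)
qed simp

lemma max_sum_mono: "max_sum f n s \<le> max_sum f (Suc n) s"
proof (induction n arbitrary: s)
  case (Suc n)
  show ?case using Suc[of "T s"] unfolding max_sum.simps(2)[of f n] max_sum.simps(2)[of f "Suc n"]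
    by (intro max.mono) auto
qed simp

lemma birkhoff_le_max_sum: "birkhoff_sum f n s \<le> max_sum f n s"
proof (induction n arbitrary: s)
  case (Suc n)
  show ?case using Suc[of "T s"] by (simp add: birkhoff_sum_Suc le_max_iff_disj)
qed (simp add: birkhoff_sum_def)

lemma bounded_integrable: "f \<in> borel_measurable S \<Longrightarrow> (\<And>s. \<bar>f s\<bar> \<le> C) \<Longrightarrow> integrable S (f :: 's \<Rightarrow> real)"
  by (rule integrable_const_bound[of _ C]) auto

text \<open>
  Garsia's argument: where the maximal sum M is positive, f \<ge> M - M \<circ> T; elsewhere M - M
  \<circ> T \<le> 0; and the integral of M - M \<circ> T over the whole space vanishes by invariance.
\<close>
lemma maximal_ergodic_finite:
  assumes [measurable]: "f \<in> borel_measurable S" and C: "\<And>s. \<bar>f s\<bar> \<le> C"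
  shows "0 \<le> (\<integral>s. (if 0 < max_sum f n s then f s else 0) \<partial>S)"
proof -
  have bd: "\<bar>max_sum f n s\<bar> \<le> real n * C" for s using max_sum_le[OF C] max_sum_nonneg by (auto simp: abs_le_iff intro: order_trans)
  have C0: "0 \<le> C" using C[of undefined] by simp
  have int1: "integrable S (max_sum f n)" by (rule bounded_integrable[OF _ bd]) measurable
  have int2: "integrable S (\<lambda>s. max_sum f n (T s))"
    by (rule bounded_integrable[of "\<lambda>s. max_sum f n (T s)", OF _ bd]) measurable
  have int3: "integrable S (\<lambda>s. (if 0 < max_sum f n s then f s else 0))"
    by (rule bounded_integrable[where C=C], measurable) (use C C0 in \<open>auto\<close>)
  have "0 = (\<integral>s. max_sum f n s \<partial>S) - (\<integral>s. max_sum f n (T s) \<partial>S)"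
    by (simp add: integral_T)
  also have "\<dots> = (\<integral>s. max_sum f n s - max_sum f n (T s) \<partial>S)"
    using int1 int2 by (rule Bochner_Integration.integral_diff[symmetric])
  also have "\<dots> \<le> (\<integral>s. (if 0 < max_sum f n s then f s else 0) \<partial>S)"
  proof (rule integral_mono)
    fix s
    show "max_sum f n s - max_sum f n (T s) \<le> (if 0 < max_sum f n s then f s else 0)"
    proof (cases "0 < max_sum f n s")
      case True
      have "max_sum f n s \<le> max 0 (f s + max_sum f n (T s))"
        using max_sum_mono[of f n s] by simp
      then show ?thesis using True by auto
    next
      case False
      then show ?thesis using max_sum_nonneg[of f n s] max_sum_nonneg[of f n "T s"] by simp
    qed
  qed (use int1 int2 int3 in auto)
  finally show ?thesis .
qed

lemma maximal_ergodic:
  assumes [measurable]: "f \<in> borel_measurable S" and C: "\<And>s. \<bar>f s\<bar> \<le> C"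
    and pos: "AE s in S. \<exists>n. 0 < birkhoff_sum f n s"
  shows "0 \<le> (\<integral>s. f s \<partial>S)"
proof -
  have C0: "0 \<le> C" using C[of undefined] by simp
  have "(\<lambda>n. \<integral>s. (if 0 < max_sum f n s then f s else 0) \<partial>S) \<longlonglongrightarrow> (\<integral>s. f s \<partial>S)"
  proof (rule integral_dominated_convergence[where w="\<lambda>_. C"])
    show "AE s in S. (\<lambda>n. (if 0 < max_sum f n s then f s else 0)) \<longlonglongrightarrow> f s"
      using pos
    proof eventually_elim
      case (elim s)
      then obtain n where n: "0 < birkhoff_sum f n s" by blast
      have "0 < max_sum f m s" if "n \<le> m" for m
      proof -
        have "max_sum f n s \<le> max_sum f m s"
          using that by (rule lift_Suc_mono_le[of "\<lambda>n. max_sum f n s", OF max_sum_mono])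
        then show ?thesis using n birkhoff_le_max_sum[of f n s] by simp
      qed
      then have "eventually (\<lambda>m. f s = (if 0 < max_sum f m s then f s else 0)) sequentially"
        unfolding eventually_sequentially by (intro exI[of _ n]) auto
      then show ?case by (rule Lim_transform_eventually[OF tendsto_const])
    qed
  next
    show "(\<lambda>s. (if 0 < max_sum f n s then f s else 0)) \<in> borel_measurable S" for n by measurable
  qed (use C C0 in \<open>auto\<close>)
  then show ?thesis
    by (rule LIMSEQ_le_const) (use maximal_ergodic_finite[OF assms(1) C] in auto)
qed

text \<open>
  The upper limit of the averages is an invariant function, so by ergodicity it lies above the level c
  almost nowhere or almost everywhere. In the second case, the maximal inequality for f - d with d
  strictly between the mean and c gives a contradiction.
\<close>
lemma birkhoff_limsup_le:
  assumes [measurable]: "f \<in> borel_measurable S" and C: "\<And>s. \<bar>f s\<bar> \<le> C"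
    and c: "(\<integral>s. f s \<partial>S) < c"
  shows "AE s in S. \<forall>\<^sub>F n in sequentially. birkhoff_sum f n s / real n \<le> c"
proof -
  define L where "L s = limsup (\<lambda>n. ereal (birkhoff_sum f n s / real n))" for s
  have [measurable]: "L \<in> borel_measurable S" unfolding L_def by measurable
  have L_T: "L (T s) = L s" if "s \<in> space S" for s
  proof -
    have "(\<lambda>n. birkhoff_sum f n (T s) / real n - birkhoff_sum f n s / real n) \<longlonglongrightarrow> 0"
    proof (rule Lim_null_comparison[where g="\<lambda>n. 2 * C / real n"])
      have "norm (birkhoff_sum f n (T s) / real n - birkhoff_sum f n s / real n) \<le> 2 * C / real n" for n
      proof -
        have "birkhoff_sum f n (T s) - birkhoff_sum f n s = f ((T ^^ n) s) - f s"
          using birkhoff_sum_Suc[of f n s] by (simp add: birkhoff_sum_def)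
        moreover have "\<bar>f ((T ^^ n) s) - f s\<bar> \<le> 2 * C" using C[of "(T ^^ n) s"] C[of s] by linarith
        ultimately show ?thesis by (simp add: diff_divide_distrib[symmetric] divide_right_mono)
      qed
      then show "\<forall>\<^sub>F n in sequentially. norm (birkhoff_sum f n (T s) / real n - birkhoff_sum f n s / real n) \<le> 2 * C / real n"
        by simp
      show "(\<lambda>n. 2 * C / real n) \<longlonglongrightarrow> 0" by (rule lim_const_over_n)
    qed
    then have z: "(\<lambda>n. ereal (birkhoff_sum f n (T s) / real n - birkhoff_sum f n s / real n)) \<longlonglongrightarrow> 0"
      by (simp add: zero_ereal_def)
    have "L (T s) = limsup (\<lambda>n. ereal (birkhoff_sum f n (T s) / real n - birkhoff_sum f n s / real n) + ereal (birkhoff_sum f n s / real n))"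
      unfolding L_def by (simp only: plus_ereal.simps) simp
    also have "\<dots> = 0 + L s"
      unfolding L_def by (rule ereal_limsup_lim_add[OF z]) auto
    finally show ?thesis by simp
  qed
  let ?A = "{s \<in> space S. ereal c \<le> L s}"
  \<comment> \<open>The event that the upper limit is at least c is exactly invariant, as ergodicity
    requires.\<close>
  have A: "?A \<in> sets S" by measurable
  have "T -` ?A \<inter> space S = ?A"
    using L_T measurable_space[OF T_measurable] by auto
  from T_ergodic[OF A this] have "prob ?A = 0 \<or> prob ?A = 1" by auto
  then show ?thesis
  proof
    assume "prob ?A = 0"
    then have "AE s in S. s \<notin> ?A" using A by (auto simp: prob_eq_0)
    then show ?thesis
    proof (rule AE_mp, intro AE_I2 impI)
      fix s assume "s \<in> space S" "s \<notin> ?A"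
      then have "L s < ereal c" by auto
      then have "\<forall>\<^sub>F n in sequentially. ereal (birkhoff_sum f n s / real n) < ereal c"
        unfolding L_def by (rule Limsup_lessD)
      then show "\<forall>\<^sub>F n in sequentially. birkhoff_sum f n s / real n \<le> c"
        by eventually_elim simp
    qed
  next
    assume "prob ?A = 1"
    then have AE: "AE s in S. s \<in> ?A" using A by (auto simp: prob_eq_1)
    obtain d where d: "(\<integral>s. f s \<partial>S) < d" "d < c" using c dense by blast
    have [measurable]: "(\<lambda>s. f s - d) \<in> borel_measurable S" by measurable
    have "0 \<le> (\<integral>s. f s - d \<partial>S)"
    proof (rule maximal_ergodic[where C="C + \<bar>d\<bar>"])
      show "\<bar>f s - d\<bar> \<le> C + \<bar>d\<bar>" for s using C[of s] by linarith
      show "AE s in S. \<exists>n. 0 < birkhoff_sum (\<lambda>s. f s - d) n s"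
        using AE
      proof eventually_elim
        case (elim s)
        then have "ereal d < L s" using d by (auto intro: less_le_trans[of _ "ereal c"])
        have "\<exists>n>0. d < birkhoff_sum f n s / real n"
        proof (rule ccontr)
          assume "\<not> ?thesis"
          then have "\<And>n. 0 < n \<Longrightarrow> ereal (birkhoff_sum f n s / real n) \<le> ereal d"
            by (metis ereal_less_eq(3) not_less)
          then have "\<forall>\<^sub>F n in sequentially. ereal (birkhoff_sum f n s / real n) \<le> ereal d"
            by (intro eventually_mono[OF eventually_gt_at_top[of 0]])
          then have "L s \<le> ereal d" unfolding L_def by (rule Limsup_bounded)
          then show False using \<open>ereal d < L s\<close> by simp
        qed
        then obtain n where n: "d < birkhoff_sum f n s / real n" "n > 0" by blast
        have "birkhoff_sum (\<lambda>s. f s - d) n s = birkhoff_sum f n s - real n * d"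
          by (simp add: birkhoff_sum_def sum_subtractf)
        then show ?case using n by (intro exI[of _ n]) (simp add: field_simps)
      qed
    qed measurable
    moreover have "(\<integral>s. f s - d \<partial>S) = (\<integral>s. f s \<partial>S) - d"
      using bounded_integrable[OF assms(1) C] by (simp add: prob_space)
    ultimately show ?thesis using d by simp
  qed
qed

lemma birkhoff:
  assumes [measurable]: "f \<in> borel_measurable S" and C: "\<And>s. \<bar>f s\<bar> \<le> C"
  shows "AE s in S. (\<lambda>n. birkhoff_sum f n s / real n) \<longlonglongrightarrow> (\<integral>s. f s \<partial>S)"
proof -
  let ?m = "\<integral>s. f s \<partial>S"
  have up: "AE s in S. \<forall>\<^sub>F n in sequentially. birkhoff_sum f n s / real n \<le> ?m + 1 / Suc k" for k
    by (rule birkhoff_limsup_le[OF _ C]) auto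
  have lo: "AE s in S. \<forall>\<^sub>F n in sequentially. birkhoff_sum (\<lambda>s. - f s) n s / real n \<le> - ?m + 1 / Suc k" for k
    by (rule birkhoff_limsup_le[where C=C]) (use C in auto)
  have "AE s in S. \<forall>k. (\<forall>\<^sub>F n in sequentially. birkhoff_sum f n s / real n \<le> ?m + 1 / Suc k)
      \<and> (\<forall>\<^sub>F n in sequentially. birkhoff_sum (\<lambda>s. - f s) n s / real n \<le> - ?m + 1 / Suc k)"
    using up lo by (simp add: AE_all_countable)
  then show ?thesis
  proof eventually_elim
    case (elim s)
    show ?case
    proof (rule tendstoI)
      fix e :: real assume "0 < e"
      then obtain k where k: "1 / real (Suc k) < e" using nat_approx_posE by metis
      from elim have "\<forall>\<^sub>F n in sequentially. birkhoff_sum f n s / real n \<le> ?m + 1 / Suc k"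
        "\<forall>\<^sub>F n in sequentially. birkhoff_sum (\<lambda>s. - f s) n s / real n \<le> - ?m + 1 / Suc k" by auto
      then show "\<forall>\<^sub>F n in sequentially. dist (birkhoff_sum f n s / real n) ?m < e"
      proof eventually_elim
        case (elim n)
        have "birkhoff_sum (\<lambda>s. - f s) n s = - birkhoff_sum f n s"
          by (simp add: birkhoff_sum_def sum_negf)
        then show ?case using elim k by (simp add: dist_real_def abs_less_iff)
      qed
    qed
  qed
qed

text \<open>
  Invariance of the law under iterates of the map, in the form in which windows of the environment are
  translated to the origin.
\<close>
lemma prob_T_pow:
  assumes "{s \<in> space S. Q s} \<in> sets S"
  shows "prob {s \<in> space S. Q ((T ^^ j) s)} = prob {s \<in> space S. Q s}"
proof -
  have "{s \<in> space S. Q ((T ^^ j) s)} = (T ^^ j) -` {s \<in> space S. Q s} \<inter> space S"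
    using measurable_space[OF T_pow_measurable] by auto
  then have 1: "prob {s \<in> space S. Q ((T ^^ j) s)} = measure (distr S S (T ^^ j)) {s \<in> space S. Q s}"
    using assms by (simp add: measure_distr)
  have "distr S S (T ^^ j) = S"
  proof (induction j)
    case 0
    show ?case using distr_id[of S] by (simp add: id_def)
  next
    case (Suc j)
    have "distr S S (T ^^ Suc j) = distr (distr S S (T ^^ j)) S T"
      by (subst distr_distr) auto
    also have "\<dots> = S" using Suc T_preserving by simp
    finally show ?case .
  qed
  then show ?thesis using 1 by simp
qed

lemma expectation_of_bool:
  assumes "{s \<in> space S. Q s} \<in> sets S"
  shows "integrable S (\<lambda>s. of_bool (Q s) :: real)" "expectation (\<lambda>s. of_bool (Q s)) = prob {s \<in> space S. Q s}"
proof -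
  have eq: "of_bool (Q s) = indicat_real {s \<in> space S. Q s} s" if "s \<in> space S" for s
    using that by (auto simp: indicator_def)
  show "integrable S (\<lambda>s. of_bool (Q s) :: real)"
    using assms by (subst Bochner_Integration.integrable_cong[OF refl eq]) (auto intro!: integrable_real_indicator simp: emeasure_eq_measure)
  show "expectation (\<lambda>s. of_bool (Q s)) = prob {s \<in> space S. Q s}"
    using assms by (subst Bochner_Integration.integral_cong[OF refl eq]) auto
qed

lemma prob_tendsto_0:
  assumes meas: "\<And>n :: nat. {s \<in> space S. Q n s} \<in> sets S"
    and ev: "AE s in S. \<forall>\<^sub>F n in sequentially. \<not> Q n s"
  shows "(\<lambda>n. prob {s \<in> space S. Q n s}) \<longlonglongrightarrow> 0"
proof -
  have "(\<lambda>n. expectation (\<lambda>s. of_bool (Q n s) :: real)) \<longlonglongrightarrow> expectation (\<lambda>_. 0)"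
  proof (rule integral_dominated_convergence[where w="\<lambda>_. 1"])
    show "AE s in S. (\<lambda>n. of_bool (Q n s) :: real) \<longlonglongrightarrow> 0"
      using ev
    proof eventually_elim
      case (elim s)
      then have "\<forall>\<^sub>F n in sequentially. 0 = (of_bool (Q n s) :: real)" by eventually_elim simp
      then show ?case by (rule Lim_transform_eventually[OF tendsto_const])
    qed
    show "(\<lambda>s. of_bool (Q n s) :: real) \<in> borel_measurable S" for n
      using expectation_of_bool(1)[OF meas] by (rule borel_measurable_integrable)
  qed auto
  then show ?thesis by (simp add: expectation_of_bool(2)[OF meas])
qed

end

section \<open>Existence of the quenched free energy\<close>

text \<open>
  Summing over blocks of length m and then over the m offsets of the blocks visits every site once;
  this turns block sums into Birkhoff sums of the map itself, whose powers need not be ergodic.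
\<close>
lemma sum_offsets:
  fixes g :: "nat \<Rightarrow> real"
  shows "(\<Sum>r<m. \<Sum>i<k. g (r + i * m)) = (\<Sum>j<k * m. g j)"
proof -
  have "(\<Sum>r<m. \<Sum>i<k. g (r + i * m)) = (\<Sum>i<k. \<Sum>r<m. g (r + i * m))" by (rule sum.swap)
  also have "\<dots> = (\<Sum>i<k. sum g {i * m..<i * m + m})"
  proof (rule sum.cong)
    fix i assume "i \<in> {..<k}"
    show "(\<Sum>r<m. g (r + i * m)) = sum g {i * m..<i * m + m}"
      by (rule sum.reindex_bij_witness[of _ "\<lambda>j. j - i * m" "\<lambda>r. r + i * m"]) auto
  qed simp
  also have "\<dots> = sum g {..<k * m}" by (rule sum.nat_group)
  finally show ?thesis .
qed

text \<open>
  The law may vanish below \<open>n0\<close>, so every jump prescribed in a lower bound has length at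
  least \<open>n0\<close>.
\<close>
locale polynomial_kernel = renewal_kernel +
  fixes n0 :: nat and c1 \<gamma> :: real
  assumes n0_pos: "1 \<le> n0" and c1_pos: "0 < c1" and \<gamma>_nonneg: "0 \<le> \<gamma>"
    and K_lower: "\<And>n. n0 \<le> n \<Longrightarrow> c1 * real n powr - \<gamma> \<le> K n"
begin

text \<open>
  The guaranteed lower bound; it does not increase with n, so a jump of any length between
  \<open>n0\<close> and n has at least this probability.
\<close>
definition floor_K :: "nat \<Rightarrow> real" where
  "floor_K n = c1 * real n powr - \<gamma>"

lemma K_ge: "n0 \<le> n \<Longrightarrow> n \<le> m \<Longrightarrow> floor_K m \<le> K n"
proof -
  assume "n0 \<le> n" "n \<le> m"
  then have "real m powr - \<gamma> \<le> real n powr - \<gamma>"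
    using n0_pos \<gamma>_nonneg by (intro powr_mono2') auto
  then have "floor_K m \<le> c1 * real n powr - \<gamma>"
    unfolding floor_K_def using c1_pos by (intro mult_left_mono) auto
  with K_lower[OF \<open>n0 \<le> n\<close>] show ?thesis by simp
qed

lemma floor_K_pos: "1 \<le> n \<Longrightarrow> 0 < floor_K n"
  unfolding floor_K_def using c1_pos by simp

lemma ln_floor_K: "1 \<le> n \<Longrightarrow> ln (floor_K n) = ln c1 - \<gamma> * ln (real n)"
  unfolding floor_K_def using c1_pos by (simp add: ln_mult ln_powr)

lemma tail_ge: "floor_K (n + n0) \<le> tail n"
proof -
  have "K (n + n0) \<le> sum K {n<..n + n0}"
    by (rule member_le_sum) (use n0_pos K_nonneg in auto)
  then show ?thesis using K_ge[of "n + n0" "n + n0"] tail_ge_sum[of n "n + n0"] by simp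
qed

lemma tail_pos: "0 < tail n"
  using tail_ge[of n] floor_K_pos[of "n + n0"] n0_pos by simp

lemma Z_pos: "(\<And>i. 0 \<le> v i) \<Longrightarrow> 0 < Z v x n"
  using Z_ge_tail[of v n x] tail_pos[of n] less_le_trans by blast

text \<open>
  Two stretches are joined by one jump from the last contact of the first one to the site
  \<open>n0\<close> beyond its end. That jump has length between \<open>n0\<close> and m +
  \<open>n0\<close>, whatever the last contact is, hence the cost is polynomial in the length m of the
  first stretch only.
\<close>
lemma Z_concat:
  assumes "\<And>i. 0 \<le> v i" "\<And>i. l \<le> v i" "0 \<le> l"
  shows "floor_K (m + n0) * l * Z v x m * Z v (x + (m + n0)) n \<le> Z v x (m + n0 + n)"
proof -
  let ?y = "x + (m + n0)" and ?N = "x + (m + n0 + n)"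
  let ?\<rho> = "floor_K (m + n0) * l * Z v ?y n"
  have "?\<rho> * Z v x (x + m - x) \<le> Z v x (?N - x)"
  proof (rule Z_ge_crossing)
    show "0 \<le> ?\<rho>"
      using assms floor_K_pos[of "m + n0"] n0_pos by (intro mult_nonneg_nonneg Z_nonneg) auto
    fix a assume a: "x \<le> a" "a \<le> x + m"
    have K: "floor_K (m + n0) \<le> K (?y - a)" using a by (intro K_ge) auto
    have "?\<rho> * tail (x + m - a) \<le> ?\<rho> * 1"
      using \<open>0 \<le> ?\<rho>\<close> tail_le_1 by (intro mult_left_mono)
    also have "\<dots> \<le> K (?y - a) * v ?y * Z v ?y (?N - ?y)"
    proof -
      have "floor_K (m + n0) * l \<le> K (?y - a) * v ?y"
        using K assms K_nonneg by (intro mult_mono) auto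
      moreover have "0 \<le> Z v ?y n" using assms(1) by (rule Z_nonneg)
      ultimately show ?thesis by (simp add: mult_right_mono)
    qed
    also have "\<dots> \<le> crossing v ?N (x + m) a"
      by (rule crossing_ge_step) (use assms n0_pos in auto)
    finally show "?\<rho> * tail (x + m - a) \<le> crossing v ?N (x + m) a" .
  qed (use assms in auto)
  then show ?thesis by (simp add: algebra_simps)
qed

text \<open>
  Start \<open>n0\<close> sites before the block and jump directly to the optimal first contact; the
  offset \<open>n0\<close> keeps this jump inside the range of the lower bound for K.
\<close>
lemma B_le_Z:
  assumes "\<And>i. 0 \<le> v i"
  shows "floor_K (m + 2 * n0) * B v (x + n0) m \<le> Z v x (m + n0)"
proof -
  let ?\<kappa> = "floor_K (m + 2 * n0)"
  have \<kappa>: "0 < ?\<kappa>" using floor_K_pos n0_pos by simp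
  have "B v (x + n0) m \<le> Z v x (m + n0) / ?\<kappa> \<or> Z v x (m + n0) / ?\<kappa> < 1"
  proof (cases "1 \<le> Z v x (m + n0) / ?\<kappa>")
    case True
    have "B v (x + n0) m \<le> Z v x (m + n0) / ?\<kappa>"
    proof (rule B_le[OF True])
      fix a assume a: "1 \<le> a" "a \<le> m"
      have "?\<kappa> * (v (x + n0 + a) * Z v (x + n0 + a) (m - a)) \<le> K (n0 + a) * (v (x + n0 + a) * Z v (x + n0 + a) (m - a))"
        using a assms by (intro mult_right_mono K_ge mult_nonneg_nonneg Z_nonneg) auto
      also have "\<dots> \<le> Z v x (m + n0)"
        using Z_ge_step[of v "n0 + a" "m + n0" x] a assms n0_pos by (simp add: algebra_simps)
      finally show "v (x + n0 + a) * Z v (x + n0 + a) (m - a) \<le> Z v x (m + n0) / ?\<kappa>"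
        using \<kappa> by (simp add: field_simps)
    qed
    then show ?thesis ..
  qed auto
  moreover have "1 \<le> Z v x (m + n0) / ?\<kappa>"
  proof -
    have "?\<kappa> \<le> tail (m + n0)" using tail_ge[of "m + n0"] by (simp only: add.assoc mult_2)
    also have "\<dots> \<le> Z v x (m + n0)" using assms by (rule Z_ge_tail)
    finally show ?thesis using \<kappa> by simp
  qed
  ultimately show ?thesis using \<kappa> by (auto simp: field_simps)
qed

end

locale pinning = polynomial_kernel K n0 c1 \<gamma> + ergodic_map S T
  for K :: "nat \<Rightarrow> real" and n0 :: nat and c1 \<gamma> :: real and S :: "'s measure" and T :: "'s \<Rightarrow> 's" +
  fixes V :: "'s \<Rightarrow> nat \<Rightarrow> real" and c :: real
  assumes c_nonneg: "0 \<le> c"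
    and V_lower: "\<And>s n. exp (- c) \<le> V s n"
    and V_upper: "\<And>s n. V s n \<le> exp c"
    and V_T: "\<And>s n. V (T s) n = V s (Suc n)"
    and V_measurable [measurable]: "\<And>n. (\<lambda>s. V s n) \<in> borel_measurable S"
begin

lemma V_pos: "0 < V s n" by (rule less_le_trans[OF exp_gt_zero V_lower])
lemma V_nonneg: "0 \<le> V s n" using V_pos[of s n] by simp

lemma V_T_pow: "V ((T ^^ j) s) = (\<lambda>n. V s (n + j))"
proof (induction j arbitrary: s)
  case (Suc j)
  show ?case using Suc[of "T s"] by (simp add: V_T funpow_swap1)
qed simp

lemma Z_V_pos: "0 < Z (V s) x n"
  by (rule Z_pos) (rule V_nonneg)

lemma Z_T_pow: "Z (V ((T ^^ j) s)) x n = Z (V s) (x + j) n"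
  unfolding V_T_pow by (rule Z_shift)

lemma B_T_pow: "B (V ((T ^^ j) s)) x n = B (V s) (x + j) n"
  unfolding V_T_pow by (rule B_shift)

lemma Z_measurable [measurable]: "(\<lambda>s. Z (V s) x n) \<in> borel_measurable S"
proof (induction n arbitrary: x rule: less_induct)
  case (less n)
  have "(\<lambda>s. tail n + (\<Sum>a=1..n. K a * V s (x + a) * Z (V s) (x + a) (n - a))) \<in> borel_measurable S"
    using less by (intro borel_measurable_add borel_measurable_sum borel_measurable_times) auto
  then show ?case by (subst Z.simps)
qed

lemma B_measurable [measurable]: "(\<lambda>s. B (V s) x n) \<in> borel_measurable S"
proof -
  have eq: "B (V s) x n = Max ((\<lambda>a. if a = 0 then 1 else V s (x + a) * Z (V s) (x + a) (n - a)) ` {0..n})" for s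
  proof -
    have "{0..n} = insert 0 {1..n}" by auto
    then show ?thesis unfolding B_def by (auto intro!: arg_cong[where f=Max] image_cong)
  qed
  show ?thesis unfolding eq by (rule borel_measurable_Max) auto
qed

definition lnZ :: "nat \<Rightarrow> 's \<Rightarrow> real" where "lnZ n s = ln (Z (V s) 0 n)"
definition lnB :: "nat \<Rightarrow> 's \<Rightarrow> real" where "lnB n s = ln (B (V s) 0 n)"

lemma lnZ_measurable [measurable]: "lnZ n \<in> borel_measurable S"
  and lnB_measurable [measurable]: "lnB n \<in> borel_measurable S"
  unfolding lnZ_def lnB_def by measurable

lemma B_le_exp: "B (V s) x n \<le> exp (c * real n)"
  by (rule B_le_exp_of_bound) (auto simp: V_nonneg V_upper c_nonneg)

lemma lnB_nonneg: "0 \<le> lnB n s"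
  unfolding lnB_def using B_ge_1[of "V s" 0 n] by simp

lemma lnB_le: "lnB n s \<le> c * real n"
proof -
  have "lnB n s \<le> ln (exp (c * real n))"
    unfolding lnB_def using B_le_exp[of s 0 n] B_ge_1[of "V s" 0 n] by (intro ln_mono) auto
  then show ?thesis by simp
qed

lemma lnZ_le_lnB: "lnZ n s \<le> lnB n s"
  unfolding lnZ_def lnB_def using Z_le_B[of "V s" 0 n] Z_pos[of "V s" 0 n] V_nonneg by (simp add: ln_mono)

lemma lnZ_ge: "ln (floor_K (n + n0)) \<le> lnZ n s"
  unfolding lnZ_def using Z_ge_tail[of "V s" n 0] tail_ge[of n] floor_K_pos[of "n + n0"] n0_pos V_nonneg
  by (intro ln_mono) (auto intro: order_trans)

text \<open>
  A common bound for the logarithms of all polynomial factors attached to a block of length m.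
\<close>
definition loss :: "nat \<Rightarrow> real" where
  "loss m = c + \<bar>ln c1\<bar> + \<gamma> * ln (real (m + 2 * n0))"

lemma loss_nonneg: "0 \<le> loss m"
  unfolding loss_def using c_nonneg \<gamma>_nonneg n0_pos by (intro add_nonneg_nonneg mult_nonneg_nonneg) auto

lemma ln_floor_K_ge: "1 \<le> n \<Longrightarrow> n \<le> m + 2 * n0 \<Longrightarrow> c - loss m \<le> ln (floor_K n)"
proof -
  assume n: "1 \<le> n" "n \<le> m + 2 * n0"
  then have "\<gamma> * ln (real n) \<le> \<gamma> * ln (real (m + 2 * n0))"
    using \<gamma>_nonneg by (intro mult_left_mono ln_mono) auto
  then show ?thesis using n unfolding loss_def by (simp add: ln_floor_K)
qed

lemma abs_lnZ_le: "\<bar>lnZ n s\<bar> \<le> loss n + c * real n"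
proof -
  have "lnZ n s \<le> c * real n" using lnZ_le_lnB[of n s] lnB_le[of n s] by simp
  moreover have "- loss n \<le> lnZ n s"
    using lnZ_ge[of n s] ln_floor_K_ge[of "n + n0" n] n0_pos c_nonneg by simp
  moreover have "0 \<le> c * real n" using c_nonneg by simp
  ultimately show ?thesis using loss_nonneg[of n] unfolding abs_le_iff by linarith
qed

lemma abs_lnB_le: "\<bar>lnB n s\<bar> \<le> c * real n"
  using lnB_nonneg[of n s] lnB_le[of n s] by simp

lemma lnB_T_le: "lnB m ((T ^^ n0) s) \<le> lnZ (m + n0) s + loss m"
proof -
  have f: "0 < floor_K (m + 2 * n0)" using floor_K_pos n0_pos by simp
  have b: "0 < B (V s) n0 m" using B_ge_1[of "V s" n0 m] by simp
  have "ln (floor_K (m + 2 * n0) * B (V s) n0 m) \<le> lnZ (m + n0) s"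
    unfolding lnZ_def using B_le_Z[of "V s" m 0] V_nonneg f b by (intro ln_mono) auto
  then have "ln (floor_K (m + 2 * n0)) + lnB m ((T ^^ n0) s) \<le> lnZ (m + n0) s"
    unfolding lnB_def B_T_pow using f b by (simp add: ln_mult)
  then show ?thesis using ln_floor_K_ge[of "m + 2 * n0" m] n0_pos c_nonneg by simp
qed

lemma expectation_lnB_le: "expectation (lnB m) \<le> expectation (lnZ (m + n0)) + loss m"
proof -
  have int1: "integrable S (\<lambda>s. lnB m ((T ^^ n0) s))"
    by (rule bounded_integrable[of _ "c * real m"]) (auto simp: abs_lnB_le intro: measurable_compose[OF T_pow_measurable])
  have int2: "integrable S (\<lambda>s. lnZ (m + n0) s + loss m)"
    using bounded_integrable[OF lnZ_measurable abs_lnZ_le] by auto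
  have "expectation (lnB m) = expectation (\<lambda>s. lnB m ((T ^^ n0) s))"
    by (rule integral_T_pow[symmetric]) simp
  also have "\<dots> \<le> expectation (\<lambda>s. lnZ (m + n0) s + loss m)"
    using int1 int2 lnB_T_le by (rule integral_mono)
  also have "\<dots> = expectation (lnZ (m + n0)) + loss m"
    using bounded_integrable[OF lnZ_measurable abs_lnZ_le] by (simp add: prob_space)
  finally show ?thesis .
qed

text \<open>
  Cutting at r, r + m, r + 2m, ... leaves two incomplete blocks of length less than m at the ends,
  which contribute at most c m each.
\<close>
lemma lnB_le_blocks:
  assumes "r < m"
  shows "lnB N s \<le> 2 * c * real m + (\<Sum>i<N div m. lnB m ((T ^^ (r + i * m)) s))"
proof (cases "r \<le> N")
  case False
  have "lnB N s \<le> c * real N" by (rule lnB_le)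
  also have "\<dots> \<le> 2 * c * real m"   proof -
    have "c * real N \<le> c * (2 * real m)" using False assms c_nonneg by (intro mult_left_mono) auto
    then show ?thesis by simp
  qed
  finally show ?thesis by (simp add: sum_nonneg lnB_nonneg add_increasing2)
next
  case True
  \<comment> \<open>Complete blocks between the two incomplete ones.\<close>
  define k where "k = (N - r) div m"
  define t where "t = (N - r) mod m"
  have N: "N = r + (k * m + t)" using True by (simp add: k_def t_def)
  have k: "k \<le> N div m" unfolding k_def by (intro div_le_mono) auto
  have t: "t < m" unfolding t_def using assms by auto
  have pos: "0 < B (V s) x n" for x n using B_ge_1[of "V s" x n] by simp
  have "B (V s) 0 N \<le> B (V s) 0 r * B (V s) r (k * m + t)"
    using B_submult[of "V s" 0 r "k * m + t"] V_nonneg by (simp add: N)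
  also have "\<dots> \<le> exp (c * real r) * (B (V s) r (k * m) * B (V s) (r + k * m) t)"
    using B_submult[of "V s" r "k * m" t] V_nonneg pos B_le_exp by (intro mult_mono) (auto simp: less_imp_le)
  also have "\<dots> \<le> exp (c * real r) * ((\<Prod>i<k. B (V s) (r + i * m) m) * exp (c * real t))"
    using B_blocks[of "V s" r k m] V_nonneg pos B_le_exp
    by (intro mult_left_mono mult_mono prod_nonneg) (auto simp: less_imp_le)
  finally have "lnB N s \<le> ln (exp (c * real r) * ((\<Prod>i<k. B (V s) (r + i * m) m) * exp (c * real t)))"
    unfolding lnB_def using pos by (intro ln_mono) auto
  also have "\<dots> = c * real r + (\<Sum>i<k. ln (B (V s) (r + i * m) m)) + c * real t"
  proof -
    have "0 < (\<Prod>i<k. B (V s) (r + i * m) m)" using pos by (intro prod_pos) auto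
    moreover have "ln (\<Prod>i<k. B (V s) (r + i * m) m) = (\<Sum>i<k. ln (B (V s) (r + i * m) m))"
      using pos by (intro ln_prod) (auto simp: less_imp_neq[THEN not_sym])
    ultimately show ?thesis by (simp only: ln_mult_pos mult_pos_pos exp_gt_zero ln_exp add.assoc)
  qed
  also have "(\<Sum>i<k. ln (B (V s) (r + i * m) m)) = (\<Sum>i<k. lnB m ((T ^^ (r + i * m)) s))"
    unfolding lnB_def B_T_pow by simp
  also have "\<dots> \<le> (\<Sum>i<N div m. lnB m ((T ^^ (r + i * m)) s))"
    using k by (intro sum_mono2) (auto simp: lnB_nonneg)
  finally have "lnB N s \<le> c * real r + c * real t + (\<Sum>i<N div m. lnB m ((T ^^ (r + i * m)) s))" by simp
  moreover have "c * real r \<le> c * real m" "c * real t \<le> c * real m"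
    using assms t c_nonneg by (auto intro!: mult_left_mono)
  ultimately show ?thesis by simp
qed

lemma lnB_le_birkhoff:
  assumes "1 \<le> m"
  shows "real m * lnB N s \<le> 2 * c * (real m)\<^sup>2 + birkhoff_sum (lnB m) N s"
proof -
  have "real m * lnB N s = (\<Sum>r<m. lnB N s)" by simp
  also have "\<dots> \<le> (\<Sum>r<m. 2 * c * real m + (\<Sum>i<N div m. lnB m ((T ^^ (r + i * m)) s)))"
    by (intro sum_mono lnB_le_blocks) auto
  also have "\<dots> = 2 * c * (real m)\<^sup>2 + (\<Sum>j<N div m * m. lnB m ((T ^^ j) s))"
    unfolding sum.distrib sum_offsets[where g="\<lambda>j. lnB m ((T ^^ j) s)"] by (simp add: power2_eq_square)
  also have "(\<Sum>j<N div m * m. lnB m ((T ^^ j) s)) \<le> birkhoff_sum (lnB m) N s"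
    unfolding birkhoff_sum_def by (intro sum_mono2) (auto simp: lnB_nonneg elim: less_le_trans)
  finally show ?thesis by simp
qed

lemma lnZ_ge_blocks:
  assumes "k * (m + n0) \<le> N"
  shows "(\<Sum>i<k. lnZ m ((T ^^ (i * (m + n0))) s) - loss m) + lnZ (N - k * (m + n0)) ((T ^^ (k * (m + n0))) s) \<le> lnZ N s"
  using assms
proof (induction k)
  case (Suc k)
  let ?q = "m + n0"
  let ?s = "(T ^^ (k * ?q)) s" and ?n = "N - Suc k * ?q"
  have f: "0 < floor_K ?q" using floor_K_pos n0_pos by simp
  have n: "?q + ?n = N - k * ?q" using Suc.prems by simp
  have "floor_K ?q * exp (- c) * Z (V ?s) 0 m * Z (V ?s) ?q ?n \<le> Z (V ?s) 0 (N - k * ?q)"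
    using Z_concat[of "V ?s" "exp (- c)" m 0 ?n] V_nonneg V_lower n by simp
  then have "ln (floor_K ?q * exp (- c) * Z (V ?s) 0 m * Z (V ?s) ?q ?n) \<le> lnZ (N - k * ?q) ?s"
    unfolding lnZ_def using f Z_pos V_nonneg by (intro ln_mono) (auto intro!: mult_pos_pos)
  also have "ln (floor_K ?q * exp (- c) * Z (V ?s) 0 m * Z (V ?s) ?q ?n)
      = ln (floor_K ?q) - c + ln (Z (V ?s) 0 m) + ln (Z (V ?s) ?q ?n)"
    using f by (simp only: ln_mult_pos mult_pos_pos exp_gt_zero ln_exp Z_V_pos diff_conv_add_uminus)
  also have "ln (Z (V ?s) ?q ?n) = lnZ ?n ((T ^^ (Suc k * ?q)) s)"
    unfolding lnZ_def Z_T_pow by (simp add: algebra_simps)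
  finally have "lnZ m ?s - loss m + lnZ ?n ((T ^^ (Suc k * ?q)) s) \<le> lnZ (N - k * ?q) ?s"
    using ln_floor_K_ge[of ?q m] n0_pos by (simp add: lnZ_def)
  with Suc show ?case by simp
qed simp

text \<open>
  The renewal first jumps to a prescribed site \<open>n0 + r\<close>, then visits consecutive blocks.
  The last incomplete stretch, of length at most twice the period q = m + n0 of the blocks, is bounded
  below by the probability of making no further contact.
\<close>
lemma lnZ_ge_shifted:
  assumes "r < m + n0" "k * (m + n0) + n0 + r \<le> N" "N \<le> k * (m + n0) + n0 + 2 * (m + n0)"
  shows "(\<Sum>i<k. lnZ m ((T ^^ n0) ((T ^^ (r + i * (m + n0))) s)) - loss m) - (loss (m + n0) + loss (2 * (m + n0))) \<le> lnZ N s"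
proof -
  let ?q = "m + n0"
  let ?s = "(T ^^ (n0 + r)) s" and ?N = "N - (n0 + r)"
  have K: "floor_K (n0 + ?q) \<le> K (n0 + r)" using assms by (intro K_ge) auto
  have f: "0 < floor_K (n0 + ?q)" using floor_K_pos n0_pos by simp
  have kN: "k * ?q \<le> ?N" using assms by simp
  have "floor_K (n0 + ?q) * exp (- c) * Z (V s) (n0 + r) ?N \<le> K (n0 + r) * V s (0 + (n0 + r)) * Z (V s) (0 + (n0 + r)) ?N"
    using K V_lower[of s "n0 + r"] f K_nonneg[of "n0 + r"] less_imp_le[OF Z_V_pos[of s "n0 + r" ?N]] V_nonneg[of s "n0 + r"]
    by (intro mult_mono mult_nonneg_nonneg) auto
  also have "\<dots> \<le> Z (V s) 0 N"
    by (rule Z_ge_step) (use V_nonneg n0_pos assms in auto)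
  finally have "ln (floor_K (n0 + ?q) * exp (- c) * Z (V s) (n0 + r) ?N) \<le> lnZ N s"
    unfolding lnZ_def by (intro ln_mono) (auto intro!: mult_pos_pos f Z_V_pos)
  also have "ln (floor_K (n0 + ?q) * exp (- c) * Z (V s) (n0 + r) ?N) = ln (floor_K (n0 + ?q)) - c + lnZ ?N ?s"
    using f unfolding lnZ_def Z_T_pow by (simp only: ln_mult_pos mult_pos_pos exp_gt_zero ln_exp Z_V_pos diff_conv_add_uminus add_0)
  finally have 1: "lnZ ?N ?s - loss ?q \<le> lnZ N s"
    using ln_floor_K_ge[of "n0 + ?q" ?q] n0_pos by simp
  have "?N - k * ?q \<le> 2 * ?q" using assms by simp
  then have "- loss (2 * ?q) \<le> lnZ (?N - k * ?q) ((T ^^ (k * ?q)) ?s)"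
    using lnZ_ge[of "?N - k * ?q" "(T ^^ (k * ?q)) ?s"] ln_floor_K_ge[of "?N - k * ?q + n0" "2 * ?q"] n0_pos c_nonneg by simp
  moreover have "(T ^^ (i * ?q)) ?s = (T ^^ n0) ((T ^^ (r + i * ?q)) s)" for i
  proof -
    have "(T ^^ a) ((T ^^ b) s) = (T ^^ (a + b)) s" for a b by (simp add: funpow_add)
    then show ?thesis by (simp only: ac_simps)
  qed
  ultimately show ?thesis using 1 lnZ_ge_blocks[OF kN, of ?s] by simp
qed

text \<open>
  Guaranteed contribution of one block, after paying for the jump to the next one; the shift by
  \<open>n0\<close> comes from the first jump.
\<close>
definition block_gain :: "nat \<Rightarrow> 's \<Rightarrow> real" where
  "block_gain m s = lnZ m ((T ^^ n0) s) - loss m"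

lemma block_gain_measurable [measurable]: "block_gain m \<in> borel_measurable S"
  unfolding block_gain_def by measurable

lemma abs_block_gain_le: "\<bar>block_gain m s\<bar> \<le> 2 * loss m + c * real m"
  unfolding block_gain_def using abs_lnZ_le[of m "(T ^^ n0) s"] loss_nonneg[of m] by simp

lemma expectation_block_gain: "expectation (block_gain m) = expectation (lnZ m) - loss m"
proof -
  have "integrable S (\<lambda>s. lnZ m ((T ^^ n0) s))"
    by (rule bounded_integrable[where C="loss m + c * real m"]) (auto simp: abs_lnZ_le)
  then show ?thesis unfolding block_gain_def
    using integral_T_pow[of "lnZ m" n0] by (simp add: prob_space)
qed

lemma lnZ_ge_birkhoff:
  assumes "n0 + 2 * (m + n0) \<le> N"
  shows "birkhoff_sum (block_gain m) N s - (real (n0 + 2 * (m + n0)) * (2 * loss m + c * real m)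
     + real (m + n0) * (loss (m + n0) + loss (2 * (m + n0)))) \<le> real (m + n0) * lnZ N s"
proof -
  let ?q = "m + n0"
  let ?G = "2 * loss m + c * real m"
  have q: "0 < ?q" using n0_pos by simp
  \<comment> \<open>One period is reserved for the offset, hence the subtraction of q before
    dividing.\<close>
  define k where "k = (N - n0 - ?q) div ?q"
  have "k * ?q \<le> N - n0 - ?q" "N - n0 - ?q < k * ?q + ?q"
    unfolding k_def using div_mult_mod_eq[of "N - n0 - ?q" ?q] mod_less_divisor[OF q, of "N - n0 - ?q"]
    by linarith+
  then have k: "k * ?q + n0 + ?q \<le> N" "N \<le> k * ?q + n0 + 2 * ?q" using assms by simp_all
  have "(\<Sum>r<?q. (\<Sum>i<k. block_gain m ((T ^^ (r + i * ?q)) s)) - (loss ?q + loss (2 * ?q))) \<le> (\<Sum>r<?q. lnZ N s)"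
    unfolding block_gain_def using k by (intro sum_mono lnZ_ge_shifted) auto
  then have 1: "(\<Sum>j<k * ?q. block_gain m ((T ^^ j) s)) - real ?q * (loss ?q + loss (2 * ?q)) \<le> real ?q * lnZ N s"
    unfolding sum_subtractf sum_offsets[where g="\<lambda>j. block_gain m ((T ^^ j) s)"] by simp
  have G: "0 \<le> ?G" using loss_nonneg[of m] c_nonneg by simp
  have "{..<N} = {..<k * ?q} \<union> {k * ?q..<N}" "{..<k * ?q} \<inter> {k * ?q..<N} = {}" using k by auto
  then have "birkhoff_sum (block_gain m) N s = (\<Sum>j<k * ?q. block_gain m ((T ^^ j) s)) + (\<Sum>j\<in>{k * ?q..<N}. block_gain m ((T ^^ j) s))"
    unfolding birkhoff_sum_def by (simp add: sum.union_disjoint)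
  moreover have "(\<Sum>j\<in>{k * ?q..<N}. block_gain m ((T ^^ j) s)) \<le> real (card {k * ?q..<N}) * ?G"
    using abs_block_gain_le by (intro sum_bounded_above) (auto simp: abs_le_iff)
  moreover have "real (card {k * ?q..<N}) * ?G \<le> real (n0 + 2 * ?q) * ?G"
  proof (intro mult_right_mono G of_nat_mono)
    show "card {k * ?q..<N} \<le> n0 + 2 * ?q" using k by simp
  qed
  ultimately show ?thesis using 1 by linarith
qed

definition upper_rate :: "nat \<Rightarrow> real" where
  "upper_rate m = (expectation (lnZ (m + n0)) + loss m) / real m"

definition lower_rate :: "nat \<Rightarrow> real" where
  "lower_rate m = (expectation (lnZ m) - loss m) / real (m + n0)"

lemma limsup_le_upper_rate:
  assumes "1 \<le> m"
  shows "AE s in S. \<forall>e>0. \<forall>\<^sub>F N in sequentially. lnZ N s / real N < upper_rate m + e"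
proof -
  have "AE s in S. (\<lambda>n. birkhoff_sum (lnB m) n s / real n) \<longlonglongrightarrow> expectation (lnB m)"
    by (rule birkhoff[OF lnB_measurable abs_lnB_le])
  then show ?thesis
  proof (eventually_elim, intro allI impI)
    fix s and e :: real
    assume lim: "(\<lambda>n. birkhoff_sum (lnB m) n s / real n) \<longlonglongrightarrow> expectation (lnB m)" and "0 < e"
    have "(\<lambda>N. 2 * c * real m / real N + birkhoff_sum (lnB m) N s / real N / real m) \<longlonglongrightarrow> 0 + expectation (lnB m) / real m"
      by (intro tendsto_add tendsto_divide lim tendsto_const lim_const_over_n) (use assms in auto)
    moreover have "0 + expectation (lnB m) / real m < upper_rate m + e"
    proof -
      have "expectation (lnB m) / real m \<le> upper_rate m"
        unfolding upper_rate_def by (intro divide_right_mono expectation_lnB_le) simp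
      then show ?thesis using \<open>0 < e\<close> by simp
    qed
    ultimately have "\<forall>\<^sub>F N in sequentially. 2 * c * real m / real N + birkhoff_sum (lnB m) N s / real N / real m < upper_rate m + e"
      by (rule order_tendstoD)
    then show "\<forall>\<^sub>F N in sequentially. lnZ N s / real N < upper_rate m + e"
      using eventually_gt_at_top[of 0]
    proof eventually_elim
      case (elim N)
      have "lnZ N s \<le> 2 * c * real m + birkhoff_sum (lnB m) N s / real m"
      proof -
        have "lnB N s \<le> (2 * c * (real m)\<^sup>2 + birkhoff_sum (lnB m) N s) / real m"
          using lnB_le_birkhoff[OF assms, of N s] assms by (simp add: pos_le_divide_eq mult.commute)
        also have "\<dots> = 2 * c * real m + birkhoff_sum (lnB m) N s / real m"
          using assms by (simp add: add_divide_distrib power2_eq_square)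
        finally show ?thesis using lnZ_le_lnB[of N s] by simp
      qed
      then have "lnZ N s / real N \<le> (2 * c * real m + birkhoff_sum (lnB m) N s / real m) / real N"
        by (rule divide_right_mono) simp
      also have "\<dots> = 2 * c * real m / real N + birkhoff_sum (lnB m) N s / real N / real m"
        by (simp add: add_divide_distrib)
      finally show ?case using elim by simp
    qed
  qed
qed

lemma liminf_ge_lower_rate:
  "AE s in S. \<forall>e>0. \<forall>\<^sub>F N in sequentially. lower_rate m - e < lnZ N s / real N"
proof -
  have "AE s in S. (\<lambda>n. birkhoff_sum (block_gain m) n s / real n) \<longlonglongrightarrow> expectation (block_gain m)"
    by (rule birkhoff[OF block_gain_measurable abs_block_gain_le])
  then show ?thesis
  proof (eventually_elim, intro allI impI)
    fix s and e :: real
    assume lim: "(\<lambda>n. birkhoff_sum (block_gain m) n s / real n) \<longlonglongrightarrow> expectation (block_gain m)" and "0 < e"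
    define D where "D = (real (n0 + 2 * (m + n0)) * (2 * loss m + c * real m)
     + real (m + n0) * (loss (m + n0) + loss (2 * (m + n0))))"
    have q: "0 < real (m + n0)" using n0_pos by simp
    have "(\<lambda>N. (birkhoff_sum (block_gain m) N s / real N - D / real N) / real (m + n0)) \<longlonglongrightarrow> (expectation (block_gain m) - 0) / real (m + n0)"
      by (intro tendsto_diff tendsto_divide lim tendsto_const lim_const_over_n) (use q in auto)
    moreover have "lower_rate m - e < (expectation (block_gain m) - 0) / real (m + n0)"
      using \<open>0 < e\<close> unfolding lower_rate_def expectation_block_gain by simp
    ultimately have "\<forall>\<^sub>F N in sequentially. lower_rate m - e < (birkhoff_sum (block_gain m) N s / real N - D / real N) / real (m + n0)"
      by (rule order_tendstoD)
    then show "\<forall>\<^sub>F N in sequentially. lower_rate m - e < lnZ N s / real N"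
      using eventually_ge_at_top[of "n0 + 2 * (m + n0)"]
    proof eventually_elim
      case (elim N)
      have "birkhoff_sum (block_gain m) N s - D \<le> real (m + n0) * lnZ N s"
        unfolding D_def by (rule lnZ_ge_birkhoff[OF elim(2)])
      then have "(birkhoff_sum (block_gain m) N s - D) / real N / real (m + n0) \<le> real (m + n0) * lnZ N s / real N / real (m + n0)"
        using q by (intro divide_right_mono) auto
      also have "\<dots> = lnZ N s / real N" using q by simp
      finally show ?case using elim by (simp add: diff_divide_distrib)
    qed
  qed
qed

lemma lower_rate_le_upper_rate:
  assumes "1 \<le> m" shows "lower_rate k \<le> upper_rate m"
proof (rule field_le_epsilon)
  fix e :: real assume e: "0 < e"
  have "AE s in S. lower_rate k \<le> upper_rate m + e"
    using limsup_le_upper_rate[OF assms] liminf_ge_lower_rate[of k]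
  proof eventually_elim
    case (elim s)
    then have "\<forall>\<^sub>F N in sequentially. lnZ N s / real N < upper_rate m + e / 2"
      "\<forall>\<^sub>F N in sequentially. lower_rate k - e / 2 < lnZ N s / real N" using e by auto
    then have "\<forall>\<^sub>F N in sequentially. lower_rate k - e / 2 < upper_rate m + e / 2"
      by eventually_elim (rule less_trans)
    then show ?case by (simp add: eventually_const_iff)
  qed
  then show "lower_rate k \<le> upper_rate m + e" by simp
qed

lemma abs_expectation_lnZ_le: "\<bar>expectation (lnZ m)\<bar> \<le> loss m + c * real m"
proof -
  have "\<bar>expectation (lnZ m)\<bar> \<le> expectation (\<lambda>s. \<bar>lnZ m s\<bar>)" by (rule integral_abs_bound)
  also have "\<dots> \<le> expectation (\<lambda>s. loss m + c * real m)"
    using bounded_integrable[OF lnZ_measurable abs_lnZ_le] by (intro integral_mono) (auto simp: abs_lnZ_le)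
  finally show ?thesis by (simp add: prob_space)
qed

lemma loss_over_n: "(\<lambda>m. loss (m + k) / real m) \<longlonglongrightarrow> 0"
  unfolding loss_def by real_asymp

text \<open>
  Both rates are built from the expectation for the same block length, so they differ by the
  normalisations 1/m and 1/(m + 2 n0), a relative error O(1/m) on a bounded quantity, and by
  logarithmic losses divided by m.
\<close>
lemma rates_close: "(\<lambda>m. upper_rate m - lower_rate (m + n0)) \<longlonglongrightarrow> 0"
proof -
  let ?g = "\<lambda>m. (loss (m + n0) / real m + 2 * c) * (2 * real n0 / real (m + 2 * n0)) + loss (m + 0) / real m + loss (m + n0) / real m"
  have bound: "\<forall>\<^sub>F m in sequentially. norm (upper_rate m - lower_rate (m + n0)) \<le> ?g m"
    using eventually_ge_at_top[of "n0"]
  proof eventually_elim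
    case (elim m)
    have m: "0 < real m" using elim n0_pos by simp
    let ?z = "expectation (lnZ (m + n0))"
    have "upper_rate m - lower_rate (m + n0) = ?z / real m * (2 * real n0 / real (m + 2 * n0)) + loss m / real m + loss (m + n0) / real (m + 2 * n0)"
    proof -
      have aux: "(z + a) / M - (z - b) / D = z / M * ((D - M) / D) + a / M + b / D"
        if "0 < M" "0 < D" for z a b M D :: real
        using that by (simp add: field_simps)
      have "m + n0 + n0 = m + 2 * n0" by simp
      then show ?thesis unfolding upper_rate_def lower_rate_def
        using aux[of "real m" "real (m + 2 * n0)" ?z "loss m" "loss (m + n0)"] m by (simp add: add.commute)
    qed
    moreover have "\<bar>?z / real m * (2 * real n0 / real (m + 2 * n0))\<bar> \<le> (loss (m + n0) / real m + 2 * c) * (2 * real n0 / real (m + 2 * n0))"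
    proof -
      have "\<bar>?z\<bar> / real m \<le> (loss (m + n0) + c * real (m + n0)) / real m"
        using abs_expectation_lnZ_le[of "m + n0"] m by (intro divide_right_mono) auto
      also have "\<dots> \<le> loss (m + n0) / real m + 2 * c"
        using m elim c_nonneg by (simp add: field_simps) (simp add: mult_left_mono)
      finally have "\<bar>?z\<bar> / real m * (2 * real n0 / real (m + 2 * n0))
          \<le> (loss (m + n0) / real m + 2 * c) * (2 * real n0 / real (m + 2 * n0))"
        by (rule mult_right_mono) simp
      then show ?thesis by (simp only: abs_mult abs_divide abs_of_nat abs_numeral)
    qed
    moreover have "loss (m + n0) / real (m + 2 * n0) \<le> loss (m + n0) / real m"
      using m loss_nonneg[of "m + n0"] by (intro divide_left_mono mult_pos_pos) auto
    moreover have "0 \<le> loss m / real m" "0 \<le> loss (m + n0) / real (m + 2 * n0)" using loss_nonneg by auto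
    ultimately show ?case unfolding real_norm_def add_0_right by linarith
  qed
  have "(\<lambda>m. 2 * real n0 / real (m + 2 * n0)) \<longlonglongrightarrow> 0" by real_asymp
  then have lim: "?g \<longlonglongrightarrow> (0 + 2 * c) * 0 + 0 + 0"
    by (intro tendsto_add tendsto_mult loss_over_n tendsto_const)
  have "?g \<longlonglongrightarrow> 0" by (rule tendsto_eq_rhs[OF lim]) simp
  then show ?thesis by (rule Lim_null_comparison[OF bound])
qed

text \<open>
  Almost surely every limit point lies between all lower rates and all upper rates, and these come
  arbitrarily close to each other. Convergence of the expectations follows by dominated convergence.
\<close>
theorem free_energy_exists:
  "\<exists>F. (AE s in S. (\<lambda>N. lnZ N s / real N) \<longlonglongrightarrow> F) \<and> (\<lambda>N. expectation (lnZ N) / real N) \<longlonglongrightarrow> F"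
proof -
  define F where "F = (INF m\<in>{1..}. upper_rate m)"
  have bdd: "bdd_below (upper_rate ` {1..})"
    using lower_rate_le_upper_rate[of _ 0] by (intro bdd_belowI[of _ "lower_rate 0"]) auto
  have up: "F \<le> upper_rate m" if "1 \<le> m" for m
    unfolding F_def using that by (intro cINF_lower bdd) auto
  have lo: "lower_rate m \<le> F" for m
    unfolding F_def by (intro cINF_greatest lower_rate_le_upper_rate) auto
  have close: "\<exists>m\<ge>1. upper_rate m < F + e \<and> F - e < lower_rate (m + n0)" if "0 < e" for e
  proof -
    have "\<forall>\<^sub>F m in sequentially. upper_rate m - lower_rate (m + n0) < e"
      by (rule order_tendstoD(2)[OF rates_close that])
    then have "\<forall>\<^sub>F m in sequentially. 1 \<le> m \<and> upper_rate m - lower_rate (m + n0) < e"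
      using eventually_ge_at_top[of 1] by eventually_elim simp
    from eventually_happens'[OF sequentially_bot this]
    obtain m where "1 \<le> m" "upper_rate m - lower_rate (m + n0) < e" by blast
    then show ?thesis using up[of m] lo[of "m + n0"] by (intro exI[of _ m]) simp
  qed
  have AE: "AE s in S. (\<lambda>N. lnZ N s / real N) \<longlonglongrightarrow> F"
  proof -
    have "AE s in S. \<forall>m. 1 \<le> m \<longrightarrow> (\<forall>e>0. \<forall>\<^sub>F N in sequentially. lnZ N s / real N < upper_rate m + e)"
      using limsup_le_upper_rate by (simp add: AE_all_countable)
    moreover have "AE s in S. \<forall>m. \<forall>e>0. \<forall>\<^sub>F N in sequentially. lower_rate m - e < lnZ N s / real N"
      using liminf_ge_lower_rate by (simp add: AE_all_countable)
    ultimately show ?thesis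
    proof eventually_elim
      case (elim s)
      show ?case
      proof (rule tendstoI)
        fix e :: real assume "0 < e"
        then obtain m where m: "1 \<le> m" "upper_rate m < F + e / 2" "F - e / 2 < lower_rate (m + n0)"
          using close[of "e / 2"] by auto
        have "\<forall>\<^sub>F N in sequentially. lnZ N s / real N < upper_rate m + e / 2"
          "\<forall>\<^sub>F N in sequentially. lower_rate (m + n0) - e / 2 < lnZ N s / real N"
          using elim m(1) \<open>0 < e\<close> by auto
        then show "\<forall>\<^sub>F N in sequentially. dist (lnZ N s / real N) F < e"
          by eventually_elim (use m in \<open>simp add: dist_real_def abs_less_iff\<close>)
      qed
    qed
  qed
  have "(\<lambda>N. expectation (\<lambda>s. lnZ N s / real N)) \<longlonglongrightarrow> expectation (\<lambda>_. F)"
  proof -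
    have "(\<lambda>m. loss (m + 0) / real m) \<longlonglongrightarrow> 0" by (rule loss_over_n)
    then have "Bseq (\<lambda>m. loss m / real m)" by (auto intro: convergent_imp_Bseq convergentI)
    then obtain C where C: "\<And>m. norm (loss m / real m) \<le> C" unfolding Bseq_def by blast
    have C0: "0 \<le> C" using C[of 0] by simp
    show ?thesis
    proof (rule integral_dominated_convergence[where w="\<lambda>_. C + c"])
      show "AE s in S. norm (lnZ N s / real N) \<le> C + c" for N
      proof (intro AE_I2)
        fix s
        have "norm (lnZ N s / real N) \<le> (loss N + c * real N) / real N"
          using abs_lnZ_le[of N s] by (simp add: divide_right_mono)
        also have "\<dots> \<le> C + c" using C[of N] C0 c_nonneg loss_nonneg[of N] by (cases "N = 0") (auto simp: add_divide_distrib)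
        finally show "norm (lnZ N s / real N) \<le> C + c" .
      qed
    qed (use AE in auto)
  qed
  then show ?thesis using AE by (auto simp: prob_space)
qed

end

section \<open>Growth and domination of solutions of the renewal equation\<close>

context renewal_kernel
begin

text \<open>
  An exponential with rate \<rho> is a subsolution of the renewal equation as soon as the truncated
  Laplace transform of K at \<rho> compensates the weight p.
\<close>
lemma Z_growth:
  assumes v: "\<And>i. 0 \<le> v i" and p: "\<And>i. x < i \<Longrightarrow> i \<le> x + n \<Longrightarrow> p \<le> v i"
    and "0 \<le> p" "0 \<le> \<rho>" and crit: "1 \<le> p * (\<Sum>a=1..A. K a * exp (- \<rho> * real a))"
  shows "tail A * exp (- \<rho> * real A) * exp (\<rho> * real n) \<le> Z v x n"
  using p
proof (induction n arbitrary: x rule: less_induct)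
  case (less n)
  let ?C = "tail A * exp (- \<rho> * real A)"
  have C: "0 \<le> ?C" using tail_nonneg[of A] by simp
  show ?case
  proof (cases "n \<le> A")
    case True
    have "?C * exp (\<rho> * real n) = tail A * exp (\<rho> * (real n - real A))"
      by (simp add: exp_add[symmetric] algebra_simps)
    also have "\<dots> \<le> tail A * 1"
      using True \<open>0 \<le> \<rho>\<close> tail_nonneg[of A] by (intro mult_left_mono) (auto simp: mult_nonneg_nonpos)
    also have "\<dots> \<le> tail n" using tail_mono[OF True] by simp
    also have "\<dots> \<le> Z v x n" by (rule Z_ge_tail) (rule v)
    finally show ?thesis .
  next
    case False
    have "?C * exp (\<rho> * real n) \<le> (?C * exp (\<rho> * real n)) * (p * (\<Sum>a=1..A. K a * exp (- \<rho> * real a)))"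
      using mult_left_mono[OF crit, of "?C * exp (\<rho> * real n)"] C by simp
    also have "\<dots> = (\<Sum>a=1..A. K a * p * (?C * exp (\<rho> * real n) * exp (- \<rho> * real a)))"
      by (simp add: sum_distrib_left mult_ac)
    also have "\<dots> = (\<Sum>a=1..A. K a * p * (?C * exp (\<rho> * real (n - a))))"
      using False by (intro sum.cong refl) (simp add: exp_add[symmetric] of_nat_diff algebra_simps)
    also have "\<dots> \<le> (\<Sum>a=1..A. K a * v (x + a) * Z v (x + a) (n - a))"
    proof (intro sum_mono mult_mono)
      fix a assume a: "a \<in> {1..A}"
      show "p \<le> v (x + a)" using less.prems a False by auto
      show "?C * exp (\<rho> * real (n - a)) \<le> Z v (x + a) (n - a)"
        by (rule less.IH) (use a False less.prems in auto)
    qed (use \<open>0 \<le> p\<close> K_nonneg v C in auto)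
    also have "\<dots> \<le> (\<Sum>a=1..n. K a * v (x + a) * Z v (x + a) (n - a))"
      using False v by (intro sum_mono2) (auto intro!: mult_nonneg_nonneg K_nonneg Z_nonneg)
    also have "\<dots> \<le> Z v x n" using tail_nonneg[of n] by (subst (2) Z.simps) simp
    finally show ?thesis .
  qed
qed

lemma laplace_ge:
  assumes "0 \<le> \<rho>"
  shows "1 - tail A - \<rho> * (\<Sum>a=1..A. real a * K a) \<le> (\<Sum>a=1..A. K a * exp (- \<rho> * real a))"
proof -
  have "1 - tail A - \<rho> * (\<Sum>a=1..A. real a * K a) = (\<Sum>a=1..A. K a * (1 + - \<rho> * real a))"
    using tail_plus_sum[of A] by (simp add: sum_distrib_left algebra_simps sum_subtractf)
  also have "\<dots> \<le> (\<Sum>a=1..A. K a * exp (- \<rho> * real a))"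
    using K_nonneg by (intro sum_mono mult_left_mono exp_ge_add_one_self) auto
  finally show ?thesis .
qed

text \<open>
  The product of the one-step bounds over the sites still to come is a supersolution.
\<close>
lemma Z_le_sites:
  assumes v: "\<And>i. 0 \<le> v i" and s: "\<And>x. 1 \<le> s x"
    and step: "\<And>x n. x + n = N \<Longrightarrow> tail n + (\<Sum>a=1..n. K a * v (x + a)) \<le> s x"
    and "x + n = N"
  shows "Z v x n \<le> (\<Prod>z\<in>{x..N}. s z)"
proof (rule Z_le_potential[where N=N and \<Phi>="\<lambda>x. \<Prod>z\<in>{x..N}. s z"])
  fix x n assume xn: "x + n = N"
  let ?P = "\<Prod>z\<in>{x + 1..N}. s z"
  have P1: "1 \<le> ?P" using s by (intro prod_ge_1) auto
  have "(\<Sum>a=1..n. K a * v (x + a) * (\<Prod>z\<in>{x + a..N}. s z)) \<le> (\<Sum>a=1..n. K a * v (x + a) * ?P)"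
  proof (intro sum_mono mult_left_mono)
    fix a assume a: "a \<in> {1..n}"
    have "(\<Prod>z\<in>{x + a..N}. s z) \<le> ?P"
      using a s by (intro prod_mono2) (auto intro: order_trans[OF zero_le_one])
    then show "(\<Prod>z\<in>{x + a..N}. s z) \<le> ?P" .
  qed (use v K_nonneg in auto)
  moreover have "tail n * 1 \<le> tail n * ?P" using P1 tail_nonneg by (intro mult_left_mono) auto
  ultimately have "tail n + (\<Sum>a=1..n. K a * v (x + a) * (\<Prod>z\<in>{x + a..N}. s z))
      \<le> (tail n + (\<Sum>a=1..n. K a * v (x + a))) * ?P"
    by (simp add: distrib_right sum_distrib_right)
  also have "\<dots> \<le> s x * ?P" using step[OF xn] P1 by (intro mult_right_mono) auto
  also have "\<dots> = (\<Prod>z\<in>{x..N}. s z)"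
  proof -
    have "{x..N} = insert x {x + 1..N}" using xn by auto
    then show ?thesis by simp
  qed
  finally show "tail n + (\<Sum>a=1..n. K a * v (x + a) * (\<Prod>z\<in>{x + a..N}. s z)) \<le> (\<Prod>z\<in>{x..N}. s z)" .
qed (use assms in auto)

lemma one_step_le:
  assumes "\<And>i. v i \<le> exp u" "0 \<le> u"
  shows "tail n + (\<Sum>a=1..n. K a * v (x + a)) \<le> exp u"
proof -
  have "(\<Sum>a=1..n. K a * v (x + a)) \<le> (\<Sum>a=1..n. K a * exp u)"
    using assms K_nonneg by (intro sum_mono mult_left_mono) auto
  moreover have "tail n * 1 \<le> tail n * exp u" using assms tail_nonneg by (intro mult_left_mono) auto
  ultimately have "tail n + (\<Sum>a=1..n. K a * v (x + a)) \<le> (tail n + sum K {1..n}) * exp u"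
    by (simp add: distrib_right sum_distrib_right)
  then show ?thesis unfolding tail_plus_sum by simp
qed

text \<open>
  The jump to the single site a0, whose weight is reduced by the factor b, already lowers the one-step
  bound e^u by the fraction (1-b) K(a0).
\<close>
lemma one_step_le_good:
  assumes "\<And>i. v i \<le> exp u" "0 \<le> u" "1 \<le> a0" "a0 \<le> n" "v (x + a0) \<le> exp u * b"
  shows "tail n + (\<Sum>a=1..n. K a * v (x + a)) \<le> exp u * (1 - (1 - b) * K a0)"
proof -
  have "(\<Sum>a=1..n. K a * v (x + a)) \<le> (\<Sum>a=1..n. K a * exp u - (if a = a0 then exp u * (1 - b) * K a0 else 0))"
  proof (intro sum_mono)
    fix a assume "a \<in> {1..n}"
    show "K a * v (x + a) \<le> K a * exp u - (if a = a0 then exp u * (1 - b) * K a0 else 0)"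
    proof (cases "a = a0")
      case True
      then show ?thesis using mult_left_mono[OF assms(5) K_nonneg[of a0]] by (simp add: algebra_simps)
    next
      case False
      then show ?thesis using mult_left_mono[OF assms(1) K_nonneg] by simp
    qed
  qed
  also have "\<dots> = exp u * sum K {1..n} - exp u * (1 - b) * K a0"
    using assms by (simp add: sum_subtractf sum_distrib_left mult.commute)
  finally have "(\<Sum>a=1..n. K a * v (x + a)) \<le> exp u * sum K {1..n} - exp u * (1 - b) * K a0" .
  moreover have "tail n * 1 \<le> tail n * exp u" using assms tail_nonneg by (intro mult_left_mono) auto
  ultimately have "tail n + (\<Sum>a=1..n. K a * v (x + a)) \<le> (tail n + sum K {1..n}) * exp u - exp u * (1 - b) * K a0"
    by (simp add: algebra_simps)
  then show ?thesis unfolding tail_plus_sum by (simp add: algebra_simps)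
qed

text \<open>
  The supersolution is constant on each block. Inside a bad block the value doubles: each contact
  leaves the block at the next jump with probability at least 4u, and a geometric number of contacts
  with this exit probability has bounded total weight. In a good block the reduced weights met when
  jumping over a distance at least m, hence into a later block, offset the gain 2u of contacts inside
  the block. The additional factor e^u per block is the weight of its first contact.
\<close>
lemma Z_le_blocks:
  fixes bad :: "nat \<Rightarrow> bool"
  assumes v: "\<And>i. 0 \<le> v i" "\<And>i. v i \<le> exp u" and u: "0 \<le> u" "u \<le> 1" and m: "1 \<le> m"
    and exit: "4 * u \<le> tail m"
    and good: "\<And>x. x \<le> N \<Longrightarrow> \<not> bad (x div m) \<Longrightarrow>
        2 * u \<le> (\<Sum>y\<in>{y. x + m \<le> y \<and> y \<le> N}. K (y - x) * (1 - v y / exp u))"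
  shows "Z v 0 N \<le> exp (u * real (N div m + 1)) * 2 ^ card {j \<in> {..N div m}. bad j}"
proof -
  define s where "s j = (if bad j then 2 else 1 :: real)" for j
  define J where "J = N div m"
  \<comment> \<open>Factor of all blocks from j on, including the weight of a first contact in each of
    them.\<close>
  define T where "T j = (\<Prod>k\<in>{j..J}. exp u * s k)" for j
  have s1: "1 \<le> s j" "0 \<le> s j" for j unfolding s_def by auto
  have eu: "1 \<le> exp u" "exp u \<le> 1 + 2 * u"
    using u exp_bound[of u] by (auto simp: power2_eq_square mult_left_le intro: order_trans)
  have t1: "1 \<le> exp u * s j" for j using mult_mono[OF eu(1) s1(1)] by simp
  have T_mono: "T j \<le> T i" if "i \<le> j" for i j
    unfolding T_def using that t1 by (intro prod_mono2) (auto intro: order_trans[OF zero_le_one])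
  have T1: "1 \<le> T j" for j unfolding T_def using t1 by (intro prod_ge_1) auto
  have T_step: "exp u * s j * T (Suc j) = T j" if "j \<le> J" for j
  proof -
    have "{j..J} = insert j {Suc j..J}" using that by auto
    then show ?thesis unfolding T_def by simp
  qed
  define \<Phi> where "\<Phi> x = s (x div m) * T (Suc (x div m))" for x
  have "Z v 0 N \<le> \<Phi> 0"
  proof (rule Z_le_potential[where N=N and \<Phi>=\<Phi>])
    fix x n assume xn: "x + n = N"
    define i where "i = x div m"
    define I where "I = {a\<in>{1..n}. (x + a) div m = i}"
    define O' where "O' = {a\<in>{1..n}. (x + a) div m \<noteq> i}"
    \<comment> \<open>Probability of leaving the block at the next jump.\<close>
    define \<kappa> where "\<kappa> = tail n + sum K O'"
    have fin: "finite I" "finite O'" unfolding I_def O'_def by auto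
    have IO: "{1..n} = I \<union> O'" "I \<inter> O' = {}" unfolding I_def O'_def by auto
    have \<kappa>1: "\<kappa> + sum K I = 1"
      using tail_plus_sum[of n] unfolding \<kappa>_def IO(1) using IO(2) fin by (simp add: sum.union_disjoint)
    have I_small: "a < m" if "a \<in> I" for a
    proof (rule ccontr)
      assume "\<not> a < m"
      then have "(x + m) div m \<le> (x + a) div m" by (intro div_le_mono) auto
      then show False using that m unfolding I_def i_def by simp
    qed
    have "I \<subseteq> {1..m}"
    proof
      fix a assume a: "a \<in> I"
      then have "1 \<le> a" by (simp add: I_def)
      then show "a \<in> {1..m}" using I_small[OF a] by simp
    qed
    then have "sum K I \<le> sum K {1..m}"
      by (intro sum_mono2 K_nonneg) auto
    then have \<kappa>_ge: "tail m \<le> \<kappa>" using \<kappa>1 tail_plus_sum[of m] by simp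
    have TI: "0 \<le> T (Suc i)" using T1[of "Suc i"] by simp
    have inner: "(\<Sum>a\<in>I. K a * v (x + a) * \<Phi> (x + a)) \<le> exp u * s i * sum K I * T (Suc i)"
    proof -
      have "(\<Sum>a\<in>I. K a * v (x + a) * \<Phi> (x + a)) \<le> (\<Sum>a\<in>I. K a * exp u * (s i * T (Suc i)))"
        using v s1 TI K_nonneg by (intro sum_mono mult_mono) (auto simp: \<Phi>_def I_def)
      then show ?thesis by (simp add: sum_distrib_left sum_distrib_right mult_ac)
    qed
    have outer: "(\<Sum>a\<in>O'. K a * v (x + a) * \<Phi> (x + a)) \<le> (\<Sum>a\<in>O'. K a * (v (x + a) / exp u)) * T (Suc i)"
    proof -
      have "K a * v (x + a) * \<Phi> (x + a) \<le> K a * (v (x + a) / exp u) * T (Suc i)" if a: "a \<in> O'" for a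
      proof -
        let ?j = "(x + a) div m"
        have j: "Suc i \<le> ?j" using a div_le_mono[of x "x + a" m] unfolding O'_def i_def by auto
        have jJ: "?j \<le> J" unfolding J_def using a xn by (intro div_le_mono) (auto simp: O'_def)
        have "v (x + a) * \<Phi> (x + a) = v (x + a) / exp u * T ?j"
          unfolding \<Phi>_def T_step[OF jJ, symmetric] by simp
        also have "\<dots> \<le> v (x + a) / exp u * T (Suc i)"
          using v T_mono[OF j] by (intro mult_left_mono) auto
        finally have "v (x + a) * \<Phi> (x + a) \<le> v (x + a) / exp u * T (Suc i)" .
        from mult_left_mono[OF this K_nonneg[of a]] show ?thesis by (simp only: mult.assoc)
      qed
      then show ?thesis unfolding sum_distrib_right by (rule sum_mono)
    qed
    have bracket: "tail n + exp u * s i * sum K I + (\<Sum>a\<in>O'. K a * (v (x + a) / exp u)) \<le> s i"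
    proof (cases "bad i")
      case True
      have "(\<Sum>a\<in>O'. K a * (v (x + a) / exp u)) \<le> (\<Sum>a\<in>O'. K a * 1)"
        using v K_nonneg by (intro sum_mono mult_left_mono) auto
      then have "tail n + exp u * s i * sum K I + (\<Sum>a\<in>O'. K a * (v (x + a) / exp u)) \<le> \<kappa> + exp u * 2 * sum K I"
        using True by (simp add: \<kappa>_def s_def)
      also have "\<dots> \<le> \<kappa> + (1 + 2 * u) * 2 * sum K I"
        using eu K_nonneg by (intro add_left_mono mult_right_mono sum_nonneg) auto
      also have "\<dots> = 2 + 4 * u - \<kappa> - 4 * u * \<kappa>"
      proof -
        have "sum K I = 1 - \<kappa>" using \<kappa>1 by simp
        then show ?thesis by (simp only:) (simp add: algebra_simps)
      qed
      also have "\<dots> \<le> 2"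
      proof -
        have "0 \<le> 4 * u * \<kappa>"
          using \<kappa>_ge u tail_nonneg[of m] by (intro mult_nonneg_nonneg) auto
        then show ?thesis using \<kappa>_ge exit by linarith
      qed
      finally show ?thesis using True by (simp add: s_def)
    next
      case False
      let ?W = "{y. x + m \<le> y \<and> y \<le> N}"
      have "(\<Sum>y\<in>?W. K (y - x) * (1 - v y / exp u)) = (\<Sum>a\<in>{m..n}. K a * (1 - v (x + a) / exp u))"
        by (rule sum.reindex_bij_witness[where i="\<lambda>a. x + a" and j="\<lambda>y. y - x"]) (use xn in auto)
      also have "\<dots> \<le> (\<Sum>a\<in>O'. K a * (1 - v (x + a) / exp u))"
      proof (rule sum_mono2)
        show "{m..n} \<subseteq> O'"
        proof
          fix a assume a: "a \<in> {m..n}"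
          then have "a \<notin> I" using I_small[of a] by auto
          then show "a \<in> O'" using a m by (simp add: O'_def I_def)
        qed
      qed (use fin v K_nonneg in auto)
      also have "\<dots> = sum K O' - (\<Sum>a\<in>O'. K a * (v (x + a) / exp u))"
        by (simp add: algebra_simps sum_subtractf)
      finally have "2 * u \<le> sum K O' - (\<Sum>a\<in>O'. K a * (v (x + a) / exp u))"
        using good[of x] False xn unfolding i_def by simp
      moreover have "exp u * sum K I \<le> (1 + 2 * u) * sum K I"
        using eu K_nonneg by (intro mult_right_mono sum_nonneg) auto
      moreover have "2 * u * sum K I \<le> 2 * u * 1"
        using u \<kappa>1 \<kappa>_ge tail_nonneg[of m] by (intro mult_left_mono) auto
      ultimately show ?thesis using False \<kappa>1 by (simp add: s_def \<kappa>_def algebra_simps)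
    qed
    have "tail n * 1 \<le> tail n * T (Suc i)" using T1 tail_nonneg by (intro mult_left_mono) auto
    moreover have "(\<Sum>a=1..n. K a * v (x + a) * \<Phi> (x + a))
        = (\<Sum>a\<in>I. K a * v (x + a) * \<Phi> (x + a)) + (\<Sum>a\<in>O'. K a * v (x + a) * \<Phi> (x + a))"
      unfolding IO(1) using IO(2) fin by (simp add: sum.union_disjoint)
    ultimately have "tail n + (\<Sum>a=1..n. K a * v (x + a) * \<Phi> (x + a))
      \<le> (tail n + exp u * s i * sum K I + (\<Sum>a\<in>O'. K a * (v (x + a) / exp u))) * T (Suc i)"
      using inner outer by (simp add: algebra_simps)
    also have "\<dots> \<le> s i * T (Suc i)" using bracket TI by (rule mult_right_mono)
    finally show "tail n + (\<Sum>a=1..n. K a * v (x + a) * \<Phi> (x + a)) \<le> \<Phi> x" by (simp add: \<Phi>_def i_def)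
  qed (use v in auto)
  also have "\<Phi> 0 \<le> T 0"
  proof -
    have "\<Phi> 0 = 1 * (s 0 * T 1)" by (simp add: \<Phi>_def)
    also have "\<dots> \<le> exp u * (s 0 * T 1)" using eu(1) s1(2)[of 0] T1[of 1] by (intro mult_right_mono) auto
    finally show ?thesis using T_step[of 0] by (simp add: mult.assoc)
  qed
  also have "T 0 = exp (u * real (J + 1)) * (\<Prod>k\<in>{..J}. s k)"
  proof -
    have "(\<Prod>k\<in>{..J}. exp u) = exp (u * real (J + 1))"
      using exp_of_nat_mult[of "J + 1" u] by (simp only: prod_constant card_atMost Suc_eq_plus1 mult.commute)
    then show ?thesis unfolding T_def prod.distrib atLeast0AtMost by (simp only:)
  qed
  also have "(\<Prod>k\<in>{..J}. s k) = 2 ^ card {j \<in> {..J}. bad j}"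
  proof -
    have "{..J} \<inter> Collect bad = {j \<in> {..J}. bad j}" by auto
    then show ?thesis unfolding s_def by (simp add: prod.If_cases)
  qed
  finally show ?thesis by (simp add: J_def)
qed

end

text \<open>
  Comparison of a term of the series with the increment of its primitive, by the mean value theorem;
  summing these increments telescopes.
\<close>
lemma powr_minus_decrement_ge:
  fixes i :: nat and \<alpha> :: real
  assumes "2 \<le> i" "0 < \<alpha>"
  shows "\<alpha> * real i powr (- (1 + \<alpha>)) \<le> real (i - 1) powr - \<alpha> - real i powr - \<alpha>"
proof -
  have "\<exists>z. real (i - 1) < z \<and> z < real i \<and> real i powr - \<alpha> - real (i - 1) powr - \<alpha> = (real i - real (i - 1)) * (- \<alpha> * z powr (- \<alpha> - 1))"
    using assms by (intro MVT2) (auto intro!: derivative_eq_intros)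
  then obtain z where z: "real (i - 1) < z" "z < real i"
    "real i powr - \<alpha> - real (i - 1) powr - \<alpha> = (real i - real (i - 1)) * (- \<alpha> * z powr (- \<alpha> - 1))" by blast
  have "real i powr (- \<alpha> - 1) \<le> z powr (- \<alpha> - 1)"
    using z assms by (intro powr_mono2') auto
  then have "\<alpha> * real i powr (- \<alpha> - 1) \<le> \<alpha> * z powr (- \<alpha> - 1)" using assms by (intro mult_left_mono) auto
  moreover have "real i - real (i - 1) = 1" using assms by (simp add: of_nat_diff)
  moreover have "- (1 + \<alpha>) = - \<alpha> - 1" by simp
  ultimately show ?thesis using z(3) by (simp only: mult_1_left)
qed

lemma sum_powr_tail_le:
  fixes \<alpha> :: real
  assumes "1 \<le> A" "0 < \<alpha>"
  shows "(\<Sum>i\<in>{A<..N}. real i powr (- (1 + \<alpha>))) \<le> real A powr - \<alpha> / \<alpha>"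
proof -
  have "A \<le> N \<Longrightarrow> (\<Sum>i\<in>{A<..N}. \<alpha> * real i powr (- (1 + \<alpha>))) \<le> real A powr - \<alpha> - real N powr - \<alpha>"
  proof (induction N rule: dec_induct)
    case (step N)
    have "{A<..Suc N} = insert (Suc N) {A<..N}" using step by auto
    then show ?case using step powr_minus_decrement_ge[of "Suc N" \<alpha>] assms by simp
  qed simp
  then have "(\<Sum>i\<in>{A<..N}. \<alpha> * real i powr (- (1 + \<alpha>))) \<le> real A powr - \<alpha>"
    by (cases "A \<le> N") (auto intro: order_trans)
  then show ?thesis using assms by (simp add: sum_distrib_left[symmetric] field_simps)
qed

lemma powr_increment_ge:
  fixes i :: nat and \<alpha> :: real
  assumes "1 \<le> i" "0 < \<alpha>" "\<alpha> < 1"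
  shows "(1 - \<alpha>) * real i powr - \<alpha> \<le> real i powr (1 - \<alpha>) - real (i - 1) powr (1 - \<alpha>)"
proof (cases "i = 1")
  case True
  then show ?thesis using assms by simp
next
  case False
  have "\<exists>z. real (i - 1) < z \<and> z < real i \<and> real i powr (1 - \<alpha>) - real (i - 1) powr (1 - \<alpha>) = (real i - real (i - 1)) * ((1 - \<alpha>) * z powr (1 - \<alpha> - 1))"
    using assms False by (intro MVT2) (auto intro!: derivative_eq_intros)
  then obtain z where z: "real (i - 1) < z" "z < real i"
    "real i powr (1 - \<alpha>) - real (i - 1) powr (1 - \<alpha>) = (real i - real (i - 1)) * ((1 - \<alpha>) * z powr (1 - \<alpha> - 1))" by blast
  have e: "1 - \<alpha> - 1 = - \<alpha>" by simp
  have "real i powr - \<alpha> \<le> z powr - \<alpha>"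
    using z assms False by (intro powr_mono2') auto
  then have "(1 - \<alpha>) * real i powr - \<alpha> \<le> (1 - \<alpha>) * z powr - \<alpha>" using assms by (intro mult_left_mono) auto
  moreover have "real i - real (i - 1) = 1" using assms by (simp add: of_nat_diff)
  ultimately show ?thesis using z(3) by (simp only: mult_1_left e)
qed

lemma sum_powr_le:
  fixes \<alpha> :: real
  assumes "0 < \<alpha>" "\<alpha> < 1"
  shows "(\<Sum>i=1..A. real i powr - \<alpha>) \<le> real A powr (1 - \<alpha>) / (1 - \<alpha>)"
proof -
  have "(\<Sum>i=1..A. (1 - \<alpha>) * real i powr - \<alpha>) \<le> real A powr (1 - \<alpha>)"
  proof (induction A)
    case (Suc A)
    then show ?case using powr_increment_ge[of "Suc A" \<alpha>] assms by simp
  qed simp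
  then show ?thesis using assms
    by (simp only: sum_distrib_left[symmetric]) (simp add: pos_le_divide_eq mult.commute)
qed

section \<open>The free energy over a binary environment\<close>

definition shift :: "(nat \<Rightarrow> real) \<Rightarrow> nat \<Rightarrow> real" where
  "shift s = (\<lambda>i. s (Suc i))"

lemma shift_pow: "(shift ^^ j) s i = s (i + j)"
  by (induction j arbitrary: i s) (auto simp: shift_def funpow_swap1)

text \<open>
  Every value other than 1 is read as a negative spin, so that the weights are bounded on the whole
  sequence space and not only on sequences with values in {-1,+1}.
\<close>
definition weight :: "real \<Rightarrow> real \<Rightarrow> (nat \<Rightarrow> real) \<Rightarrow> nat \<Rightarrow> real" where
  "weight \<beta> h s n = exp (h + \<beta> * (if s n = 1 then 1 else - 1))"

lemma weight_nonneg: "0 \<le> weight \<beta> h s n" by (simp add: weight_def)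

text \<open>
  The environment is moved to the space of sequences, where the shift acts. The position 0 is only a
  convenient representative, by stationarity.
\<close>
locale spin_pinning = polynomial_kernel K n0 c1 \<gamma> + ergodic_map S shift
  for K n0 c1 \<gamma> and S :: "(nat \<Rightarrow> real) measure" +
  assumes sets_S: "sets S = sets (PiM UNIV (\<lambda>_. borel))"
    and minus_pos: "0 < measure S {s \<in> space S. s 0 \<noteq> 1}"
begin

lemma component_measurable [measurable]: "(\<lambda>s. s n) \<in> borel_measurable S"
proof -
  have "(\<lambda>s. s n) \<in> borel_measurable (PiM UNIV (\<lambda>_::nat. borel :: real measure))" by simp
  then show ?thesis by (subst measurable_cong_sets[OF sets_S refl])
qed

lemma pinning_weight: "pinning K n0 c1 \<gamma> S shift (weight \<beta> h) (\<bar>\<beta>\<bar> + \<bar>h\<bar>)"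
proof (unfold_locales)
  show "weight \<beta> h (shift s) n = weight \<beta> h s (Suc n)" for s n
    by (simp add: weight_def shift_def)
  show "(\<lambda>s. weight \<beta> h s n) \<in> borel_measurable S" for n
    unfolding weight_def by measurable
qed (auto simp: weight_def)

definition lnZ :: "real \<Rightarrow> real \<Rightarrow> nat \<Rightarrow> (nat \<Rightarrow> real) \<Rightarrow> real" where
  "lnZ \<beta> h N s = ln (Z (weight \<beta> h s) 0 N)"

definition F :: "real \<Rightarrow> real \<Rightarrow> real" where
  "F \<beta> h = lim (\<lambda>N. expectation (lnZ \<beta> h N) / real N)"

lemma lnZ_pinning: "pinning.lnZ K (weight \<beta> h) N = lnZ \<beta> h N"
proof -
  interpret W: pinning K n0 c1 \<gamma> S shift "weight \<beta> h" "\<bar>\<beta>\<bar> + \<bar>h\<bar>" by (rule pinning_weight)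
  show ?thesis by (simp add: fun_eq_iff W.lnZ_def lnZ_def)
qed

lemma F_AE: "AE s in S. (\<lambda>N. lnZ \<beta> h N s / real N) \<longlonglongrightarrow> F \<beta> h"
  and F_tendsto: "(\<lambda>N. expectation (lnZ \<beta> h N) / real N) \<longlonglongrightarrow> F \<beta> h"
proof -
  interpret W: pinning K n0 c1 \<gamma> S shift "weight \<beta> h" "\<bar>\<beta>\<bar> + \<bar>h\<bar>" by (rule pinning_weight)
  from W.free_energy_exists obtain f
    where f: "AE s in S. (\<lambda>N. lnZ \<beta> h N s / real N) \<longlonglongrightarrow> f" "(\<lambda>N. expectation (lnZ \<beta> h N) / real N) \<longlonglongrightarrow> f"
    unfolding lnZ_pinning by blast
  have "F \<beta> h = f" unfolding F_def by (rule limI[OF f(2)])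
  then show "AE s in S. (\<lambda>N. lnZ \<beta> h N s / real N) \<longlonglongrightarrow> F \<beta> h"
    "(\<lambda>N. expectation (lnZ \<beta> h N) / real N) \<longlonglongrightarrow> F \<beta> h" using f by auto
qed

lemma lnZ_integrable: "integrable S (lnZ \<beta> h N)"
proof -
  interpret W: pinning K n0 c1 \<gamma> S shift "weight \<beta> h" "\<bar>\<beta>\<bar> + \<bar>h\<bar>" by (rule pinning_weight)
  show ?thesis using bounded_integrable[OF W.lnZ_measurable W.abs_lnZ_le] unfolding lnZ_pinning .
qed

lemma Z_weight_pos: "0 < Z (weight \<beta> h s) x n"
  by (rule Z_pos) (rule weight_nonneg)

lemma F_le:
  assumes "\<And>N. expectation (lnZ \<beta> h N) \<le> a * real N + b"
  shows "F \<beta> h \<le> a"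
proof (rule LIMSEQ_le[OF F_tendsto])
  have "(\<lambda>N. a + b / real N) \<longlonglongrightarrow> a + 0" by (intro tendsto_add tendsto_const lim_const_over_n)
  then show "(\<lambda>N. a + b / real N) \<longlonglongrightarrow> a" by simp
  show "\<exists>M. \<forall>N\<ge>M. expectation (lnZ \<beta> h N) / real N \<le> a + b / real N"
    using assms by (intro exI[of _ 1]) (auto simp: field_simps)
qed

text \<open>
  A lower bound along multiples of a fixed block length determines the limit; logarithmic corrections
  vanish.
\<close>
lemma F_ge:
  assumes "1 \<le> k" and "\<And>J. a * real (J * k) - b * ln (real (J * k + n0)) - d \<le> expectation (lnZ \<beta> h (J * k))"
  shows "a \<le> F \<beta> h"
proof (rule LIMSEQ_le)
  have k: "0 < real k" using assms by simp
  have "(\<lambda>J. expectation (lnZ \<beta> h (k * J)) / real (k * J)) \<longlonglongrightarrow> F \<beta> h"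
    using filterlim_compose[OF F_tendsto mult_nat_left_at_top[of k]] assms by simp
  then show "(\<lambda>J. expectation (lnZ \<beta> h (J * k)) / real (J * k)) \<longlonglongrightarrow> F \<beta> h" by (simp only: mult.commute)
  show "(\<lambda>J. a - (b * ln (real J * real k + real n0) + d) / (real J * real k)) \<longlonglongrightarrow> a"
    using k by real_asymp
  show "\<exists>M. \<forall>J\<ge>M. a - (b * ln (real J * real k + real n0) + d) / (real J * real k) \<le> expectation (lnZ \<beta> h (J * k)) / real (J * k)"
  proof (intro exI[of _ 1] allI impI)
    fix J :: nat assume "1 \<le> J"
    have "(a * real (J * k) - b * ln (real (J * k + n0)) - d) / real (J * k) \<le> expectation (lnZ \<beta> h (J * k)) / real (J * k)"
      using assms(2) by (intro divide_right_mono) auto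
    also have "(a * real (J * k) - b * ln (real (J * k + n0)) - d) / real (J * k) = a - (b * ln (real J * real k + real n0) + d) / (real J * real k)"
      using \<open>1 \<le> J\<close> k by (simp add: diff_divide_distrib add_divide_distrib)
    finally show "a - (b * ln (real J * real k + real n0) + d) / (real J * real k) \<le> expectation (lnZ \<beta> h (J * k)) / real (J * k)" .
  qed
qed

lemma lnZ_ge: "ln c1 - \<gamma> * ln (real (N + n0)) \<le> lnZ \<beta> h N s"
proof -
  have "floor_K (N + n0) \<le> Z (weight \<beta> h s) 0 N"
    using tail_ge[of N] Z_ge_tail[of "weight \<beta> h s" N 0] weight_nonneg by (meson order_trans)
  then have "ln (floor_K (N + n0)) \<le> lnZ \<beta> h N s"
    unfolding lnZ_def using floor_K_pos[of "N + n0"] n0_pos by (intro ln_mono) auto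
  then show ?thesis using n0_pos by (simp add: ln_floor_K)
qed

lemma expectation_ge: "(\<And>s. a \<le> lnZ \<beta> h N s) \<Longrightarrow> a \<le> expectation (lnZ \<beta> h N)"
  using integral_mono[of S "\<lambda>_. a" "lnZ \<beta> h N"] lnZ_integrable by (simp add: prob_space)

lemma F_nonneg: "0 \<le> F \<beta> h"
proof (rule F_ge[of 1 0 \<gamma> "- ln c1"])
  show "0 * real (J * 1) - \<gamma> * ln (real (J * 1 + n0)) - - ln c1 \<le> expectation (lnZ \<beta> h (J * 1))" for J
    using lnZ_ge by (intro expectation_ge) simp
qed simp

text \<open>
  All contact weights are then at most 1.
\<close>
lemma F_nonpos:
  assumes "0 \<le> \<beta>" "h \<le> - \<beta>"
  shows "F \<beta> h \<le> 0"
proof (rule F_le[where b=0])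
  fix N
  have "lnZ \<beta> h N s \<le> 0" for s
  proof -
    have v: "weight \<beta> h s i \<le> exp 0" for i using assms by (auto simp: weight_def)
    have "Z (weight \<beta> h s) 0 N \<le> (\<Prod>z\<in>{0..N}. 1)"
      by (rule Z_le_sites) (use one_step_le[of "weight \<beta> h s" 0] v weight_nonneg in auto)
    then show ?thesis unfolding lnZ_def using Z_weight_pos[of \<beta> h s 0 N] by simp
  qed
  then have "expectation (lnZ \<beta> h N) \<le> expectation (\<lambda>_. 0)"
    by (intro integral_mono lnZ_integrable) auto
  then show "expectation (lnZ \<beta> h N) \<le> 0 * real N + 0" by simp
qed

lemma homogeneous_ge:
  assumes "0 \<le> r" "1 \<le> exp u * (\<Sum>a=1..A. K a * exp (- r * real a))"
  shows "r \<le> F 0 u"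
proof (rule F_ge[of 1 r 0 "r * real A - ln (tail A)"])
  fix J
  have "r * real J - (r * real A - ln (tail A)) \<le> lnZ 0 u J s" for s
  proof -
    have "tail A * exp (- r * real A) * exp (r * real J) \<le> Z (weight 0 u s) 0 J"
      by (rule Z_growth[of _ _ _ "exp u"]) (use assms weight_nonneg in \<open>auto simp: weight_def\<close>)
    then have "ln (tail A * exp (- r * real A) * exp (r * real J)) \<le> lnZ 0 u J s"
      unfolding lnZ_def using tail_pos by (intro ln_mono) auto
    also have "ln (tail A * exp (- r * real A) * exp (r * real J)) = ln (tail A) - r * real A + r * real J"
      using tail_pos[of A] by (simp add: ln_mult)
    finally show ?thesis by simp
  qed
  then show "r * real (J * 1) - 0 * ln (real (J * 1 + n0)) - (r * real A - ln (tail A)) \<le> expectation (lnZ 0 u (J * 1))"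
    by (intro expectation_ge) simp
qed simp

lemma exp_half_bound: "0 \<le> u \<Longrightarrow> u \<le> 1 \<Longrightarrow> 1 \<le> exp u * (1 - u / 2 :: real)"
proof -
  assume u: "0 \<le> u" "u \<le> 1"
  have "1 \<le> (1 + u) * (1 - u / 2)" using u mult_left_le[of u u] by (simp add: algebra_simps)
  also have "\<dots> \<le> exp u * (1 - u / 2)" using u exp_ge_add_one_self[of u] by (intro mult_right_mono) auto
  finally show ?thesis .
qed

text \<open>
  Expanding the Laplace transform to first order, the criterion for growth at rate r only asks that
  the mass beyond A and r times the mean truncated at A be small compared with u.
\<close>
lemma homogeneous_ge_of_truncation:
  assumes "0 \<le> r" "0 \<le> u" "u \<le> 1" "tail A \<le> u / 4" "r * (\<Sum>a=1..A. real a * K a) \<le> u / 4"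
  shows "r \<le> F 0 u"
proof (rule homogeneous_ge[of r u A])
  have "1 - u / 2 \<le> (\<Sum>a=1..A. K a * exp (- r * real a))"
    using laplace_ge[of r A] assms by linarith
  then have "exp u * (1 - u / 2) \<le> exp u * (\<Sum>a=1..A. K a * exp (- r * real a))"
    by (intro mult_left_mono) auto
  then show "1 \<le> exp u * (\<Sum>a=1..A. K a * exp (- r * real a))"
    using exp_half_bound[of u] assms by linarith
qed (use assms in auto)

lemma homogeneous_linear:
  assumes "summable (\<lambda>a. real a * K a)"
  obtains c where "0 < c" "\<And>u. 0 < u \<Longrightarrow> u \<le> 1 \<Longrightarrow> c * u \<le> F 0 u"
proof -
  define C where "C = (\<Sum>a. real a * K a) + 1"
  have C: "(\<Sum>a=1..A. real a * K a) \<le> C" for A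
    unfolding C_def using sum_le_suminf[OF assms, of "{1..A}"] K_nonneg by simp
  have Cpos: "0 < C" unfolding C_def using suminf_nonneg[OF assms] K_nonneg by (simp add: add_nonneg_pos)
  show ?thesis
  proof (rule that[of "1 / (4 * C)"])
    show "0 < 1 / (4 * C)" using Cpos by simp
    fix u :: real assume u: "0 < u" "u \<le> 1"
    have "\<forall>\<^sub>F A in sequentially. tail A < u / 4"
      using u by (intro order_tendstoD(2)[OF tail_tendsto_0]) auto
    from eventually_happens'[OF sequentially_bot this] obtain A where A: "tail A < u / 4" by blast
    show "1 / (4 * C) * u \<le> F 0 u"
    proof (rule homogeneous_ge_of_truncation[of _ _ A])
      have "1 / (4 * C) * u * (\<Sum>a=1..A. real a * K a) \<le> 1 / (4 * C) * u * C"
        using u Cpos C by (intro mult_left_mono) auto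
      also have "\<dots> = u / 4" using Cpos by simp
      finally show "1 / (4 * C) * u * (\<Sum>a=1..A. real a * K a) \<le> u / 4" .
    qed (use u A Cpos in auto)
  qed
qed

text \<open>
  Truncation at A = R m with R a large constant: the tail is then a small multiple of m^(-\<alpha>),
  hence of u, and the truncated mean is of order m^(1-\<alpha>), which allows the rate
  m^(-\<alpha>)/m^(1-\<alpha>) = 1/m up to a constant.
\<close>
lemma homogeneous_power:
  assumes "0 < \<alpha>" "\<alpha> < 1" "0 < \<delta>" and up: "\<And>n. 1 \<le> n \<Longrightarrow> K n \<le> C1 * real n powr - (1 + \<alpha>)"
  obtains c where "0 < c"
    "\<And>m u. 1 \<le> m \<Longrightarrow> \<delta> * real m powr - \<alpha> \<le> u \<Longrightarrow> u \<le> 1 \<Longrightarrow> c / real m \<le> F 0 u"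
proof -
  have C1: "0 < C1"
  proof -
    have "0 < K n0" using K_lower[of n0] c1_pos n0_pos by (smt (verit) mult_pos_pos of_nat_0_less_iff powr_gt_zero less_le_trans order_refl zero_less_one)
    also have "\<dots> \<le> C1 * real n0 powr - (1 + \<alpha>)" using up n0_pos by simp
    finally show ?thesis by (simp add: zero_less_mult_iff)
  qed
  have tail_up: "tail A \<le> C1 / \<alpha> * real A powr - \<alpha>" if "1 \<le> A" for A
  proof (rule tail_le)
    fix N
    have "sum K {A<..N} \<le> (\<Sum>i\<in>{A<..N}. C1 * real i powr - (1 + \<alpha>))"
      using up by (intro sum_mono) auto
    also have "\<dots> = C1 * (\<Sum>i\<in>{A<..N}. real i powr - (1 + \<alpha>))" by (simp add: sum_distrib_left)
    also have "\<dots> \<le> C1 * (real A powr - \<alpha> / \<alpha>)"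
      using sum_powr_tail_le[OF that assms(1), of N] C1 by (intro mult_left_mono) auto
    finally show "sum K {A<..N} \<le> C1 / \<alpha> * real A powr - \<alpha>" by simp
  qed
  have mean_up: "(\<Sum>a=1..A. real a * K a) \<le> C1 / (1 - \<alpha>) * real A powr (1 - \<alpha>)" for A
  proof -
    have "(\<Sum>a=1..A. real a * K a) \<le> (\<Sum>a=1..A. C1 * real a powr - \<alpha>)"
    proof (intro sum_mono)
      fix a assume a: "a \<in> {1..A}"
      have "real a * K a \<le> real a * (C1 * real a powr - (1 + \<alpha>))"
        using up a by (intro mult_left_mono) auto
      also have "\<dots> = C1 * (real a powr 1 * real a powr - (1 + \<alpha>))" using a by simp
      also have "\<dots> = C1 * real a powr - \<alpha>" by (simp only: powr_add[symmetric]) simp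
      finally show "real a * K a \<le> C1 * real a powr - \<alpha>" .
    qed
    also have "\<dots> = C1 * (\<Sum>a=1..A. real a powr - \<alpha>)" by (simp add: sum_distrib_left)
    also have "\<dots> \<le> C1 * (real A powr (1 - \<alpha>) / (1 - \<alpha>))"
      using sum_powr_le[OF assms(1,2)] C1 by (intro mult_left_mono) auto
    finally show ?thesis by simp
  qed
  have "(\<lambda>R. C1 / \<alpha> * real R powr - \<alpha>) \<longlonglongrightarrow> 0"
    using assms(1) by real_asymp
  then have "\<forall>\<^sub>F R in sequentially. C1 / \<alpha> * real R powr - \<alpha> < \<delta> / 4"
    using assms(3) by (intro order_tendstoD(2)) auto
  then have "\<forall>\<^sub>F R in sequentially. 1 \<le> R \<and> C1 / \<alpha> * real R powr - \<alpha> < \<delta> / 4"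
    using eventually_ge_at_top[of 1] by eventually_elim simp
  from eventually_happens'[OF sequentially_bot this]
  obtain R where R: "1 \<le> R" "C1 / \<alpha> * real R powr - \<alpha> < \<delta> / 4" by blast
  define D where "D = C1 / (1 - \<alpha>) * real R powr (1 - \<alpha>)"
  have D: "0 < D" unfolding D_def using C1 assms R by simp
  show ?thesis
  proof (rule that[of "\<delta> / (4 * D)"])
    show "0 < \<delta> / (4 * D)" using D assms by simp
    fix m :: nat and u :: real assume m: "1 \<le> m" and u: "\<delta> * real m powr - \<alpha> \<le> u" "u \<le> 1"
    have u0: "0 \<le> u" using u(1) assms(3) by (smt (verit) mult_nonneg_nonneg powr_ge_zero)
    show "\<delta> / (4 * D) / real m \<le> F 0 u"
    proof (rule homogeneous_ge_of_truncation[of _ _ "R * m"])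
      have "tail (R * m) \<le> C1 / \<alpha> * real (R * m) powr - \<alpha>" using R m by (intro tail_up) simp
      also have "\<dots> = (C1 / \<alpha> * real R powr - \<alpha>) * real m powr - \<alpha>" by (simp add: powr_mult)
      also have "\<dots> \<le> \<delta> / 4 * real m powr - \<alpha>" using R by (intro mult_right_mono) auto
      finally show "tail (R * m) \<le> u / 4" using u by simp
      have "(\<Sum>a=1..R * m. real a * K a) \<le> D * real m powr (1 - \<alpha>)"
        using mean_up[of "R * m"] by (simp add: D_def powr_mult)
      then have "\<delta> / (4 * D) / real m * (\<Sum>a=1..R * m. real a * K a) \<le> \<delta> / (4 * D) / real m * (D * real m powr (1 - \<alpha>))"
        using D assms m by (intro mult_left_mono) auto
      also have "\<dots> = \<delta> / 4 * (real m powr (1 - \<alpha>) / real m powr 1)" using D m by simp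
      also have "\<dots> = \<delta> / 4 * real m powr - \<alpha>" by (simp only: powr_diff[symmetric]) simp
      finally show "\<delta> / (4 * D) / real m * (\<Sum>a=1..R * m. real a * K a) \<le> u / 4" using u by simp
    qed (use D assms u0 u in auto)
  qed
qed

end

section \<open>Upper bounds from the negative spins\<close>

text \<open>
  Two counts that are each accurate up to a tenth of the mean determine the count in the difference up
  to one half, as long as the window starts at most at 2m.
\<close>
lemma window_count_arith:
  fixes p x m c1 c2 :: real
  assumes "\<bar>c2 - p * (x + 2 * m)\<bar> \<le> p / 10 * (x + 2 * m)" "\<bar>c1 - p * (x + m)\<bar> \<le> p / 10 * (x + m)" "p * x \<le> p * m"
  shows "p / 2 * m \<le> c2 - c1"
  using assms unfolding abs_le_iff by (simp add: algebra_simps)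

context spin_pinning
begin

definition minus_density :: real where
  "minus_density = measure S {s \<in> space S. s 0 \<noteq> 1}"

definition minus_count :: "nat \<Rightarrow> nat \<Rightarrow> (nat \<Rightarrow> real) \<Rightarrow> real" where
  "minus_count a b s = (\<Sum>i\<in>{a..<b}. of_bool (s i \<noteq> 1))"

lemma minus_count_measurable [measurable]: "minus_count a b \<in> borel_measurable S"
  unfolding minus_count_def by measurable

lemma minus_density_pos: "0 < minus_density" and minus_density_le_1: "minus_density \<le> 1"
  using minus_pos by (auto simp: minus_density_def)

lemma minus_count_AE: "AE s in S. (\<lambda>n. minus_count 0 n s / real n) \<longlonglongrightarrow> minus_density"
proof -
  let ?f = "\<lambda>s :: nat \<Rightarrow> real. of_bool (s 0 \<noteq> 1) :: real"
  have "AE s in S. (\<lambda>n. birkhoff_sum ?f n s / real n) \<longlonglongrightarrow> expectation ?f"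
    by (rule birkhoff[where C=1]) auto
  moreover have "expectation ?f = minus_density"
    unfolding minus_density_def by (rule expectation_of_bool(2)) measurable
  moreover have "birkhoff_sum ?f n s = minus_count 0 n s" for n s
    unfolding birkhoff_sum_def minus_count_def by (simp add: shift_pow lessThan_atLeast0)
  ultimately show ?thesis by simp
qed

definition plus_run :: "nat \<Rightarrow> (nat \<Rightarrow> real) \<Rightarrow> bool" where
  "plus_run L s \<longleftrightarrow> (\<forall>y\<in>{n0..L}. s y = 1)"

abbreviation "plus_run_prob L \<equiv> prob {s \<in> space S. plus_run L s}"

lemma plus_run_measurable: "{s \<in> space S. plus_run L s} \<in> sets S"
  unfolding plus_run_def by measurable

text \<open>
  A negative spin beyond \<open>n0\<close> occurs almost surely, since negative spins have a positive
  density.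
\<close>
lemma prob_plus_run_tendsto_0: "plus_run_prob \<longlonglongrightarrow> 0"
proof (rule prob_tendsto_0[OF plus_run_measurable])
  show "AE s in S. \<forall>\<^sub>F L in sequentially. \<not> plus_run L s"
    using minus_count_AE
  proof eventually_elim
    case (elim s)
    have "\<exists>y\<ge>n0. s y \<noteq> 1"
    proof (rule ccontr)
      assume no: "\<not> (\<exists>y\<ge>n0. s y \<noteq> 1)"
      have early: "i < n0" if "s i \<noteq> 1" for i using no that by (meson not_less)
      have bound: "minus_count 0 n s \<le> real n0" for n
      proof -
        have "minus_count 0 n s \<le> (\<Sum>i\<in>{0..<n}. of_bool (i < n0))"
          unfolding minus_count_def using early by (intro sum_mono) auto
        also have "\<dots> = real (card ({0..<n} \<inter> {i. i < n0}))" by (subst sum_of_bool_eq) auto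
        also have "\<dots> \<le> real (card {0..<n0})" by (intro of_nat_mono card_mono) auto
        finally show ?thesis by simp
      qed
      have "(\<lambda>n. minus_count 0 n s / real n) \<longlonglongrightarrow> 0"
      proof (rule Lim_null_comparison[where g="\<lambda>n. real n0 / real n"])
        show "\<forall>\<^sub>F n in sequentially. norm (minus_count 0 n s / real n) \<le> real n0 / real n"
          using bound by (auto intro!: always_eventually divide_right_mono simp: minus_count_def sum_nonneg)
      qed (rule lim_const_over_n)
      then have "minus_density = 0" using elim LIMSEQ_unique by blast
      then show False using minus_density_pos by simp
    qed
    then obtain y where "n0 \<le> y" "s y \<noteq> 1" by blast
    then show ?case
      unfolding plus_run_def eventually_sequentially by (intro exI[of _ y]) auto
  qed
qed

text \<open>
  Some window of length m, starting between m and 2m, contains less than half of the expected number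
  of negative spins. These are the windows reached by jumps of length in [m,2m) from the sites of the
  block [0,m).
\<close>
definition sparse :: "nat \<Rightarrow> (nat \<Rightarrow> real) \<Rightarrow> bool" where
  "sparse m s \<longleftrightarrow> (\<exists>x<m. minus_count (x + m) (x + 2 * m) s < minus_density / 2 * real m)"

abbreviation "sparse_prob m \<equiv> prob {s \<in> space S. sparse m s}"

lemma sparse_measurable: "{s \<in> space S. sparse m s} \<in> sets S"
  unfolding sparse_def by measurable

text \<open>
  All windows involved start within a fixed multiple of m, so one application of the ergodic theorem
  to the counts from the origin controls them simultaneously.
\<close>
lemma prob_sparse_tendsto_0: "sparse_prob \<longlonglongrightarrow> 0"
proof (rule prob_tendsto_0[OF sparse_measurable])
  show "AE s in S. \<forall>\<^sub>F m in sequentially. \<not> sparse m s"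
    using minus_count_AE
  proof eventually_elim
    case (elim s)
    let ?p = minus_density and ?C = "\<lambda>n. minus_count 0 n s"
    have "\<forall>\<^sub>F n in sequentially. dist (?C n / real n) ?p < ?p / 10"
      using elim minus_density_pos by (intro tendstoD) auto
    then obtain M where M: "\<And>n. M \<le> n \<Longrightarrow> dist (?C n / real n) ?p < ?p / 10"
      unfolding eventually_sequentially by blast
    have C: "\<bar>?C n - ?p * real n\<bar> \<le> ?p / 10 * real n" if "M \<le> n" "1 \<le> n" for n
    proof -
      have "\<bar>?C n / real n - ?p\<bar> * real n \<le> ?p / 10 * real n"
        using M[OF that(1)] by (intro mult_right_mono) (auto simp: dist_real_def)
      moreover have "\<bar>?C n / real n - ?p\<bar> * real n = \<bar>(?C n / real n - ?p) * real n\<bar>"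
        by (simp add: abs_mult)
      ultimately show ?thesis using that(2) by (simp add: left_diff_distrib)
    qed
    have "\<not> sparse m s" if m: "M + 1 \<le> m" for m
    proof -
      have "?p / 2 * real m \<le> minus_count (x + m) (x + 2 * m) s" if "x < m" for x
      proof -
        have "?C (x + 2 * m) = ?C (x + m) + minus_count (x + m) (x + 2 * m) s"
          unfolding minus_count_def by (rule sum.atLeastLessThan_concat[symmetric]) auto
        moreover have "\<bar>?C (x + 2 * m) - ?p * real (x + 2 * m)\<bar> \<le> ?p / 10 * real (x + 2 * m)"
          by (rule C) (use m in auto)
        moreover have "\<bar>?C (x + m) - ?p * real (x + m)\<bar> \<le> ?p / 10 * real (x + m)"
          by (rule C) (use m in auto)
        moreover have "?p * real x \<le> ?p * real m" using that minus_density_pos by simp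
        ultimately show ?thesis
          using window_count_arith[of "?C (x + 2 * m)" ?p "real x" "real m" "?C (x + m)"]
          by (simp only: of_nat_add of_nat_mult of_nat_numeral add_diff_cancel_left')
      qed
      then show ?thesis unfolding sparse_def by (meson leD)
    qed
    then show ?case unfolding eventually_sequentially by (intro exI[of _ "M + 1"] allI impI)
  qed
qed

lemma weight_shifted:
  assumes "0 \<le> \<beta>"
  shows "weight \<beta> (- \<beta> + u) s i \<le> exp u"
    and "s i \<noteq> 1 \<Longrightarrow> weight \<beta> (- \<beta> + u) s i = exp u * exp (- 2 * \<beta>)"
    and "s i = 1 \<Longrightarrow> weight \<beta> (- \<beta> + u) s i = exp u"
  using assms by (auto simp: weight_def exp_add[symmetric])

text \<open>
  A site is treated as bad when its window of length L is entirely positive, or reaches beyond the end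
  of the system; the second possibility concerns at most L sites.
\<close>
lemma lnZ_le_site:
  assumes "0 < \<beta>" "0 \<le> u" "n0 \<le> L" "exp u * (1 - (1 - exp (- 2 * \<beta>)) * floor_K L) \<le> 1"
  shows "lnZ \<beta> (- \<beta> + u) N s \<le> (\<Sum>z\<in>{0..N}. u * of_bool (plus_run L ((shift ^^ z) s))) + u * real L"
proof -
  let ?v = "weight \<beta> (- \<beta> + u) s"
  define bad where "bad z \<longleftrightarrow> plus_run L ((shift ^^ z) s) \<or> N < z + L" for z
  have v: "0 \<le> ?v i" "?v i \<le> exp u" for i using weight_shifted(1)[of \<beta> u s i] assms weight_nonneg by auto
  have "Z ?v 0 N \<le> (\<Prod>z\<in>{0..N}. if bad z then exp u else 1)"
  proof (rule Z_le_sites)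
    fix x n assume xn: "x + n = N"
    show "tail n + (\<Sum>a=1..n. K a * ?v (x + a)) \<le> (if bad x then exp u else 1)"
    proof (cases "bad x")
      case True
      then show ?thesis using one_step_le[of ?v u n x] v assms by simp
    next
      case False
      then obtain y where y: "n0 \<le> y" "y \<le> L" "s (y + x) \<noteq> 1" "x + L \<le> N"
        unfolding bad_def plus_run_def shift_pow by auto
      have "tail n + (\<Sum>a=1..n. K a * ?v (x + a)) \<le> exp u * (1 - (1 - exp (- 2 * \<beta>)) * K y)"
      proof (rule one_step_le_good)
        show "?v (x + y) \<le> exp u * exp (- 2 * \<beta>)"
          using weight_shifted(2)[of \<beta> s "x + y" u] y assms by (simp add: add.commute)
      qed (use v assms y n0_pos xn in auto)
      also have "\<dots> \<le> exp u * (1 - (1 - exp (- 2 * \<beta>)) * floor_K L)"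
        using K_ge[OF y(1,2)] assms(1) by (intro mult_left_mono diff_left_mono) auto
      finally show ?thesis using False assms(4) by simp
    qed
  qed (use v assms in auto)
  also have "\<dots> = exp (\<Sum>z\<in>{0..N}. u * of_bool (bad z))"
    by (subst exp_sum) (auto intro!: prod.cong)
  finally have "ln (Z ?v 0 N) \<le> ln (exp (\<Sum>z\<in>{0..N}. u * of_bool (bad z)))"
    using Z_weight_pos by (intro ln_mono) auto
  then have "lnZ \<beta> (- \<beta> + u) N s \<le> (\<Sum>z\<in>{0..N}. u * of_bool (bad z))" by (simp add: lnZ_def)
  also have "\<dots> \<le> (\<Sum>z\<in>{0..N}. u * of_bool (plus_run L ((shift ^^ z) s)) + u * of_bool (N < z + L))"
    using assms by (intro sum_mono) (auto simp: bad_def)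
  also have "\<dots> = (\<Sum>z\<in>{0..N}. u * of_bool (plus_run L ((shift ^^ z) s))) + u * real (card ({0..N} \<inter> {z. N < z + L}))"
    by (simp add: sum.distrib sum_distrib_left[symmetric])
  also have "u * real (card ({0..N} \<inter> {z. N < z + L})) \<le> u * real L"
  proof -
    have "card ({0..N} \<inter> {z. N < z + L}) \<le> card {N + 1 - L..<N + 1}" by (intro card_mono) auto
    also have "\<dots> \<le> L" by simp
    finally show ?thesis using assms by (intro mult_left_mono) auto
  qed
  finally show ?thesis by simp
qed

lemma F_le_site:
  assumes "0 < \<beta>" "0 \<le> u" "n0 \<le> L" "exp u * (1 - (1 - exp (- 2 * \<beta>)) * floor_K L) \<le> 1"
  shows "F \<beta> (- \<beta> + u) \<le> u * plus_run_prob L"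
proof (rule F_le)
  fix N
  let ?p = "plus_run_prob L"
  have meas: "{s \<in> space S. plus_run L ((shift ^^ z) s)} \<in> sets S" for z
    unfolding plus_run_def shift_pow by measurable
  have int: "integrable S (\<lambda>s. u * of_bool (plus_run L ((shift ^^ z) s)))" for z
    by (intro integrable_mult_right expectation_of_bool(1) meas)
  have "expectation (lnZ \<beta> (- \<beta> + u) N)
      \<le> expectation (\<lambda>s. (\<Sum>z\<in>{0..N}. u * of_bool (plus_run L ((shift ^^ z) s))) + u * real L)"
    by (intro integral_mono lnZ_integrable Bochner_Integration.integrable_add Bochner_Integration.integrable_sum int lnZ_le_site assms) auto
  also have "\<dots> = (\<Sum>z\<in>{0..N}. u * ?p) + u * real L"
  proof -
    have e: "expectation (\<lambda>s. u * of_bool (plus_run L ((shift ^^ z) s))) = u * ?p" for z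
      by (simp only: integral_mult_right_zero expectation_of_bool(2)[OF meas] prob_T_pow[OF plus_run_measurable])
    have c: "expectation (\<lambda>_. u * real L) = u * real L" by (simp add: prob_space)
    show ?thesis
      by (subst Bochner_Integration.integral_add[OF Bochner_Integration.integrable_sum[OF int]], simp)
        (simp only: Bochner_Integration.integral_sum[OF int] e c)
  qed
  also have "\<dots> = u * ?p * real N + (u * ?p + u * real L)" by (simp add: algebra_simps)
  finally show "expectation (lnZ \<beta> (- \<beta> + u) N) \<le> u * ?p * real N + (u * ?p + u * real L)" .
qed

text \<open>
  Besides the sparse blocks, the last three blocks count as bad, since the windows ahead of them may
  reach beyond the end of the system.
\<close>
lemma lnZ_le_block:
  assumes "0 < \<beta>" "0 \<le> u" "u \<le> 1" "n0 \<le> m" "4 * u \<le> tail m"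
    and dens: "2 * u \<le> floor_K (2 * m) * (1 - exp (- 2 * \<beta>)) * (minus_density / 2 * real m)"
  shows "lnZ \<beta> (- \<beta> + u) N s \<le> u * real (N div m + 1)
      + ln 2 * ((\<Sum>j\<in>{..N div m}. of_bool (sparse m ((shift ^^ (j * m)) s))) + 3)"
proof -
  let ?v = "weight \<beta> (- \<beta> + u) s" and ?b = "exp (- 2 * \<beta>)"
  have m: "1 \<le> m" using assms n0_pos by simp
  define bad where "bad j \<longleftrightarrow> sparse m ((shift ^^ (j * m)) s) \<or> N < (j + 3) * m" for j
  have v: "0 \<le> ?v i" "?v i \<le> exp u" for i using weight_shifted(1)[of \<beta> u s i] assms weight_nonneg by auto
  have b: "0 \<le> 1 - ?b" using assms by simp
  have "Z ?v 0 N \<le> exp (u * real (N div m + 1)) * 2 ^ card {j \<in> {..N div m}. bad j}"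
  proof (rule Z_le_blocks)
    fix x assume x: "x \<le> N" "\<not> bad (x div m)"
    define j where "j = x div m"
    have xm: "x mod m < m" using m by simp
    have xj: "x = x mod m + j * m" unfolding j_def by simp
    have N: "(j + 3) * m \<le> N" and good: "\<not> sparse m ((shift ^^ (j * m)) s)"
      using x(2) unfolding bad_def j_def by auto
    have xN: "x + 2 * m \<le> N" using xj xm N by (simp add: algebra_simps)
    have "minus_density / 2 * real m \<le> minus_count (x mod m + m) (x mod m + 2 * m) ((shift ^^ (j * m)) s)"
      using good xm unfolding sparse_def by (meson not_less)
    also have "\<dots> = (\<Sum>y\<in>{x + m..<x + 2 * m}. of_bool (s y \<noteq> 1))"
      unfolding minus_count_def shift_pow
      by (rule sum.reindex_bij_witness[where i="\<lambda>y. y - j * m" and j="\<lambda>i. i + j * m"]) (use xj in auto)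
    finally have count: "minus_density / 2 * real m \<le> (\<Sum>y\<in>{x + m..<x + 2 * m}. of_bool (s y \<noteq> 1))" .
    have fpos: "0 \<le> floor_K (2 * m)" using floor_K_pos[of "2 * m"] m by simp
    have "2 * u \<le> floor_K (2 * m) * (1 - ?b) * (\<Sum>y\<in>{x + m..<x + 2 * m}. of_bool (s y \<noteq> 1))"
      using dens mult_left_mono[OF count, of "floor_K (2 * m) * (1 - ?b)"] fpos b by simp
    also have "\<dots> = (\<Sum>y\<in>{x + m..<x + 2 * m}. floor_K (2 * m) * ((1 - ?b) * of_bool (s y \<noteq> 1)))"
      by (simp only: sum_distrib_left mult.assoc)
    also have "\<dots> \<le> (\<Sum>y\<in>{x + m..<x + 2 * m}. K (y - x) * (1 - ?v y / exp u))"
    proof (intro sum_mono mult_mono)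
      fix y assume y: "y \<in> {x + m..<x + 2 * m}"
      show "floor_K (2 * m) \<le> K (y - x)" using y assms by (intro K_ge) auto
      show "(1 - ?b) * of_bool (s y \<noteq> 1) \<le> 1 - ?v y / exp u"
        using weight_shifted(2,3)[of \<beta> s y u] assms by (cases "s y = 1") auto
    qed (use b K_nonneg in auto)
    also have "\<dots> \<le> (\<Sum>y\<in>{y. x + m \<le> y \<and> y \<le> N}. K (y - x) * (1 - ?v y / exp u))"
    proof (rule sum_mono2)
      have "{y. x + m \<le> y \<and> y \<le> N} = {x + m..N}" by auto
      then show "finite {y. x + m \<le> y \<and> y \<le> N}" by simp
    qed (use xN K_nonneg v in auto)
    finally show "2 * u \<le> (\<Sum>y\<in>{y. x + m \<le> y \<and> y \<le> N}. K (y - x) * (1 - ?v y / exp u))" .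
  qed (use v assms m in auto)
  then have "lnZ \<beta> (- \<beta> + u) N s \<le> ln (exp (u * real (N div m + 1)) * 2 ^ card {j \<in> {..N div m}. bad j})"
    unfolding lnZ_def using Z_weight_pos by (intro ln_mono) auto
  also have "\<dots> = u * real (N div m + 1) + ln 2 * real (card {j \<in> {..N div m}. bad j})"
    by (simp add: ln_mult ln_realpow)
  also have "real (card {j \<in> {..N div m}. bad j}) \<le> (\<Sum>j\<in>{..N div m}. of_bool (sparse m ((shift ^^ (j * m)) s))) + 3"
  proof -
    have "{j \<in> {..N div m}. bad j} \<subseteq> ({..N div m} \<inter> {j. sparse m ((shift ^^ (j * m)) s)}) \<union> {N div m + 1 - 3..<N div m + 1}"
    proof
      fix j assume j: "j \<in> {j \<in> {..N div m}. bad j}"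
      have "N div m < j + 3" if "N < (j + 3) * m" using that m by (simp add: div_less_iff_less_mult)
      then show "j \<in> ({..N div m} \<inter> {j. sparse m ((shift ^^ (j * m)) s)}) \<union> {N div m + 1 - 3..<N div m + 1}"
        using j unfolding bad_def by auto
    qed
    then have "card {j \<in> {..N div m}. bad j} \<le> card (({..N div m} \<inter> {j. sparse m ((shift ^^ (j * m)) s)}) \<union> {N div m + 1 - 3..<N div m + 1})"
      by (intro card_mono) auto
    also have "\<dots> \<le> card ({..N div m} \<inter> {j. sparse m ((shift ^^ (j * m)) s)}) + card {N div m + 1 - 3..<N div m + 1}"
      by (rule card_Un_le)
    also have "\<dots> \<le> card ({..N div m} \<inter> {j. sparse m ((shift ^^ (j * m)) s)}) + 3" by simp
    finally have "real (card {j \<in> {..N div m}. bad j}) \<le> real (card ({..N div m} \<inter> {j. sparse m ((shift ^^ (j * m)) s)})) + 3" by linarith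
    then show ?thesis by simp
  qed
  finally show ?thesis by simp
qed

lemma F_le_block:
  assumes "0 < \<beta>" "0 \<le> u" "u \<le> 1" "n0 \<le> m" "4 * u \<le> tail m"
    and dens: "2 * u \<le> floor_K (2 * m) * (1 - exp (- 2 * \<beta>)) * (minus_density / 2 * real m)"
  shows "F \<beta> (- \<beta> + u) \<le> (u + ln 2 * sparse_prob m) / real m"
proof (rule F_le)
  fix N
  let ?p = "sparse_prob m" and ?J = "N div m"
  have m: "0 < real m" using assms n0_pos by simp
  have meas: "{s \<in> space S. sparse m ((shift ^^ z) s)} \<in> sets S" for z
    unfolding sparse_def minus_count_def shift_pow by measurable
  have int: "integrable S (\<lambda>s. of_bool (sparse m ((shift ^^ z) s)) :: real)" for z
    by (intro expectation_of_bool(1) meas)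
  have int': "integrable S (\<lambda>s. \<Sum>j\<in>{..?J}. of_bool (sparse m ((shift ^^ (j * m)) s)) :: real)"
    by (intro Bochner_Integration.integrable_sum int)
  have "expectation (lnZ \<beta> (- \<beta> + u) N)
      \<le> expectation (\<lambda>s. u * real (?J + 1) + ln 2 * ((\<Sum>j\<in>{..?J}. of_bool (sparse m ((shift ^^ (j * m)) s))) + 3))"
    by (intro integral_mono lnZ_integrable Bochner_Integration.integrable_add integrable_mult_right int' lnZ_le_block assms) auto
  also have "\<dots> = u * real (?J + 1) + ln 2 * (expectation (\<lambda>s. \<Sum>j\<in>{..?J}. of_bool (sparse m ((shift ^^ (j * m)) s))) + 3)"
    using int' by (simp add: prob_space)
  also have "expectation (\<lambda>s. \<Sum>j\<in>{..?J}. of_bool (sparse m ((shift ^^ (j * m)) s)) :: real) = real (?J + 1) * ?p"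
  proof -
    have e: "expectation (\<lambda>s. of_bool (sparse m ((shift ^^ z) s))) = ?p" for z
      by (simp only: expectation_of_bool(2)[OF meas] prob_T_pow[OF sparse_measurable])
    show ?thesis by (simp only: Bochner_Integration.integral_sum[OF int] e sum_constant card_atMost Suc_eq_plus1)
  qed
  also have "u * real (?J + 1) + ln 2 * (real (?J + 1) * ?p + 3) = (u + ln 2 * ?p) * real ?J + (u + ln 2 * ?p + 3 * ln 2)"
    by (simp add: algebra_simps)
  also have "(u + ln 2 * ?p) * real ?J \<le> (u + ln 2 * ?p) * (real N / real m)"
  proof (intro mult_left_mono)
    have "real (N div m * m) \<le> real N" by (intro of_nat_mono) simp
    then show "real (N div m) \<le> real N / real m" using m by (simp add: pos_le_divide_eq)
  qed (use assms in auto)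
  finally show "expectation (lnZ \<beta> (- \<beta> + u) N) \<le> (u + ln 2 * ?p) / real m * real N + (u + ln 2 * ?p + 3 * ln 2)"
    by simp
qed

end

section \<open>Comparison with the homogeneous model, and long positive runs\<close>

context spin_pinning
begin

text \<open>
  The length L is chosen first, so that the density of bad sites is small compared with \<epsilon>;
  the one-step bound at good sites then holds for all u below a threshold depending on L.
\<close>
lemma small_o_of_finite_mean:
  assumes "0 < \<beta>" "summable (\<lambda>a. real a * K a)" "0 < \<epsilon>"
  shows "\<forall>\<^sub>F u in at_right 0. F \<beta> (- \<beta> + u) \<le> \<epsilon> * F 0 u"
proof -
  obtain c where c: "0 < c" "\<And>u. 0 < u \<Longrightarrow> u \<le> 1 \<Longrightarrow> c * u \<le> F 0 u"
    using homogeneous_linear[OF assms(2)] by blast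
  have "\<forall>\<^sub>F L in sequentially. plus_run_prob L < \<epsilon> * c"
    using assms c by (intro order_tendstoD(2)[OF prob_plus_run_tendsto_0]) auto
  then have "\<forall>\<^sub>F L in sequentially. n0 \<le> L \<and> plus_run_prob L < \<epsilon> * c"
    using eventually_ge_at_top[of n0] by eventually_elim simp
  from eventually_happens'[OF sequentially_bot this]
  obtain L where L: "n0 \<le> L" "plus_run_prob L < \<epsilon> * c" by blast
  define \<theta> where "\<theta> = (1 - exp (- 2 * \<beta>)) * floor_K L"
  have \<theta>: "0 < \<theta>" unfolding \<theta>_def using assms L n0_pos by (intro mult_pos_pos floor_K_pos) auto
  have "((\<lambda>u. exp u * (1 - \<theta>)) \<longlongrightarrow> exp 0 * (1 - \<theta>)) (at_right 0)"
    by (intro tendsto_intros)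
  then have "\<forall>\<^sub>F u in at_right 0. exp u * (1 - \<theta>) < 1"
    by (rule order_tendstoD(2)) (use \<theta> in simp)
  moreover have "\<forall>\<^sub>F u in at_right 0. u < (1 :: real)"
    by (rule order_tendstoD(2)[OF tendsto_ident_at]) simp
  moreover have "\<forall>\<^sub>F u in at_right 0. (0 :: real) < u" by (rule eventually_at_right_less)
  ultimately show ?thesis
  proof eventually_elim
    case (elim u)
    have "F \<beta> (- \<beta> + u) \<le> u * plus_run_prob L"
      by (rule F_le_site) (use assms elim L in \<open>auto simp: \<theta>_def\<close>)
    also have "\<dots> \<le> u * (\<epsilon> * c)" using L elim by (intro mult_left_mono) auto
    also have "\<dots> = \<epsilon> * (c * u)" by simp
    also have "\<dots> \<le> \<epsilon> * F 0 u" using c(2)[of u] elim assms by (intro mult_left_mono) auto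
    finally show ?case .
  qed
qed

text \<open>
  The constant \<delta> fixes the block length m through u \<approx> \<delta> m^(-\<alpha>). It is
  chosen so that both u-dependent hypotheses of the block bound hold, namely the exit probability and
  the probability of a jump onto a negative spin at distance of order m, which are of order
  m^(-\<alpha>).
\<close>
lemma small_o_of_infinite_mean:
  assumes "0 < \<beta>" "0 < \<alpha>" "\<alpha> < 1" "\<gamma> = 1 + \<alpha>" "0 < \<epsilon>"
    and up: "\<And>n. 1 \<le> n \<Longrightarrow> K n \<le> C1 * real n powr - (1 + \<alpha>)"
  shows "\<forall>\<^sub>F u in at_right 0. F \<beta> (- \<beta> + u) \<le> \<epsilon> * F 0 u"
proof -
  \<comment> \<open>Here b is the relative loss at a negative spin, and the jumps of length between m
    and 2m have total probability at least e m^(-\<alpha>).\<close>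
  define b where "b = 1 - exp (- 2 * \<beta>)"
  define e where "e = c1 * 2 powr - \<gamma>"
  define p where "p = minus_density"
  define \<delta> where "\<delta> = b * p * e / 4"
  have b: "0 < b" "b \<le> 1" unfolding b_def using assms by auto
  have p: "0 < p" "p \<le> 1" unfolding p_def using minus_density_pos minus_density_le_1 by auto
  have e: "0 < e" unfolding e_def using c1_pos by simp
  have \<delta>: "0 < \<delta>" unfolding \<delta>_def using b p e by simp
  have \<delta>_le: "4 * \<delta> \<le> e"
  proof -
    have "b * p * e \<le> 1 * 1 * e" using b p e by (intro mult_mono) auto
    then show ?thesis by (simp add: \<delta>_def)
  qed
  have mf: "real m * floor_K (2 * m) = e * real m powr - \<alpha>" if "1 \<le> m" for m
  proof -
    have "real m * floor_K (2 * m) = e * (real m powr 1 * real m powr - \<gamma>)"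
      using that unfolding floor_K_def e_def by (simp add: powr_mult)
    also have "real m powr 1 * real m powr - \<gamma> = real m powr - \<alpha>"
      by (simp only: powr_add[symmetric]) (simp add: assms(4))
    finally show ?thesis .
  qed
  obtain c where c: "0 < c"
    "\<And>m u. 1 \<le> m \<Longrightarrow> \<delta> * 2 powr - \<alpha> * real m powr - \<alpha> \<le> u \<Longrightarrow> u \<le> 1 \<Longrightarrow> c / real m \<le> F 0 u"
    using homogeneous_power[OF assms(2,3) _ up, of "\<delta> * 2 powr - \<alpha>"] \<delta> by auto
  have "(\<lambda>m. ln 2 * sparse_prob m) \<longlonglongrightarrow> ln 2 * 0"
    by (intro tendsto_mult tendsto_const prob_sparse_tendsto_0)
  then have "\<forall>\<^sub>F m in sequentially. ln 2 * sparse_prob m < \<epsilon> * c / 2"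
    by (rule order_tendstoD(2)) (use assms c in simp)
  then obtain M0 where M0: "\<And>m. M0 \<le> m \<Longrightarrow> ln 2 * sparse_prob m < \<epsilon> * c / 2"
    unfolding eventually_sequentially by blast
  define M where "M = max M0 n0"
  have M: "1 \<le> M" "n0 \<le> M" "M0 \<le> M" unfolding M_def using n0_pos by auto
  have small: "\<forall>\<^sub>F u in at_right 0. u < r" if "0 < r" for r :: real
    by (rule order_tendstoD(2)[OF tendsto_ident_at]) (rule that)
  have "\<forall>\<^sub>F u in at_right 0. u < 1 \<and> u < \<epsilon> * c / 2 \<and> u < \<delta> * real M powr - \<alpha> \<and> 0 < u"
    using c assms \<delta> M by (intro eventually_conj small eventually_at_right_less) auto
  then show ?thesis
  proof eventually_elim
    case (elim u)
    define R where "R = (\<delta> / u) powr (1 / \<alpha>)"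
    define m where "m = nat \<lfloor>R\<rfloor>"
    have R_pow: "R powr \<alpha> = \<delta> / u" unfolding R_def using assms elim \<delta> by (simp add: powr_powr)
    have R0: "0 < R" unfolding R_def using elim \<delta> by simp
    have "real M \<le> R"
    proof -
      have "u * real M powr \<alpha> \<le> \<delta> * real M powr - \<alpha> * real M powr \<alpha>"
        using elim by (intro mult_right_mono) auto
      also have "\<dots> = \<delta>" using M by (simp add: powr_minus field_simps)
      finally have "real M powr \<alpha> \<le> R powr \<alpha>"
        unfolding R_pow using elim by (simp add: pos_le_divide_eq mult.commute)
      moreover have "R powr \<alpha> < real M powr \<alpha>" if "R < real M"
        using that assms(2) R0 by (intro powr_less_mono2) auto
      ultimately show ?thesis by (meson leD leI)
    qed
    then have "M \<le> m" unfolding m_def by (simp add: le_nat_floor)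
    then have m: "1 \<le> m" "n0 \<le> m" "M0 \<le> m" using M by auto
    have mR: "real m \<le> R" unfolding m_def using R0 by simp
    have Rm: "R \<le> 2 * real m"
    proof -
      have "R < real m + 1" unfolding m_def using R0 by linarith
      then show ?thesis using m by simp
    qed
    have u_le: "u \<le> \<delta> * real m powr - \<alpha>"
    proof -
      have "real m powr \<alpha> \<le> \<delta> / u" unfolding R_pow[symmetric] using mR assms by (intro powr_mono2) auto
      then show ?thesis using elim m by (simp add: powr_minus field_simps)
    qed
    have u_ge: "\<delta> * 2 powr - \<alpha> * real m powr - \<alpha> \<le> u"
    proof -
      have "\<delta> / u \<le> (2 * real m) powr \<alpha>" unfolding R_pow[symmetric] using Rm R0 assms by (intro powr_mono2) auto
      then show ?thesis using elim m by (simp add: powr_minus powr_mult field_simps)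
    qed
    have "F \<beta> (- \<beta> + u) \<le> (u + ln 2 * sparse_prob m) / real m"
    proof (rule F_le_block)
      have "real m * floor_K (2 * m) = (\<Sum>i\<in>{m<..2 * m}. floor_K (2 * m))" by simp
      also have "\<dots> \<le> sum K {m<..2 * m}" using m by (intro sum_mono K_ge) auto
      also have "\<dots> \<le> tail m" by (rule tail_ge_sum)
      finally have t: "e * real m powr - \<alpha> \<le> tail m" using mf[OF m(1)] by simp
      have "4 * u \<le> 4 * \<delta> * real m powr - \<alpha>" using u_le by simp
      also have "\<dots> \<le> e * real m powr - \<alpha>" using \<delta>_le by (intro mult_right_mono) auto
      finally show "4 * u \<le> tail m" using t by simp
      have "floor_K (2 * m) * (1 - exp (- 2 * \<beta>)) * (minus_density / 2 * real m) = b * p / 2 * (real m * floor_K (2 * m))"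
        by (simp add: b_def p_def)
      also have "\<dots> = 2 * (\<delta> * real m powr - \<alpha>)" unfolding mf[OF m(1)] by (simp add: \<delta>_def)
      finally show "2 * u \<le> floor_K (2 * m) * (1 - exp (- 2 * \<beta>)) * (minus_density / 2 * real m)" using u_le by simp
    qed (use assms elim m in auto)
    also have "\<dots> \<le> \<epsilon> * c / real m"
      using M0[OF m(3)] elim by (intro divide_right_mono) auto
    also have "\<dots> = \<epsilon> * (c / real m)" by simp
    also have "\<dots> \<le> \<epsilon> * F 0 u" using c(2)[OF m(1) u_ge] elim assms by (intro mult_left_mono) auto
    finally show ?case .
  qed
qed

definition plus_block :: "nat \<Rightarrow> (nat \<Rightarrow> real) \<Rightarrow> bool" where
  "plus_block n s \<longleftrightarrow> (\<forall>i\<in>{1..n}. s i = 1)"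

lemma plus_block_measurable: "{s \<in> space S. plus_block n s} \<in> sets S"
  unfolding plus_block_def by measurable

lemma floor_K_ge_exp:
  assumes "1 \<le> d" "0 < r"
  shows "exp (ln c1 - \<gamma> * ln r - \<gamma> / r * real d) \<le> floor_K d"
proof -
  have "ln (real d / r) \<le> real d / r - 1" using assms by (intro ln_le_minus_one) auto
  then have "ln (real d) \<le> ln r + real d / r" using assms by (simp add: ln_div)
  then have "\<gamma> * ln (real d) \<le> \<gamma> * (ln r + real d / r)" using \<gamma>_nonneg by (intro mult_left_mono)
  then have "ln c1 - \<gamma> * ln r - \<gamma> / r * real d \<le> ln (floor_K d)"
    using assms by (simp add: ln_floor_K algebra_simps)
  then have "exp (ln c1 - \<gamma> * ln r - \<gamma> / r * real d) \<le> exp (ln (floor_K d))" by simp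
  then show ?thesis using floor_K_pos[OF assms(1)] by simp
qed

text \<open>
  Downward induction over the blocks. A block that is not fully positive is skipped at no cost,
  because the bound is stated for the jump crossing its left end. A fully positive one is entered
  \<open>n0\<close> sites after its left end, which keeps the entering jump in the range of the lower
  bound for K even when the previous block was visited too. The cost \<gamma>/r per site comes from
  the tangent to the logarithm at r.
\<close>
lemma crossing_ge_plus_blocks:
  fixes s :: "nat \<Rightarrow> real" and \<beta> u :: real
  defines "v \<equiv> weight \<beta> (- \<beta> + u) s"
  assumes "0 \<le> \<beta>" "0 \<le> u" "n0 \<le> n" "0 < r" "0 < D"
    and grow: "\<And>y k. (\<And>i. y < i \<Longrightarrow> i \<le> y + k \<Longrightarrow> s i = 1) \<Longrightarrow> D * exp (l * real k) \<le> Z v y k"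
    and \<Gamma>: "\<Gamma> = ln c1 - \<gamma> * ln r + ln D + l * real (n - n0)"
    and "j \<le> J" "x \<le> j * n"
  shows "floor_K (J * n + n0) * exp (\<Gamma> * (\<Sum>i\<in>{j..<J}. of_bool (plus_block n ((shift ^^ (i * n)) s))) - \<gamma> / r * (real (J * n) - real x))
    \<le> crossing v (J * n) (j * n) x"
  using \<open>j \<le> J\<close> \<open>x \<le> j * n\<close>
proof (induction j arbitrary: x rule: inc_induct)
  case base
  have "\<gamma> / r * (real (J * n) - real x) \<ge> 0"
    using base \<gamma>_nonneg assms(5) of_nat_mono[OF base] by (intro mult_nonneg_nonneg) auto
  then have "floor_K (J * n + n0) * exp (- (\<gamma> / r * (real (J * n) - real x))) \<le> floor_K (J * n + n0) * 1"
    using floor_K_pos[of "J * n + n0"] n0_pos by (intro mult_left_mono) auto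
  also have "\<dots> \<le> tail (J * n)" using tail_ge by simp
  also have "\<dots> \<le> tail (J * n - x)" by (rule tail_mono) simp
  finally show ?case by (simp add: crossing_def)
next
  case (step j)
  let ?N = "J * n" and ?f = "floor_K (J * n + n0)"
  let ?c = "\<lambda>j. \<Sum>i\<in>{j..<J}. of_bool (plus_block n ((shift ^^ (i * n)) s)) :: real"
  have v: "0 \<le> v i" for i unfolding v_def by (rule weight_nonneg)
  have f: "0 < ?f" using floor_K_pos n0_pos by simp
  have jJ: "Suc j * n \<le> ?N" using step by (intro mult_right_mono) auto
  have set: "{j..<J} = insert j {Suc j..<J}" using step by auto
  show ?case
  proof (cases "plus_block n ((shift ^^ (j * n)) s)")
    case False
    have "?f * exp (\<Gamma> * ?c (Suc j) - \<gamma> / r * (real ?N - real x)) \<le> crossing v ?N (Suc j * n) x"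
      using step.prems by (intro step.IH) simp
    also have "\<dots> \<le> crossing v ?N (j * n) x"
      unfolding crossing_def
      by (intro add_left_mono sum_mono2) (auto intro!: mult_nonneg_nonneg K_nonneg Z_nonneg v)
    finally show ?thesis using False by (simp add: set)
  next
    case True
    define y where "y = j * n + n0"
    have plus: "s i = 1" if "j * n < i" "i \<le> Suc j * n" for i
    proof -
      have "i - j * n \<in> {1..n}" using that by auto
      then show ?thesis using True that unfolding plus_block_def shift_pow by fastforce
    qed
    have y: "j * n < y" "y \<le> Suc j * n" "x < y" using n0_pos assms(4) step.prems by (auto simp: y_def)
    let ?\<rho> = "?f * exp (\<Gamma> * ?c (Suc j) - \<gamma> / r * (real ?N - real y))"
    have \<rho>: "0 \<le> ?\<rho>" using f by simp
    have "?\<rho> * (D * exp (l * real (n - n0))) \<le> ?\<rho> * Z v y (Suc j * n - y)"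
    proof (intro mult_left_mono \<rho>)
      have "n - n0 = Suc j * n - y" by (simp add: y_def)
      then show "D * exp (l * real (n - n0)) \<le> Z v y (Suc j * n - y)"
        by (simp only:) (rule grow, rule plus, use y in auto)
    qed
    also have "\<dots> \<le> Z v y (?N - y)"
    proof (rule Z_ge_crossing[OF v \<rho> y(2) jJ])
      fix a assume a: "y \<le> a" "a \<le> Suc j * n"
      have "\<gamma> / r * (real ?N - real a) \<le> \<gamma> / r * (real ?N - real y)"
        using a \<gamma>_nonneg assms(5) by (intro mult_left_mono) auto
      then have "?\<rho> \<le> ?f * exp (\<Gamma> * ?c (Suc j) - \<gamma> / r * (real ?N - real a))"
        using f by (intro mult_left_mono) auto
      also have "\<dots> \<le> crossing v ?N (Suc j * n) a" using a by (intro step.IH)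
      finally have "?\<rho> \<le> crossing v ?N (Suc j * n) a" .
      moreover have "?\<rho> * tail (Suc j * n - a) \<le> ?\<rho> * 1" using \<rho> tail_le_1 by (intro mult_left_mono)
      ultimately show "?\<rho> * tail (Suc j * n - a) \<le> crossing v ?N (Suc j * n) a" by simp
    qed
    finally have Z: "?\<rho> * (D * exp (l * real (n - n0))) \<le> Z v y (?N - y)" .
    have vy: "1 \<le> v y" using weight_shifted(3)[of \<beta> s y u] plus[OF y(1,2)] assms(2,3) by (simp add: v_def)
    have Kxy: "exp (ln c1 - \<gamma> * ln r - \<gamma> / r * real (y - x)) \<le> K (y - x)"
    proof -
      have "n0 \<le> y - x" using step.prems by (simp add: y_def)
      moreover have "1 \<le> y - x" using y by simp
      ultimately show ?thesis using floor_K_ge_exp[of "y - x" r] K_ge[of "y - x" "y - x"] assms(5) by simp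
    qed
    have "?f * exp (\<Gamma> * ?c j - \<gamma> / r * (real ?N - real x))
        = exp (ln c1 - \<gamma> * ln r - \<gamma> / r * real (y - x)) * 1 * (?\<rho> * (D * exp (l * real (n - n0))))"
    proof -
      have cj: "?c j = 1 + ?c (Suc j)" using True by (simp add: set)
      have D: "D = exp (ln D)" using assms(6) by simp
      have yx: "real (y - x) = real y - real x" using y by (simp add: of_nat_diff)
      have "\<Gamma> * ?c j - \<gamma> / r * (real ?N - real x)
         = (ln c1 - \<gamma> * ln r - \<gamma> / r * real (y - x)) + (\<Gamma> * ?c (Suc j) - \<gamma> / r * (real ?N - real y)) + (ln D + l * real (n - n0))"
        unfolding cj yx by (simp add: \<Gamma> algebra_simps)
      then show ?thesis by (subst D) (simp only: exp_add mult_ac mult_1_left mult_1_right)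
    qed
    also have "\<dots> \<le> K (y - x) * v y * Z v y (?N - y)"
    proof (rule mult_mono[OF mult_mono[OF Kxy vy] Z])
      show "0 \<le> ?\<rho> * (D * exp (l * real (n - n0)))"
        using f assms(6) by (intro mult_nonneg_nonneg) (simp_all add: less_imp_le)
    qed (use K_nonneg v in auto)
    also have "\<dots> \<le> crossing v ?N (j * n) x"
      by (rule crossing_ge_step) (use v y jJ in auto)
    finally show ?thesis .
  qed
qed

text \<open>
  With r = n/p for p the probability of a positive block, the linear part of the jump cost equals
  \<gamma> p per block, while a block earns \<Gamma> p on average; so it suffices to reach \<Gamma> >
  \<gamma>.
\<close>
lemma F_pos_of_long_plus_blocks:
  assumes "0 \<le> \<beta>" "0 < u"
    and runs: "\<And>e n1. 0 < e \<Longrightarrow> \<exists>n\<ge>n1. exp (- e * real n) \<le> prob {s \<in> space S. plus_block n s}"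
  shows "0 < F \<beta> (- \<beta> + u)"
proof -
  have "\<forall>\<^sub>F A in sequentially. tail A < 1 - exp (- (u / 2))"
    using assms by (intro order_tendstoD(2)[OF tail_tendsto_0]) auto
  then have "\<forall>\<^sub>F A in sequentially. 1 \<le> A \<and> tail A < 1 - exp (- (u / 2))"
    using eventually_ge_at_top[of 1] by eventually_elim simp
  from eventually_happens'[OF sequentially_bot this]
  obtain A where A: "1 \<le> A" "tail A < 1 - exp (- (u / 2))" by blast
  \<comment> \<open>Half of the gain u compensates the truncation at A, the other half yields the rate
    l.\<close>
  define l where "l = u / (2 * real A)"
  have l: "0 < l" unfolding l_def using A assms by simp
  have crit: "1 \<le> exp u * (\<Sum>a=1..A. K a * exp (- l * real a))"
  proof -
    have "exp (- (u / 2)) * exp (- (u / 2)) \<le> (\<Sum>a=1..A. K a) * exp (- (u / 2))"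
      using A tail_plus_sum[of A] by (intro mult_right_mono) auto
    also have "\<dots> = (\<Sum>a=1..A. K a * exp (- (u / 2)))" by (simp add: sum_distrib_right)
    also have "\<dots> \<le> (\<Sum>a=1..A. K a * exp (- l * real a))"
    proof (intro sum_mono mult_left_mono K_nonneg)
      fix a assume a: "a \<in> {1..A}"
      have "l * real a \<le> l * real A" using a l by (intro mult_left_mono) auto
      also have "\<dots> = u / 2" using A by (simp add: l_def)
      finally show "exp (- (u / 2)) \<le> exp (- l * real a)" by simp
    qed
    finally have "exp u * (exp (- (u / 2)) * exp (- (u / 2))) \<le> exp u * (\<Sum>a=1..A. K a * exp (- l * real a))"
      by (intro mult_left_mono) auto
    then show ?thesis by (simp add: exp_add[symmetric])
  qed
  define D where "D = tail A * exp (- l * real A)"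
  have D: "0 < D" unfolding D_def using tail_pos by simp
  have grow: "D * exp (l * real k) \<le> Z (weight \<beta> (- \<beta> + u) s) y k"
    if "\<And>i. y < i \<Longrightarrow> i \<le> y + k \<Longrightarrow> s i = 1" for s y k
    unfolding D_def
  proof (rule Z_growth[where p="exp u"])
    show "exp u \<le> weight \<beta> (- \<beta> + u) s i" if "y < i" "i \<le> y + k" for i
      using weight_shifted(3)[OF assms(1), of s i u] \<open>\<And>i. y < i \<Longrightarrow> i \<le> y + k \<Longrightarrow> s i = 1\<close>[OF that] by simp
  qed (use crit l weight_nonneg in auto)
  define C where "C = ln c1 + ln D - l * real n0"
  have "filterlim (\<lambda>n. l * real n / 2 - \<gamma> * ln (real n) + C) at_top sequentially"
    using l by real_asymp
  then have "\<forall>\<^sub>F n in sequentially. \<gamma> + 1 \<le> l * real n / 2 - \<gamma> * ln (real n) + C"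
    unfolding filterlim_at_top by blast
  then obtain n1 where n1: "\<And>n. n1 \<le> n \<Longrightarrow> \<gamma> + 1 \<le> l * real n / 2 - \<gamma> * ln (real n) + C"
    unfolding eventually_sequentially by blast
  \<comment> \<open>The cost \<gamma> e n of finding a positive block must not exceed half of its gain
    l n.\<close>
  define e where "e = l / (2 * (\<gamma> + 1))"
  have e: "0 < e" unfolding e_def using l \<gamma>_nonneg by simp
  have \<gamma>e: "\<gamma> * e \<le> l / 2"
  proof -
    have "\<gamma> * e \<le> (\<gamma> + 1) * e" using e by simp
    also have "\<dots> = l / 2" unfolding e_def using \<gamma>_nonneg by (simp add: field_simps)
    finally show ?thesis .
  qed
  obtain n where n: "max n1 n0 \<le> n" "exp (- e * real n) \<le> prob {s \<in> space S. plus_block n s}"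
    using runs[OF e] by blast
  define p where "p = prob {s \<in> space S. plus_block n s}"
  have n': "n1 \<le> n" "n0 \<le> n" "0 < real n" using n(1) n0_pos by auto
  have p: "0 < p" unfolding p_def using n(2) by (meson exp_gt_zero less_le_trans)
  have lnp: "- e * real n \<le> ln p"
    using n(2) p unfolding p_def by (metis ln_exp ln_mono exp_gt_zero)
  define r where "r = real n / p"
  have r: "0 < r" unfolding r_def using n' p by simp
  define \<Gamma> where "\<Gamma> = ln c1 - \<gamma> * ln r + ln D + l * real (n - n0)"
  have "\<gamma> + 1 \<le> \<Gamma>"
  proof -
    have "ln r \<le> ln (real n) + e * real n" unfolding r_def using n' p lnp by (simp add: ln_div)
    then have "\<gamma> * ln r \<le> \<gamma> * (ln (real n) + e * real n)" using \<gamma>_nonneg by (intro mult_left_mono)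
    also have "\<dots> \<le> \<gamma> * ln (real n) + l / 2 * real n"
      using mult_right_mono[OF \<gamma>e, of "real n"] by (simp add: algebra_simps)
    finally have "\<gamma> * ln r \<le> \<gamma> * ln (real n) + l / 2 * real n" .
    moreover have "l * real (n - n0) = l * real n - l * real n0" using n' by (simp add: of_nat_diff algebra_simps)
    ultimately show ?thesis using n1[OF n'(1)] unfolding \<Gamma>_def C_def by simp
  qed
  have meas: "{s \<in> space S. plus_block n ((shift ^^ z) s)} \<in> sets S" for z
    unfolding plus_block_def shift_pow by measurable
  have int: "integrable S (\<lambda>s. of_bool (plus_block n ((shift ^^ z) s)) :: real)" for z
    by (intro expectation_of_bool(1) meas)
  have "(\<Gamma> - \<gamma>) * p / real n \<le> F \<beta> (- \<beta> + u)"
  proof (rule F_ge[where k=n and b=\<gamma> and d="- ln c1"])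
    fix J
    let ?c = "\<lambda>s. \<Sum>i\<in>{0..<J}. of_bool (plus_block n ((shift ^^ (i * n)) s)) :: real"
    have ge: "ln (floor_K (J * n + n0)) + (\<Gamma> * ?c s - \<gamma> / r * real (J * n)) \<le> lnZ \<beta> (- \<beta> + u) (J * n) s" for s
    proof -
      let ?v = "weight \<beta> (- \<beta> + u) s"
      have f: "0 < floor_K (J * n + n0)" using floor_K_pos n0_pos by simp
      have "floor_K (J * n + n0) * exp (\<Gamma> * ?c s - \<gamma> / r * (real (J * n) - real 0)) \<le> crossing ?v (J * n) (0 * n) 0"
        by (rule crossing_ge_plus_blocks[where l=l and D=D]) (use assms n' r D grow in \<open>auto simp: \<Gamma>_def\<close>)
      also have "\<dots> = Z ?v 0 (J * n)"
        using Z_abs[of 0 "J * n" ?v] by (simp add: crossing_def)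
      finally have "ln (floor_K (J * n + n0) * exp (\<Gamma> * ?c s - \<gamma> / r * real (J * n))) \<le> lnZ \<beta> (- \<beta> + u) (J * n) s"
        unfolding lnZ_def using f by (intro ln_mono) auto
      then show ?thesis using f by (simp add: ln_mult)
    qed
    have int': "integrable S (\<lambda>s. ln (floor_K (J * n + n0)) + (\<Gamma> * ?c s - \<gamma> / r * real (J * n)))"
      by (intro Bochner_Integration.integrable_add Bochner_Integration.integrable_diff integrable_mult_right Bochner_Integration.integrable_sum int) auto
    have ec: "expectation ?c = real J * p"
    proof -
      have ez: "expectation (\<lambda>s. of_bool (plus_block n ((shift ^^ z) s))) = p" for z
        unfolding p_def by (simp only: expectation_of_bool(2)[OF meas] prob_T_pow[OF meas[of 0, simplified]])
      show ?thesis by (simp only: Bochner_Integration.integral_sum[OF int] ez sum_constant card_atLeastLessThan diff_zero)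
    qed
    have "expectation (\<lambda>s. ln (floor_K (J * n + n0)) + (\<Gamma> * ?c s - \<gamma> / r * real (J * n))) \<le> expectation (lnZ \<beta> (- \<beta> + u) (J * n))"
      by (intro integral_mono int' lnZ_integrable ge)
    also have "expectation (\<lambda>s. ln (floor_K (J * n + n0)) + (\<Gamma> * ?c s - \<gamma> / r * real (J * n)))
       = ln (floor_K (J * n + n0)) + (\<Gamma> * (real J * p) - \<gamma> / r * real (J * n))"
    proof -
      have i1: "integrable S (\<lambda>s. \<Gamma> * ?c s)"
        by (intro integrable_mult_right Bochner_Integration.integrable_sum int)
      show ?thesis
        by (subst Bochner_Integration.integral_add, simp, intro Bochner_Integration.integrable_diff i1, simp,
            subst Bochner_Integration.integral_diff[OF i1], simp, subst integral_mult_right_zero, subst ec)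
           (simp add: prob_space)
    qed
    also have "ln (floor_K (J * n + n0)) = ln c1 - \<gamma> * ln (real (J * n + n0))" using n0_pos by (intro ln_floor_K) simp
    also have "\<gamma> / r * real (J * n) = \<gamma> * (real J * p)" using n' by (simp add: r_def)
    finally have bound: "ln c1 - \<gamma> * ln (real (J * n + n0)) + (\<Gamma> * (real J * p) - \<gamma> * (real J * p))
      \<le> expectation (lnZ \<beta> (- \<beta> + u) (J * n))" .
    have "(\<Gamma> - \<gamma>) * p / real n * real (J * n) = (\<Gamma> - \<gamma>) * (real J * p)"
      using n' by simp
    also have "\<dots> = \<Gamma> * (real J * p) - \<gamma> * (real J * p)" by (rule left_diff_distrib)
    finally have "(\<Gamma> - \<gamma>) * p / real n * real (J * n) = \<Gamma> * (real J * p) - \<gamma> * (real J * p)" .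
    with bound show "(\<Gamma> - \<gamma>) * p / real n * real (J * n) - \<gamma> * ln (real (J * n + n0)) - - ln c1 \<le> expectation (lnZ \<beta> (- \<beta> + u) (J * n))"
      by linarith
  qed (use n' in auto)
  moreover have "0 < (\<Gamma> - \<gamma>) * p / real n" using \<open>\<gamma> + 1 \<le> \<Gamma>\<close> p n' by simp
  ultimately show ?thesis by simp
qed

end

section \<open>Transfer to the random environment\<close>

context environment
begin

abbreviation "trajectory x \<equiv> (\<lambda>i. \<omega> i x)"

lemma trajectory_measurable: "trajectory \<in> M \<rightarrow>\<^sub>M PiM UNIV (\<lambda>_. borel)"
  by (rule measurable_PiM_single') (auto simp: random_variables)

lemma measure_sequence_law:
  assumes "{s. Q s} \<in> sets (PiM UNIV (\<lambda>_. borel))"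
  shows "measure (sequence_law M \<omega>) {s. Q s} = prob {x \<in> space M. Q (trajectory x)}"
proof -
  have "trajectory -` {s. Q s} \<inter> space M = {x \<in> space M. Q (trajectory x)}" by auto
  then show ?thesis unfolding sequence_law_def using measure_distr[OF trajectory_measurable assms] by simp
qed

lemma sets_sequence_law: "sets (sequence_law M \<omega>) = sets (PiM UNIV (\<lambda>_. borel))"
  and space_sequence_law: "space (sequence_law M \<omega>) = UNIV"
  by (auto simp: sequence_law_def space_PiM)

lemma shift_measurable: "shift \<in> PiM UNIV (\<lambda>_. borel) \<rightarrow>\<^sub>M PiM UNIV (\<lambda>_. borel :: real measure)"
  unfolding shift_def by (rule measurable_PiM_single') auto

lemma distr_shift: "distr (sequence_law M \<omega>) (PiM UNIV (\<lambda>_. borel)) shift = sequence_law M \<omega>"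
proof -
  have "distr (sequence_law M \<omega>) (PiM UNIV (\<lambda>_. borel)) shift = distr M (PiM UNIV (\<lambda>_. borel)) (shift \<circ> trajectory)"
    unfolding sequence_law_def by (rule distr_distr[OF shift_measurable trajectory_measurable])
  also have "shift \<circ> trajectory = (\<lambda>x i. \<omega> (Suc i) x)" by (auto simp: shift_def)
  finally show ?thesis using stationary unfolding sequence_law_def by simp
qed

lemma ergodic_map_shift: "ergodic_map (sequence_law M \<omega>) shift"
proof -
  interpret S: prob_space "sequence_law M \<omega>"
    unfolding sequence_law_def by (rule prob_space_distr[OF trajectory_measurable])
  show ?thesis
  proof unfold_locales
    show "shift \<in> sequence_law M \<omega> \<rightarrow>\<^sub>M sequence_law M \<omega>"
      using shift_measurable by (simp only: measurable_cong_sets[OF sets_sequence_law sets_sequence_law])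
    show "distr (sequence_law M \<omega>) (sequence_law M \<omega>) shift = sequence_law M \<omega>"
      using distr_shift by (subst distr_cong[OF refl sets_sequence_law refl])
    fix A assume "A \<in> sets (sequence_law M \<omega>)" "shift -` A \<inter> space (sequence_law M \<omega>) = A"
    then show "measure (sequence_law M \<omega>) A \<in> {0, 1}"
      by (intro ergodic) (auto simp: sets_sequence_law space_sequence_law shift_def vimage_def)
  qed
qed

lemma component_set_sequence_law: "{s. s n \<noteq> (1::real)} \<in> sets (PiM UNIV (\<lambda>_::nat. borel))"
proof -
  have "{s \<in> space (PiM UNIV (\<lambda>_::nat. borel :: real measure)). s n \<noteq> 1} \<in> sets (PiM UNIV (\<lambda>_. borel))"
    by measurable
  then show ?thesis by (simp add: space_PiM)
qed

text \<open>
  The assumption concerns the position 1; stationarity moves it to the origin.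
\<close>
lemma minus_prob_pos: "0 < measure (sequence_law M \<omega>) {s \<in> space (sequence_law M \<omega>). s 0 \<noteq> 1}"
proof -
  let ?S = "sequence_law M \<omega>"
  interpret S: ergodic_map ?S shift by (rule ergodic_map_shift)
  have "{x \<in> space M. trajectory x 1 \<noteq> 1} = {x \<in> space M. \<omega> 1 x = -1}" using plus_minus by fastforce
  then have "0 < measure ?S {s. s 1 \<noteq> 1}"
    using nontrivial_minus measure_sequence_law[OF component_set_sequence_law[of 1]] by simp
  also have "measure ?S {s. s 1 \<noteq> 1} = measure ?S {s \<in> space ?S. (shift ^^ 1) s 0 \<noteq> 1}"
    by (simp add: space_sequence_law shift_def)
  also have "\<dots> = measure ?S {s \<in> space ?S. s 0 \<noteq> 1}"
    by (rule S.prob_T_pow) (use component_set_sequence_law[of 0] in \<open>simp add: space_sequence_law sets_sequence_law\<close>)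
  finally show ?thesis .
qed

lemma spin_pinning:
  assumes "polynomial_kernel K n0 c1 \<gamma>"
  shows "spin_pinning K n0 c1 \<gamma> (sequence_law M \<omega>)"
  using assms ergodic_map_shift minus_prob_pos sets_sequence_law
  by (intro spin_pinning.intro spin_pinning_axioms.intro)

text \<open>
  A vanishing lower limit of the rates produces arbitrarily long runs whose probability decays more
  slowly than any given exponential; runs of probability zero have an infinite rate and do not
  interfere.
\<close>
lemma long_plus_blocks:
  assumes "infinite_disorder M \<omega>" "0 < e"
  shows "\<exists>n\<ge>n1. exp (- e * real n) \<le> prob {x \<in> space M. \<forall>i\<in>{1..n}. \<omega> i x = 1}"
proof -
  have "liminf (all_plus_rate M \<omega>) < ereal e" using assms by (simp add: infinite_disorder_def)
  then have "\<exists>\<^sub>F n in sequentially. all_plus_rate M \<omega> n < ereal e"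
    using le_Liminf_iff[of "ereal e" sequentially "all_plus_rate M \<omega>"] Liminf_bounded[of "ereal e" "all_plus_rate M \<omega>" sequentially]
    by (auto simp: frequently_def not_less not_le[symmetric])
  then have "\<exists>n\<ge>max n1 1. all_plus_rate M \<omega> n < ereal e"
    unfolding frequently_sequentially by blast
  then obtain n where n: "max n1 1 \<le> n" "all_plus_rate M \<omega> n < ereal e" by blast
  let ?p = "prob {x \<in> space M. \<forall>i\<in>{1..n}. \<omega> i x = 1}"
  have p0: "?p \<noteq> 0" using n(2) unfolding all_plus_rate_def Let_def by (auto split: if_splits)
  then have p: "0 < ?p" by (simp add: zero_less_measure_iff)
  have "- (1 / real n) * ln ?p < e" using n(2) p0 unfolding all_plus_rate_def Let_def by simp
  then have "- e * real n \<le> ln ?p" using n(1) by (simp add: field_simps)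
  then have "exp (- e * real n) \<le> exp (ln ?p)" by (subst exp_le_cancel_iff)
  then have "exp (- e * real n) \<le> ?p" using p by (simp only: exp_ln)
  then show ?thesis using n(1) by (intro exI[of _ n] conjI) simp_all
qed

end

locale disordered_pinning = renewal_process P \<tau> + E: environment M \<omega>
  for P :: "'a measure" and \<tau> and M :: "'b measure" and \<omega> +
  fixes n0 :: nat and c1 \<gamma> :: real
  assumes kernel: "polynomial_kernel K n0 c1 \<gamma>"
begin

abbreviation "S \<equiv> sequence_law M \<omega>"

sublocale spin: spin_pinning K n0 c1 \<gamma> S
  by (rule E.spin_pinning[OF kernel])

text \<open>
  The definite description in the definition of the free energy is met by the limit on the sequence
  space: almost sure convergence transfers along the trajectory map, and almost sure limits are
  unique.
\<close>
lemma free_energy_eq: "free_energy P \<tau> M \<omega> \<beta> h = spin.F \<beta> h"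
proof -
  have lnZ: "1 / real N * ln (partition_function P \<tau> \<beta> h (\<lambda>i. \<omega> i x) N) = spin.lnZ \<beta> h N (\<lambda>i. \<omega> i x) / real N"
    if "x \<in> space M" for x N
  proof -
    have "(\<lambda>i. exp (h + \<beta> * \<omega> i x)) = weight \<beta> h (\<lambda>i. \<omega> i x)"
    proof
      fix i
      have "\<omega> i x = -1 \<or> \<omega> i x = 1" using E.plus_minus[OF that, of i] by auto
      then show "exp (h + \<beta> * \<omega> i x) = weight \<beta> h (\<lambda>i. \<omega> i x) i" by (auto simp: weight_def)
    qed
    then show ?thesis unfolding spin.lnZ_def partition_function_eq_Z by simp
  qed
  have "AE s in S. (\<lambda>N. spin.lnZ \<beta> h N s / real N) \<longlonglongrightarrow> spin.F \<beta> h" by (rule spin.F_AE)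
  then have "AE x in M. (\<lambda>N. spin.lnZ \<beta> h N (\<lambda>i. \<omega> i x) / real N) \<longlonglongrightarrow> spin.F \<beta> h"
    unfolding sequence_law_def by (rule AE_distrD[OF E.trajectory_measurable])
  then have lim: "AE x in M. (\<lambda>N. 1 / real N * ln (partition_function P \<tau> \<beta> h (\<lambda>i. \<omega> i x) N)) \<longlonglongrightarrow> spin.F \<beta> h"
    by (rule AE_mp) (auto intro!: AE_I2 simp: lnZ simp del: times_divide_eq_left)
  show ?thesis
    unfolding free_energy_def
  proof (rule the_equality)
    show "AE x in M. (\<lambda>N. 1 / real N * ln (partition_function P \<tau> \<beta> h (\<lambda>i. \<omega> i x) N)) \<longlonglongrightarrow> spin.F \<beta> h"
      by (rule lim)
    fix c assume "AE x in M. (\<lambda>N. 1 / real N * ln (partition_function P \<tau> \<beta> h (\<lambda>i. \<omega> i x) N)) \<longlonglongrightarrow> c"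
    with lim have "AE x in M. c = spin.F \<beta> h"
      by eventually_elim (rule LIMSEQ_unique)
    then show "c = spin.F \<beta> h" by simp
  qed
qed

lemma critical_point_eq:
  assumes "0 < \<beta>" "infinite_disorder M \<omega>"
  shows "critical_point P \<tau> M \<omega> \<beta> = - \<beta>"
proof -
  have runs: "\<exists>n\<ge>n1. exp (- e * real n) \<le> spin.prob {s \<in> space S. spin.plus_block n s}" if e: "0 < e" for e n1
  proof -
    obtain n where n: "n1 \<le> n" "exp (- e * real n) \<le> E.prob {x \<in> space M. \<forall>i\<in>{1..n}. \<omega> i x = 1}"
      using E.long_plus_blocks[OF assms(2) e] by blast
    have "{s \<in> space S. spin.plus_block n s} \<in> sets S" by (rule spin.plus_block_measurable)
    then have "{s. spin.plus_block n s} \<in> sets (PiM UNIV (\<lambda>_. borel))"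
      by (simp only: E.space_sequence_law E.sets_sequence_law UNIV_I simp_thms)
    then have "measure S {s. spin.plus_block n s} = E.prob {x \<in> space M. spin.plus_block n (\<lambda>i. \<omega> i x)}"
      by (rule E.measure_sequence_law)
    also have "{x \<in> space M. spin.plus_block n (\<lambda>i. \<omega> i x)} = {x \<in> space M. \<forall>i\<in>{1..n}. \<omega> i x = 1}"
      by (simp only: spin.plus_block_def)
    finally show ?thesis using n by (intro exI[of _ n]) (simp add: E.space_sequence_law)
  qed
  have pos: "0 < free_energy P \<tau> M \<omega> \<beta> h \<longleftrightarrow> - \<beta> < h" for h
  proof
    assume "0 < free_energy P \<tau> M \<omega> \<beta> h"
    then show "- \<beta> < h" using spin.F_nonpos[of \<beta> h] assms(1) unfolding free_energy_eq by (meson less_imp_le not_le)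
  next
    assume "- \<beta> < h"
    then have "0 < spin.F \<beta> (- \<beta> + (h + \<beta>))"
      using assms(1) runs by (intro spin.F_pos_of_long_plus_blocks) auto
    then show "0 < free_energy P \<tau> M \<omega> \<beta> h" unfolding free_energy_eq by simp
  qed
  show ?thesis
    unfolding critical_point_def
  proof (rule the_equality)
    show "\<forall>h. 0 < free_energy P \<tau> M \<omega> \<beta> h \<longleftrightarrow> - \<beta> < h" using pos by blast
    fix hc assume "\<forall>h. 0 < free_energy P \<tau> M \<omega> \<beta> h \<longleftrightarrow> hc < h"
    then have "\<And>h. hc < h \<longleftrightarrow> - \<beta> < h" using pos by blast
    then show "hc = - \<beta>" by (meson less_irrefl linorder_neqE)
  qed
qed

lemma small_oI:
  assumes "\<And>\<epsilon>. 0 < \<epsilon> \<Longrightarrow> \<forall>\<^sub>F u in at_right 0. spin.F \<beta> (- \<beta> + u) \<le> \<epsilon> * spin.F 0 u"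
  shows "(\<lambda>u. free_energy P \<tau> M \<omega> \<beta> (- \<beta> + u)) \<in> o[at_right 0](\<lambda>u. free_energy P \<tau> M \<omega> 0 u)"
proof (rule landau_o.smallI)
  fix c :: real assume "0 < c"
  from assms[OF this] show "\<forall>\<^sub>F u in at_right 0. norm (free_energy P \<tau> M \<omega> \<beta> (- \<beta> + u)) \<le> c * norm (free_energy P \<tau> M \<omega> 0 u)"
    by eventually_elim (simp add: free_energy_eq spin.F_nonneg)
qed

end

lemma asymptotic_power_bounds:
  fixes K :: "nat \<Rightarrow> real"
  assumes "K \<sim>[at_top] (\<lambda>n. c * real n powr - \<gamma>)" "0 < c"
  obtains n0 C where "1 \<le> n0" "\<And>n. n0 \<le> n \<Longrightarrow> c / 2 * real n powr - \<gamma> \<le> K n"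
    "\<And>n. 1 \<le> n \<Longrightarrow> K n \<le> C * real n powr - \<gamma>"
proof -
  let ?g = "\<lambda>n. c * real n powr - \<gamma>"
  have lim: "((\<lambda>n. K n / ?g n) \<longlongrightarrow> 1) at_top"
    using assms by (intro asymp_equivD_strong) (auto intro!: eventually_mono[OF eventually_gt_at_top[of 0]])
  have "\<forall>\<^sub>F n in at_top. 1 / 2 < K n / ?g n" by (rule order_tendstoD(1)[OF lim]) simp
  moreover have "\<forall>\<^sub>F n in at_top. K n / ?g n < 2" by (rule order_tendstoD(2)[OF lim]) simp
  ultimately have "\<forall>\<^sub>F n in at_top. 1 \<le> n \<and> c / 2 * real n powr - \<gamma> \<le> K n \<and> K n \<le> 2 * c * real n powr - \<gamma>"
    using eventually_ge_at_top[of 1]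
  proof eventually_elim
    case (elim n)
    then have "0 < ?g n" using assms(2) by simp
    then show ?case using elim by (simp add: field_simps)
  qed
  then obtain n0 where n0: "\<And>n. n0 \<le> n \<Longrightarrow> 1 \<le> n \<and> c / 2 * real n powr - \<gamma> \<le> K n \<and> K n \<le> 2 * c * real n powr - \<gamma>"
    unfolding eventually_sequentially by blast
  define C where "C = 2 * c + (\<Sum>n\<in>{1..n0}. \<bar>K n\<bar> * real n powr \<gamma>)"
  have "K n \<le> C * real n powr - \<gamma>" if n: "1 \<le> n" for n
  proof (cases "n0 \<le> n")
    case True
    have "K n \<le> 2 * c * real n powr - \<gamma>" using n0[OF True] by simp
    also have "\<dots> \<le> C * real n powr - \<gamma>"
      unfolding C_def by (intro mult_right_mono) (auto intro!: sum_nonneg)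
    finally show ?thesis .
  next
    case False
    have "\<bar>K n\<bar> * real n powr \<gamma> \<le> (\<Sum>n\<in>{1..n0}. \<bar>K n\<bar> * real n powr \<gamma>)"
      using False n by (intro member_le_sum) auto
    then have "\<bar>K n\<bar> * real n powr \<gamma> \<le> C" using assms(2) by (simp add: C_def)
    then have "\<bar>K n\<bar> * real n powr \<gamma> * real n powr - \<gamma> \<le> C * real n powr - \<gamma>"
      by (intro mult_right_mono) auto
    moreover have "real n powr \<gamma> * real n powr - \<gamma> = 1" using n by (simp add: powr_add[symmetric])
    ultimately have "\<bar>K n\<bar> \<le> C * real n powr - \<gamma>" by (simp only: mult.assoc mult_1_right)
    then show ?thesis by simp
  qed
  then show ?thesis using n0 n0[of n0] by (intro that[of n0 C]) auto
qed

lemma disordered_pinning_small_o: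
  fixes P :: "'a measure" and M :: "'b measure"
  assumes "disordered_pinning P \<tau> M \<omega> n0 c1 (1 + \<alpha>)" "0 < \<alpha>" "\<alpha> \<noteq> 1" "0 < \<beta>"
    and up: "\<And>n. 1 \<le> n \<Longrightarrow> inter_arrival_law P \<tau> n \<le> C * real n powr - (1 + \<alpha>)"
  shows "(\<lambda>u. free_energy P \<tau> M \<omega> \<beta> (- \<beta> + u)) \<in> o[at_right 0](\<lambda>u. free_energy P \<tau> M \<omega> 0 u)"
proof -
  interpret disordered_pinning P \<tau> M \<omega> n0 c1 "1 + \<alpha>" by fact
  show ?thesis
  proof (rule small_oI)
    fix \<epsilon> :: real assume \<epsilon>: "0 < \<epsilon>"
    show "\<forall>\<^sub>F u in at_right 0. spin.F \<beta> (- \<beta> + u) \<le> \<epsilon> * spin.F 0 u"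
    proof (cases "\<alpha> < 1")
      case True
      show ?thesis
        by (rule spin.small_o_of_infinite_mean[OF assms(4,2) True refl \<epsilon> up])
    next
      case False
      then have \<alpha>: "1 < \<alpha>" using assms(3) by simp
      have "summable (\<lambda>a. real a * K a)"
      proof (rule summable_comparison_test')
        show "summable (\<lambda>a. C * real a powr - \<alpha>)"
          using \<alpha> by (intro summable_mult) (simp add: summable_real_powr_iff)
        fix a :: nat assume a: "1 \<le> a"
        have "real a * K a \<le> real a * (C * real a powr - (1 + \<alpha>))" using up[OF a] by (intro mult_left_mono) auto
        also have "\<dots> = C * (real a powr 1 * real a powr - (1 + \<alpha>))" using a by simp
        also have "\<dots> = C * real a powr - \<alpha>" by (simp only: powr_add[symmetric]) simp
        finally show "norm (real a * K a) \<le> C * real a powr - \<alpha>" using K_nonneg[of a] by simp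
      qed
      then show ?thesis by (rule spin.small_o_of_finite_mean[OF assms(4) _ \<epsilon>])
    qed
  qed
qed

theorem theorem1p7:
  fixes P :: "'a measure" and \<tau> :: "nat \<Rightarrow> 'a \<Rightarrow> nat"
    and M :: "'b measure" and \<omega> :: "nat \<Rightarrow> 'b \<Rightarrow> real"
    and \<alpha> c\<^sub>K :: real
  assumes "renewal_process P \<tau>"
    and "\<alpha> > 0" and "\<alpha> \<noteq> 1" and "c\<^sub>K > 0"
    and "inter_arrival_law P \<tau> \<sim>[at_top] (\<lambda>n. c\<^sub>K * real n powr (- (1 + \<alpha>)))"
    and "environment M \<omega>"
  shows "(\<forall>\<beta>>0. critical_point P \<tau> M \<omega> \<beta> = - \<beta> \<longrightarrow>
            (\<lambda>u. free_energy P \<tau> M \<omega> \<beta> (- \<beta> + u))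
              \<in> o[at_right 0](\<lambda>u. free_energy P \<tau> M \<omega> 0 u)) \<and>
         (infinite_disorder M \<omega> \<longrightarrow>
           (\<forall>\<beta>>0. critical_point P \<tau> M \<omega> \<beta> = - \<beta> \<and>
            (\<lambda>u. free_energy P \<tau> M \<omega> \<beta> (- \<beta> + u))
              \<in> o[at_right 0](\<lambda>u. free_energy P \<tau> M \<omega> 0 u)))"
proof -
  interpret renewal_process P \<tau> by fact
  obtain n0 C where n0: "1 \<le> n0"
    "\<And>n. n0 \<le> n \<Longrightarrow> c\<^sub>K / 2 * real n powr - (1 + \<alpha>) \<le> inter_arrival_law P \<tau> n"
    and up: "\<And>n. 1 \<le> n \<Longrightarrow> inter_arrival_law P \<tau> n \<le> C * real n powr - (1 + \<alpha>)"
    by (rule asymptotic_power_bounds[OF assms(5,4)]) (rule that)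
  have "polynomial_kernel (inter_arrival_law P \<tau>) n0 (c\<^sub>K / 2) (1 + \<alpha>)"
    using n0 assms(2,4) by unfold_locales auto
  then have D: "disordered_pinning P \<tau> M \<omega> n0 (c\<^sub>K / 2) (1 + \<alpha>)"
    using assms(1,6) by (intro disordered_pinning.intro disordered_pinning_axioms.intro)
  show ?thesis
  proof (intro conjI allI impI)
    fix \<beta> :: real assume \<beta>: "0 < \<beta>"
    show o: "(\<lambda>u. free_energy P \<tau> M \<omega> \<beta> (- \<beta> + u)) \<in> o[at_right 0](\<lambda>u. free_energy P \<tau> M \<omega> 0 u)"
      by (rule disordered_pinning_small_o[OF D assms(2,3) \<beta> up])
    show "(\<lambda>u. free_energy P \<tau> M \<omega> \<beta> (- \<beta> + u)) \<in> o[at_right 0](\<lambda>u. free_energy P \<tau> M \<omega> 0 u)"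
      by (rule o)
    assume "infinite_disorder M \<omega>"
    then show "critical_point P \<tau> M \<omega> \<beta> = - \<beta>"
      by (rule disordered_pinning.critical_point_eq[OF D \<beta>])
  qed
qed

end
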